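(* Let $N\ge1$, $K\ge0$, $\varphi\in L^1_K$ and $\mathbf F\in C(\mathbf{R}^N\times(0,\infty)\times\mathbf{R}:\mathbf{R}^N)$ satisfy, for some constants $C>0$ and $A>1$, $|\mathbf F(x,t,p)|\le C(1+t)^{-A+1/2}|p|$ for all $(x,t,p)\in\mathbf{R}^N\times(0,\infty)\times\mathbf{R}$. Then there exists $u\in C(\mathbf{R}^N\times(0,\infty))$ such that: (i) for every $q\in[1,\infty]$ and $l\in[0,K]$, $\sup_{t>0}t^{\frac N2(1-\frac1q)}\|u(t)\|_q+\sup_{t>0}(1+t)^{-\frac l2}|||u(t)|||_l<\infty$; (ii) $u(x,t)=(e^{t\Delta}\varphi)(x)+\int_0^t\nabla\cdot e^{(t-s)\Delta}\mathbf F(\cdot,s,u(\cdot,s))\,ds$ for almost all $(x,t)\in\mathbf{R}^N\times(0,\infty)$ (i.e. $u$ is a mild solution of $\partial_tu=\Delta u+\nabla\cdot\mathbf F(x,t,u)$, $u(\cdot,0)=\varphi$); (iii) $\lim_{t\to\infty}t^{\frac N2(1-\frac1q)}\|u(t)-Mg(t)\|_q=0$ for all $q\in[1,\infty]$, where $M=\int_{\mathbf{R}^N}\varphi\,dx$.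
   Context: Notation: $G(x,t)=(4\pi t)^{-N/2}\exp(-|x|^2/(4t))$; $g(x,t)=G(x,1+t)$; $(e^{t\Delta}\varphi)(x)=\int G(x-\xi,t)\varphi(\xi)\,d\xi$ (applied componentwise to vector fields). $\|\cdot\|_q$ is the norm of $L^q(\mathbf{R}^N)$; $|||f|||_m=\int(1+|x|)^m|f|\,dx$; $L^1_K=\{\phi\in L^1(\mathbf{R}^N):|||\phi|||_K<\infty\}$. *)

theory Defs
  imports "HOL-Analysis.Analysis" "HOL-Probability.Essential_Supremum"
begin

text \<open>Space R^N is modelled by a Euclidean space type 'a with N = DIM('a) (so N >= 1).\<close>

definition gauss :: "'a::euclidean_space \<Rightarrow> real \<Rightarrow> real" where
  "gauss x t = (4 * pi * t) powr (- real DIM('a) / 2) * exp (- (norm x)\<^sup>2 / (4 * t))"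

definition gauss1 :: "'a::euclidean_space \<Rightarrow> real \<Rightarrow> real" where
  "gauss1 x t = gauss x (1 + t)"

definition heat :: "real \<Rightarrow> ('a::euclidean_space \<Rightarrow> real) \<Rightarrow> 'a \<Rightarrow> real" where
  "heat t \<phi> x = (LINT \<xi>|lborel. gauss (x - \<xi>) t * \<phi> \<xi>)"

definition heatv :: "real \<Rightarrow> ('a::euclidean_space \<Rightarrow> 'a) \<Rightarrow> 'a \<Rightarrow> 'a" where
  "heatv t V x = (\<Sum>b\<in>Basis. heat t (\<lambda>y. V y \<bullet> b) x *\<^sub>R b)"

definition divg :: "('a::euclidean_space \<Rightarrow> 'a) \<Rightarrow> 'a \<Rightarrow> real" where
  "divg V x = (\<Sum>b\<in>Basis. deriv (\<lambda>h. V (x + h *\<^sub>R b) \<bullet> b) 0)"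

definition memLq :: "ereal \<Rightarrow> ('a::euclidean_space \<Rightarrow> real) \<Rightarrow> bool" where
  "memLq q f \<longleftrightarrow> f \<in> borel_measurable lborel \<and>
     (if q = \<infinity> then esssup lborel (\<lambda>x. ereal \<bar>f x\<bar>) < \<infinity>
      else integrable lborel (\<lambda>x. \<bar>f x\<bar> powr real_of_ereal q))"

definition Lq_norm :: "ereal \<Rightarrow> ('a::euclidean_space \<Rightarrow> real) \<Rightarrow> real" where
  "Lq_norm q f = (if q = \<infinity> then real_of_ereal (esssup lborel (\<lambda>x. ereal \<bar>f x\<bar>))
      else (LINT x|lborel. \<bar>f x\<bar> powr real_of_ereal q) powr (1 / real_of_ereal q))"

definition inv_exp :: "ereal \<Rightarrow> real" where
  "inv_exp q = (if q = \<infinity> then 0 else 1 / real_of_ereal q)"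

definition wmem :: "real \<Rightarrow> ('a::euclidean_space \<Rightarrow> real) \<Rightarrow> bool" where
  "wmem m f \<longleftrightarrow> f \<in> borel_measurable lborel \<and> integrable lborel (\<lambda>x. (1 + norm x) powr m * \<bar>f x\<bar>)"

definition wnorm :: "real \<Rightarrow> ('a::euclidean_space \<Rightarrow> real) \<Rightarrow> real" where
  "wnorm m f = (LINT x|lborel. (1 + norm x) powr m * \<bar>f x\<bar>)"

end

theory Submission
  imports Defs "HOL-Probability.Distributions" "HOL-Complex_Analysis.Great_Picard"
begin

text \<open>
  Put \<open>V(t) = G(2t) * |\<phi>|\<close>. Since \<open>|\<nabla>G(t - s)| \<le> c (t - s)^(-1/2) G(2(t - s))\<close> and \<open>G(2(t - s)) * V(s) = V(t)\<close>,
  a pointwise bound \<open>|u| \<le> h(t) V(t)\<close> is propagated by the integral equation as soon as \<open>h\<close> is a supersolution of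
  the scalar Volterra equation with kernel \<open>(t - s)^(-1/2) C (1 + s)^(-A+1/2)\<close>, and because \<open>A > 1\<close> there is a
  bounded one. All norm estimates follow from this majorant; moreover the Duhamel term is \<open>o(1) V(t)\<close> as
  \<open>t \<rightarrow> \<infinity>\<close>, so the large-time behaviour is that of the free evolution.

  As \<open>F\<close> is merely continuous in \<open>p\<close>, the solution is obtained by Tonelli's method: integrating only up to
  \<open>t - \<eta>\<close> gives an equation that finitely many substitutions solve on bounded time intervals. The majorant
  makes these approximations locally equicontinuous as \<open>\<eta> \<rightarrow> 0\<close>, and a convergent subsequence is extracted.
\<close>

section \<open>The Gauss kernel\<close>

text \<open>The doubled time in V is the price of the gradient: |x|/t times the kernel is controlled
  by t^(-1/2) times a kernel only at a later time. Doubling is stable under composition, since 2(t -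
  s) + 2s = 2t, so iteration accumulates no further constant than 2^(N/2). A > 1 is the borderline
  of the method. The integral of (t - s)^(-1/2) (1 + s)^(-A + 1/2) over (0, t) tends to 0 for A > 1,
  but to pi for A = 1. Without a Lipschitz condition there is no contraction, and compactness has to
  come from the kernel alone. Its singularity sits at the base point (x, t) and moves with it, so
  continuity in (x, t) is proved with dominating functions that move too. The result is formulated
  as L^1 continuity of the kernel with weight V. This involves neither F nor u, so a single modulus
  gives equicontinuity of all approximations and continuity of the limit.\<close>

lemma gauss_nonneg [simp]: "0 \<le> gauss x t"
  by (simp add: gauss_def)

lemma gauss_minus [simp]: "gauss (- x) t = gauss x t"
  by (simp add: gauss_def)

lemma gauss_sym: "gauss (x - y) t = gauss (y - x) t"
  by (metis gauss_minus minus_diff_eq)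

lemma borel_measurable_gauss [measurable (raw)]:
  assumes [measurable]: "f \<in> borel_measurable M" "g \<in> borel_measurable M"
  shows "(\<lambda>z. gauss (f z :: 'a::euclidean_space) (g z)) \<in> borel_measurable M"
  unfolding gauss_def by measurable

lemma tendsto_gauss:
  assumes "(f \<longlongrightarrow> x) F" "(g \<longlongrightarrow> t) F" "t > 0"
  shows "((\<lambda>z. gauss (f z :: 'a::euclidean_space) (g z)) \<longlongrightarrow> gauss x t) F"
  unfolding gauss_def using assms by (intro tendsto_intros) auto

text \<open>The exponential factorises over the coordinates, and each factor is a multiple of a
  normal density whose total mass is known.\<close>

lemma nn_integral_exp_norm_square:
  fixes m :: "'a::euclidean_space"
  assumes "c > 0"
  shows "(\<integral>\<^sup>+y. ennreal (exp (- c * (norm (y - m))\<^sup>2)) \<partial>lborel) = ennreal ((pi / c) powr (real DIM('a) / 2))"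
proof -
  \<comment> \<open>The standard deviation for which the exponent of the normal density has rate
    c.\<close>
  define \<sigma> where "\<sigma> = sqrt (1 / (2 * c))"
  have \<sigma>: "\<sigma> > 0" "2 * \<sigma>\<^sup>2 = 1 / c" using assms by (auto simp: \<sigma>_def)
  have one: "(\<integral>\<^sup>+x. ennreal (exp (- c * (x - \<mu>)\<^sup>2)) \<partial>lborel) = ennreal (sqrt (pi / c))" for \<mu> :: real
  proof -
    have "exp (- c * (x - \<mu>)\<^sup>2) = sqrt (pi / c) * normal_density \<mu> \<sigma> x" for x
    proof -
      have "2 * pi * \<sigma>\<^sup>2 = pi / c" using \<sigma>(2) by (simp add: field_simps)
      moreover have "- (x - \<mu>)\<^sup>2 / (2 * \<sigma>\<^sup>2) = - c * (x - \<mu>)\<^sup>2"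
        using \<sigma>(2) by (simp add: field_simps)
      ultimately show ?thesis using assms by (simp add: normal_density_def)
    qed
    then have "(\<integral>\<^sup>+x. ennreal (exp (- c * (x - \<mu>)\<^sup>2)) \<partial>lborel)
        = (\<integral>\<^sup>+x. ennreal (sqrt (pi / c)) * ennreal (normal_density \<mu> \<sigma> x) \<partial>lborel)"
      using assms by (simp add: ennreal_mult)
    also have "\<dots> = ennreal (sqrt (pi / c)) * (\<integral>\<^sup>+x. ennreal (normal_density \<mu> \<sigma> x) \<partial>lborel)"
      by (rule nn_integral_cmult) simp
    also have "(\<integral>\<^sup>+x. ennreal (normal_density \<mu> \<sigma> x) \<partial>lborel) = 1"
      using \<sigma> by (subst nn_integral_eq_integral) auto
    finally show ?thesis by simp
  qed
  have "exp (- c * (norm (y - m))\<^sup>2) = (\<Prod>b\<in>Basis. exp (- c * (y \<bullet> b - m \<bullet> b)\<^sup>2))" for y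
  proof -
    have "(norm (y - m))\<^sup>2 = (\<Sum>b\<in>Basis. (y \<bullet> b - m \<bullet> b)\<^sup>2)"
      by (subst power2_norm_eq_inner, subst euclidean_inner) (simp add: inner_diff_left power2_eq_square)
    then have "exp (- c * (norm (y - m))\<^sup>2) = exp (\<Sum>b\<in>Basis. - c * (y \<bullet> b - m \<bullet> b)\<^sup>2)"
      by (simp only: sum_distrib_left)
    also have "\<dots> = (\<Prod>b\<in>Basis. exp (- c * (y \<bullet> b - m \<bullet> b)\<^sup>2))" by (rule exp_sum) simp
    finally show ?thesis .
  qed
  then have "(\<integral>\<^sup>+y. ennreal (exp (- c * (norm (y - m))\<^sup>2)) \<partial>lborel)
     = (\<integral>\<^sup>+y. (\<Prod>b\<in>Basis. ennreal (exp (- c * (y \<bullet> b - m \<bullet> b)\<^sup>2))) \<partial>lborel)"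
    by (simp add: prod_ennreal)
  also have "\<dots> = (\<Prod>b\<in>(Basis::'a set). \<integral>\<^sup>+x. ennreal (exp (- c * (x - m \<bullet> b)\<^sup>2)) \<partial>lborel)"
    by (rule nn_integral_lborel_prod) auto
  also have "\<dots> = ennreal (sqrt (pi / c)) ^ DIM('a)"
    by (simp only: one) simp
  also have "\<dots> = ennreal (sqrt (pi / c) ^ DIM('a))"
    using assms by (simp add: ennreal_power)
  also have "sqrt (pi / c) ^ DIM('a) = (pi / c) powr (real DIM('a) / 2)"
    using assms by (simp add: powr_half_sqrt[symmetric] powr_realpow[symmetric] powr_powr)
  finally show ?thesis .
qed

lemma nn_integral_gauss:
  fixes m :: "'a::euclidean_space"
  assumes "t > 0"
  shows "(\<integral>\<^sup>+y. ennreal (gauss (y - m) t) \<partial>lborel) = 1"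
proof -
  have "(\<integral>\<^sup>+y. ennreal (gauss (y - m) t) \<partial>lborel)
     = (\<integral>\<^sup>+y. ennreal ((4 * pi * t) powr (- real DIM('a) / 2)) * ennreal (exp (- (1 / (4 * t)) * (norm (y - m))\<^sup>2)) \<partial>lborel)"
    by (simp add: gauss_def ennreal_mult)
  also have "\<dots> = ennreal ((4 * pi * t) powr (- real DIM('a) / 2)) * ennreal ((pi / (1 / (4 * t))) powr (real DIM('a) / 2))"
    using assms by (subst nn_integral_cmult, simp, subst nn_integral_exp_norm_square) auto
  also have "\<dots> = 1"
    using assms by (simp add: ennreal_mult[symmetric] powr_minus_divide mult_ac)
  finally show ?thesis .
qed

lemma integrable_gauss:
  assumes "t > 0"
  shows "integrable lborel (\<lambda>y. gauss (y - m :: 'a::euclidean_space) t)"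
  using nn_integral_gauss[OF assms, of m] by (intro integrableI_nonneg) auto

text \<open>Completing the square in y: \<open>m\<close> is the point where the sum of both
  exponents is minimal, the minimum is the exponent of the kernel at time a + b, and the remaining
  Gaussian of rate \<open>c\<close> integrates to the quotient of the normalisations.\<close>

lemma gauss_semigroup:
  fixes x z :: "'a::euclidean_space"
  assumes "a > 0" "b > 0"
  shows "(\<integral>\<^sup>+y. ennreal (gauss (x - y) a * gauss (y - z) b) \<partial>lborel) = ennreal (gauss (x - z) (a + b))"
proof -
  define N where "N = real DIM('a) / 2"
  define m where "m = (b / (a + b)) *\<^sub>R x + (a / (a + b)) *\<^sub>R z"
  define c where "c = (a + b) / (4 * a * b)"
  have c: "c > 0" using assms by (simp add: c_def)
  have sq: "(norm (x - y))\<^sup>2 / (4 * a) + (norm (y - z))\<^sup>2 / (4 * b)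
      = (norm (x - z))\<^sup>2 / (4 * (a + b)) + c * (norm (y - m))\<^sup>2" for y
  proof -
    define p q where "p = x - y" and "q = y - z"
    have ym: "y - m = (1 / (a + b)) *\<^sub>R (a *\<^sub>R q - b *\<^sub>R p)"
    proof -
      have "(a + b) *\<^sub>R (y - m) = a *\<^sub>R q - b *\<^sub>R p"
      proof -
        have "(a + b) *\<^sub>R m = b *\<^sub>R x + a *\<^sub>R z"
          using assms by (simp add: m_def scaleR_add_right)
        then show ?thesis by (simp add: scaleR_diff_right p_def q_def scaleR_add_left)
      qed
      then have "(1 / (a + b)) *\<^sub>R (a *\<^sub>R q - b *\<^sub>R p) = (1 / (a + b)) *\<^sub>R (a + b) *\<^sub>R (y - m)" by simp
      then show ?thesis using assms by simp
    qed
    have xz: "x - z = p + q" by (simp add: p_def q_def)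
    have ab: "a + b \<noteq> 0" "a \<noteq> 0" "b \<noteq> 0" using assms by auto
    have "(norm (y - m))\<^sup>2 = (a\<^sup>2 * (q \<bullet> q) - 2 * a * b * (p \<bullet> q) + b\<^sup>2 * (p \<bullet> p)) / (a + b)\<^sup>2"
    proof -
      have "(norm (a *\<^sub>R q - b *\<^sub>R p))\<^sup>2 = a\<^sup>2 * (q \<bullet> q) - 2 * a * b * (p \<bullet> q) + b\<^sup>2 * (p \<bullet> p)"
        unfolding power2_norm_eq_inner
        by (simp add: inner_diff_left inner_diff_right inner_commute power2_eq_square algebra_simps)
      then show ?thesis unfolding ym norm_scaleR power_mult_distrib by (simp add: power_divide)
    qed
    moreover have "(norm (x - z))\<^sup>2 = p \<bullet> p + 2 * (p \<bullet> q) + q \<bullet> q"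
      unfolding xz power2_norm_eq_inner by (simp add: inner_add_left inner_add_right inner_commute)
    moreover have "(p \<bullet> p) / (4 * a) + (q \<bullet> q) / (4 * b) = (p \<bullet> p + 2 * (p \<bullet> q) + q \<bullet> q) / (4 * (a + b))
       + c * ((a\<^sup>2 * (q \<bullet> q) - 2 * a * b * (p \<bullet> q) + b\<^sup>2 * (p \<bullet> p)) / (a + b)\<^sup>2)"
    proof -
      have "c * ((a\<^sup>2 * (q \<bullet> q) - 2 * a * b * (p \<bullet> q) + b\<^sup>2 * (p \<bullet> p)) / (a + b)\<^sup>2)
        = (a\<^sup>2 * (q \<bullet> q) - 2 * a * b * (p \<bullet> q) + b\<^sup>2 * (p \<bullet> p)) / (4 * a * b * (a + b))"
        using ab by (simp add: c_def power2_eq_square)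
      then show ?thesis using ab by (simp add: divide_simps) algebra
    qed
    ultimately show ?thesis by (simp add: p_def[symmetric] q_def[symmetric] power2_norm_eq_inner)
  qed
  define k where "k = (4 * pi * a) powr (- N) * (4 * pi * b) powr (- N)"
  have "gauss (x - y) a * gauss (y - z) b
      = k * exp (- (norm (x - z))\<^sup>2 / (4 * (a + b))) * exp (- c * (norm (y - m))\<^sup>2)" for y
  proof -
    have "exp (- (norm (x - y))\<^sup>2 / (4 * a)) * exp (- (norm (y - z))\<^sup>2 / (4 * b))
       = exp (- ((norm (x - y))\<^sup>2 / (4 * a) + (norm (y - z))\<^sup>2 / (4 * b)))"
      by (simp add: exp_add[symmetric])
    also have "\<dots> = exp (- (norm (x - z))\<^sup>2 / (4 * (a + b))) * exp (- c * (norm (y - m))\<^sup>2)"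
      unfolding sq by (simp add: exp_add[symmetric])
    finally show ?thesis by (simp add: gauss_def k_def N_def mult_ac)
  qed
  then have "(\<integral>\<^sup>+y. ennreal (gauss (x - y) a * gauss (y - z) b) \<partial>lborel)
     = (\<integral>\<^sup>+y. ennreal (k * exp (- (norm (x - z))\<^sup>2 / (4 * (a + b)))) * ennreal (exp (- c * (norm (y - m))\<^sup>2)) \<partial>lborel)"
    by (simp add: ennreal_mult k_def)
  also have "\<dots> = ennreal (k * exp (- (norm (x - z))\<^sup>2 / (4 * (a + b)))) * ennreal ((pi / c) powr N)"
    using c by (subst nn_integral_cmult, simp, subst nn_integral_exp_norm_square) (auto simp: N_def)
  also have "\<dots> = ennreal (k * (pi / c) powr N * exp (- (norm (x - z))\<^sup>2 / (4 * (a + b))))"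
    by (simp add: ennreal_mult[symmetric] k_def mult_ac)
  also have "k * (pi / c) powr N = (4 * pi * (a + b)) powr (- N)"
  proof -
    have "(4 * pi * a) * (4 * pi * b) = (4 * pi * (a + b)) * (pi / c)"
      using assms by (simp add: c_def field_simps)
    then have "((4 * pi * a) * (4 * pi * b)) powr N = ((4 * pi * (a + b)) * (pi / c)) powr N" by simp
    then have "(4 * pi * a) powr N * (4 * pi * b) powr N = (4 * pi * (a + b)) powr N * (pi / c) powr N"
      by (subst (asm) (1 2) powr_mult)
    moreover have "(4 * pi * a) powr N > 0" "(4 * pi * b) powr N > 0" "(4 * pi * (a + b)) powr N > 0" "(pi / c) powr N > 0"
      using assms c by auto
    moreover have "inverse u * inverse v * p = inverse w" if "u * v = w * p" "u > 0" "v > 0" "w > 0" "p > 0" for u v w p :: real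
      using that by (simp add: field_simps)
    ultimately show ?thesis unfolding k_def powr_minus by blast
  qed
  finally show ?thesis by (simp add: gauss_def N_def)
qed

lemma gauss_le:
  assumes "t > 0"
  shows "gauss (x :: 'a::euclidean_space) t \<le> (4 * pi * t) powr (- real DIM('a) / 2)"
proof -
  have "exp (- (norm x)\<^sup>2 / (4 * t)) \<le> 1" using assms by simp
  then show ?thesis unfolding gauss_def by (rule mult_left_le) simp
qed

text \<open>Passing to a later time frees a Gaussian factor that can absorb polynomial growth in
  norm x. All uses take c = 2.\<close>

lemma gauss_scale:
  assumes "t > 0" "c > 0"
  shows "gauss (x :: 'a::euclidean_space) t
    = c powr (real DIM('a) / 2) * gauss x (c * t) * exp (- (1 - 1 / c) * (norm x)\<^sup>2 / (4 * t))"
proof -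
  have "exp (- (norm x)\<^sup>2 / (4 * t)) = exp (- (norm x)\<^sup>2 / (4 * (c * t))) * exp (- (1 - 1 / c) * (norm x)\<^sup>2 / (4 * t))"
    using assms by (simp add: exp_add[symmetric] field_simps)
  moreover have "(4 * pi * t) powr (- real DIM('a) / 2) = c powr (real DIM('a) / 2) * (4 * pi * (c * t)) powr (- real DIM('a) / 2)"
    using assms by (simp add: powr_mult powr_minus field_simps)
  ultimately show ?thesis by (simp add: gauss_def)
qed

lemma gauss_le_double:
  assumes "t > 0"
  shows "gauss (x :: 'a::euclidean_space) t \<le> 2 powr (real DIM('a) / 2) * gauss x (2 * t)"
proof -
  have "exp (- (1 - 1 / 2) * (norm x)\<^sup>2 / (4 * t)) \<le> 1" using assms by simp
  then show ?thesis
    by (subst gauss_scale[OF assms, of 2]) (auto intro!: mult_left_le)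
qed

text \<open>The spatial gradient of the Gauss kernel in closed form;
  \<open>gauss_has_derivative_line\<close> confirms this.\<close>

definition ggrad :: "'a::euclidean_space \<Rightarrow> real \<Rightarrow> 'a" where
  "ggrad x t = (- gauss x t / (2 * t)) *\<^sub>R x"

lemma borel_measurable_ggrad [measurable (raw)]:
  assumes [measurable]: "f \<in> borel_measurable M" "g \<in> borel_measurable M"
  shows "(\<lambda>z. ggrad (f z :: 'a::euclidean_space) (g z)) \<in> borel_measurable M"
  unfolding ggrad_def by measurable

lemma tendsto_ggrad:
  assumes "(f \<longlongrightarrow> x) F" "(g \<longlongrightarrow> t) F" "t > 0"
  shows "((\<lambda>z. ggrad (f z :: 'a::euclidean_space) (g z)) \<longlongrightarrow> ggrad x t) F"
  unfolding ggrad_def using assms by (intro tendsto_intros tendsto_gauss) auto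

text \<open>In the similarity variable r = |x| / sqrt t the gradient carries the extra factor
  t^(-1/2) r/2, and r/2 is absorbed by the factor exp(- r^2/8) that \<open>gauss_scale\<close>
  frees.\<close>

lemma norm_ggrad_le:
  assumes "t > 0"
  shows "norm (ggrad (x :: 'a::euclidean_space) t) \<le> 2 powr (real DIM('a) / 2) * t powr (- 1 / 2) * gauss x (2 * t)"
proof -
  define r where "r = norm x / sqrt t"
  have r: "r \<ge> 0" "r\<^sup>2 = (norm x)\<^sup>2 / t" using assms by (auto simp: r_def power_divide)
  have "r / 2 \<le> 1 + r\<^sup>2 / 8"
    using zero_le_power2[of "r - 2"] by (simp add: power2_eq_square algebra_simps)
  also have "\<dots> \<le> exp (r\<^sup>2 / 8)" by (rule exp_ge_add_one_self)
  finally have 1: "r / 2 * exp (- r\<^sup>2 / 8) \<le> 1"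
    by (simp add: exp_minus field_simps)
  have 2: "- (1 - 1 / 2) * (norm x)\<^sup>2 / (4 * t) = - r\<^sup>2 / 8" using r by simp
  have "norm (ggrad x t) = norm x / (2 * t) * gauss x t"
    using assms by (simp add: ggrad_def)
  also have "norm x / (2 * t) = t powr (- 1 / 2) * (r / 2)"
    using assms by (simp add: r_def powr_minus powr_half_sqrt field_simps)
  also have "t powr (- 1 / 2) * (r / 2) * gauss x t
    = 2 powr (real DIM('a) / 2) * t powr (- 1 / 2) * gauss x (2 * t) * (r / 2 * exp (- r\<^sup>2 / 8))"
    unfolding 2[symmetric] by (subst gauss_scale[OF assms, of 2]) (auto simp: mult_ac)
  also have "\<dots> \<le> 2 powr (real DIM('a) / 2) * t powr (- 1 / 2) * gauss x (2 * t)"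
    using 1 by (intro mult_left_le) auto
  finally show ?thesis .
qed

lemma gauss_has_derivative_line:
  assumes "t > 0"
  shows "((\<lambda>h. gauss (x + h *\<^sub>R b :: 'a::euclidean_space) t) has_real_derivative ggrad (x + h *\<^sub>R b) t \<bullet> b) (at h)"
proof -
  define k where "k = (4 * pi * t) powr (- real DIM('a) / 2)"
  define E where "E = (\<lambda>h. x \<bullet> x + 2 * h * (x \<bullet> b) + h\<^sup>2 * (b \<bullet> b))"
  have n: "(norm (x + h *\<^sub>R b))\<^sup>2 = E h" for h
    unfolding power2_norm_eq_inner
    by (simp add: E_def inner_add_left inner_add_right inner_commute power2_eq_square)
  have g: "gauss (x + h *\<^sub>R b) t = k * exp (- E h / (4 * t))" for h
    by (simp add: gauss_def n k_def)
  have "(E has_real_derivative 2 * ((x + h *\<^sub>R b) \<bullet> b)) (at h)"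
    unfolding E_def by (auto intro!: derivative_eq_intros simp: inner_add_left)
  then have "((\<lambda>h. k * exp (- E h / (4 * t))) has_real_derivative
      k * (exp (- E h / (4 * t)) * (- (2 * ((x + h *\<^sub>R b) \<bullet> b)) / (4 * t)))) (at h)"
    using DERIV_chain'[of "\<lambda>h. - E h / (4 * t)" _ h UNIV exp, OF DERIV_cdivide[OF DERIV_minus] DERIV_exp]
    by (intro DERIV_cmult) blast
  then show ?thesis
    unfolding g ggrad_def by (simp add: mult_ac)
qed

section \<open>Generalised dominated convergence and the heat semigroup\<close>

text \<open>Dominated convergence with a majorant depending on n: convergence of the masses
  \<open>c n\<close> upgrades pointwise convergence of the majorants to L^1 convergence, and the
  rest reduces to a fixed majorant.\<close>

lemma generalised_dominated_convergence:
  fixes f :: "nat \<Rightarrow> 'a \<Rightarrow> 'b::{banach, second_countable_topology}" and g :: "nat \<Rightarrow> 'a \<Rightarrow> real"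
  assumes f [measurable]: "\<And>n. f n \<in> borel_measurable M" "f0 \<in> borel_measurable M"
    and g [measurable]: "\<And>n. g n \<in> borel_measurable M" "g0 \<in> borel_measurable M"
    and nonneg: "\<And>n x. 0 \<le> g n x" "\<And>x. 0 \<le> g0 x"
    and flim: "AE x in M. (\<lambda>n. f n x) \<longlonglongrightarrow> f0 x"
    and glim: "AE x in M. (\<lambda>n. g n x) \<longlonglongrightarrow> g0 x"
    and bound: "\<And>n. AE x in M. norm (f n x) \<le> g n x"
    and int: "\<And>n. (\<integral>\<^sup>+x. ennreal (g n x) \<partial>M) = ennreal (c n)" "(\<integral>\<^sup>+x. ennreal (g0 x) \<partial>M) = ennreal c0"
    and clim: "c \<longlonglongrightarrow> c0"
  shows "integrable M f0" "\<And>n. integrable M (f n)" "(\<lambda>n. \<integral>x. norm (f n x - f0 x) \<partial>M) \<longlonglongrightarrow> 0"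
proof -
  have gi: "integrable M (g n)" for n
    using int(1) nonneg by (intro integrableI_nonneg) auto
  have g0i: "integrable M g0"
    using int(2) nonneg by (intro integrableI_nonneg) auto
  have b0: "AE x in M. norm (f0 x) \<le> g0 x"
  proof -
    have "AE x in M. \<forall>n. norm (f n x) \<le> g n x"
      using bound by (simp add: AE_all_countable)
    then show ?thesis using flim glim
    proof eventually_elim
      case (elim x)
      show ?case
        by (rule tendsto_le[OF _ elim(3) tendsto_norm[OF elim(2)]]) (use elim(1) in auto)
    qed
  qed
  show fi: "integrable M (f n)" for n
    by (rule Bochner_Integration.integrable_bound[OF gi[of n] f(1)]) (use bound[of n] nonneg in auto)
  show f0i: "integrable M f0"
    by (rule Bochner_Integration.integrable_bound[OF g0i f(2)]) (use b0 nonneg in auto)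
  have "(\<lambda>n. \<integral>\<^sup>+x. norm (g n x - g0 x) \<partial>M) \<longlonglongrightarrow> 0"
  proof (rule Scheffe_lemma1[OF gi g0i glim])
    have "(\<lambda>n. \<integral>\<^sup>+x. norm (g n x) \<partial>M) \<longlonglongrightarrow> (\<integral>\<^sup>+x. norm (g0 x) \<partial>M)"
      using int nonneg clim by (simp add: tendsto_ennrealI)
    then show "limsup (\<lambda>n. \<integral>\<^sup>+x. norm (g n x) \<partial>M) \<le> (\<integral>\<^sup>+x. norm (g0 x) \<partial>M)"
      by (simp add: lim_imp_Limsup)
  qed
  moreover have "(\<integral>\<^sup>+x. norm (g n x - g0 x) \<partial>M) = ennreal (\<integral>x. \<bar>g n x - g0 x\<bar> \<partial>M)" for n
    using gi g0i by (subst nn_integral_eq_integral) auto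
  ultimately have "(\<lambda>n. ennreal (\<integral>x. \<bar>g n x - g0 x\<bar> \<partial>M)) \<longlonglongrightarrow> ennreal 0" by simp
  then have G: "(\<lambda>n. \<integral>x. \<bar>g n x - g0 x\<bar> \<partial>M) \<longlonglongrightarrow> 0"
    by (subst (asm) tendsto_ennreal_iff) auto
  \<comment> \<open>Truncation at 2 g0 restores a fixed majorant. What it cuts off is at most |g n -
    g0|, because |f n - f0| is at most g n + g0.\<close>
  have "(\<lambda>n. \<integral>x. min (norm (f n x - f0 x)) (2 * g0 x) \<partial>M) \<longlonglongrightarrow> (\<integral>x. 0 \<partial>M)"
  proof (rule integral_dominated_convergence[where w = "\<lambda>x. 2 * g0 x"])
    show "AE x in M. (\<lambda>n. min (norm (f n x - f0 x)) (2 * g0 x)) \<longlonglongrightarrow> 0"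
      using flim
    proof eventually_elim
      case (elim x)
      have "(\<lambda>n. norm (f n x - f0 x)) \<longlonglongrightarrow> 0"
        using elim by (simp add: LIM_zero tendsto_norm_zero)
      from tendsto_min[OF this tendsto_const[of "2 * g0 x"]]
      show ?case using nonneg(2)[of x] by simp
    qed
  qed (use g0i nonneg in auto)
  from tendsto_add[OF this G]
  have S: "(\<lambda>n. (\<integral>x. min (norm (f n x - f0 x)) (2 * g0 x) \<partial>M) + (\<integral>x. \<bar>g n x - g0 x\<bar> \<partial>M)) \<longlonglongrightarrow> 0" by simp
  show "(\<lambda>n. \<integral>x. norm (f n x - f0 x) \<partial>M) \<longlonglongrightarrow> 0"
  proof (rule tendsto_sandwich[OF _ _ tendsto_const S])
    show "\<forall>\<^sub>F n in sequentially. (\<integral>x. norm (f n x - f0 x) \<partial>M)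
        \<le> (\<integral>x. min (norm (f n x - f0 x)) (2 * g0 x) \<partial>M) + (\<integral>x. \<bar>g n x - g0 x\<bar> \<partial>M)"
    proof (intro always_eventually allI)
      fix n
      have mi: "integrable M (\<lambda>x. min (norm (f n x - f0 x)) (2 * g0 x))"
        by (rule Bochner_Integration.integrable_bound[OF integrable_norm[OF Bochner_Integration.integrable_diff[OF fi[of n] f0i]]])
           (use nonneg in auto)
      have "(\<integral>x. norm (f n x - f0 x) \<partial>M) \<le> (\<integral>x. min (norm (f n x - f0 x)) (2 * g0 x) + \<bar>g n x - g0 x\<bar> \<partial>M)"
      proof (rule integral_mono_AE)
        show "AE x in M. norm (f n x - f0 x) \<le> min (norm (f n x - f0 x)) (2 * g0 x) + \<bar>g n x - g0 x\<bar>"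
          using bound[of n] b0
        proof eventually_elim
          case (elim x)
          have "norm (f n x - f0 x) \<le> g n x + g0 x"
            using norm_triangle_ineq4[of "f n x" "f0 x"] elim by linarith
          then show ?case by linarith
        qed
      qed (use fi f0i mi gi g0i in auto)
      then show "(\<integral>x. norm (f n x - f0 x) \<partial>M)
          \<le> (\<integral>x. min (norm (f n x - f0 x)) (2 * g0 x) \<partial>M) + (\<integral>x. \<bar>g n x - g0 x\<bar> \<partial>M)"
        using mi gi g0i by simp
    qed
  qed simp
qed

text \<open>The scaling t^(-N/2) of the sup norm against the L^1 norm is exactly the one under which
  interpolation gives the weight t^(N/2 (1 - 1/q)) with the same constant m. Every L^q claim is
  thereby reduced to a sup bound and an L^1 bound.\<close>

lemma Lq_norm_interpolation:
  fixes f :: "'a::euclidean_space \<Rightarrow> real"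
  assumes [measurable]: "f \<in> borel_measurable borel"
    and t: "t > 0" and m: "m > 0" and q: "1 \<le> q"
    and sup: "\<And>x. \<bar>f x\<bar> \<le> t powr (- real DIM('a) / 2) * m"
    and L1: "(\<integral>\<^sup>+x. ennreal \<bar>f x\<bar> \<partial>lborel) \<le> ennreal m"
  shows "memLq q f" "t powr (real DIM('a) / 2 * (1 - inv_exp q)) * Lq_norm q f \<le> m" "0 \<le> Lq_norm q f"
proof -
  define N where "N = real DIM('a) / 2"
  define B where "B = t powr (- N) * m"
  have B: "B > 0" using t m by (simp add: B_def)
  have fB: "\<bar>f x\<bar> \<le> B" for x using sup[of x] by (simp add: B_def N_def)
  have f1: "integrable lborel f"
    using L1 by (intro integrableI_bounded) (auto simp: le_less_trans[OF L1])
  have if1: "(\<integral>x. \<bar>f x\<bar> \<partial>lborel) \<le> m"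
  proof -
    have "ennreal (\<integral>x. \<bar>f x\<bar> \<partial>lborel) \<le> ennreal m"
      using L1 f1 by (subst nn_integral_eq_integral[symmetric]) auto
    then show ?thesis using m by simp
  qed
  have "memLq q f \<and> t powr (N * (1 - inv_exp q)) * Lq_norm q f \<le> m \<and> 0 \<le> Lq_norm q f"
  proof (cases "q = \<infinity>")
    case True
    have e: "esssup lborel (\<lambda>x. ereal \<bar>f x\<bar>) \<le> ereal B"
      using fB by (intro esssup_I) auto
    have e0: "0 \<le> esssup lborel (\<lambda>x. ereal \<bar>f x\<bar>)"
    proof -
      have "esssup lborel (\<lambda>x::'a. 0::ereal) \<le> esssup lborel (\<lambda>x. ereal \<bar>f x\<bar>)"
        by (intro esssup_mono) auto
      then show ?thesis by (simp add: esssup_const)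
    qed
    have "real_of_ereal (esssup lborel (\<lambda>x. ereal \<bar>f x\<bar>)) \<le> B"
      using e e0 by (metis real_of_ereal.simps(1) real_of_ereal_positive_mono PInfty_neq_ereal(1))
    moreover have "t powr N * B = m" using t by (simp add: B_def powr_minus)
    moreover have "esssup lborel (\<lambda>x. ereal \<bar>f x\<bar>) < \<infinity>"
      using e by (rule le_less_trans) simp
    ultimately show ?thesis using True t e0
      by (auto simp: memLq_def Lq_norm_def inv_exp_def real_of_ereal_pos)
  next
    case False
    then obtain p where qp: "q = ereal p" using q by (cases q) auto
    have p: "p \<ge> 1" using q qp by simp
    \<comment> \<open>Interpolation between L^1 and the sup norm: p - 1 of the p factors are
      estimated by the sup bound B.\<close>
    have pw: "\<bar>f x\<bar> powr p \<le> B powr (p - 1) * \<bar>f x\<bar>" for x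
    proof (cases "f x = 0")
      case False
      then have "\<bar>f x\<bar> powr p = \<bar>f x\<bar> powr (p - 1) * \<bar>f x\<bar>"
        using powr_add[of "\<bar>f x\<bar>" "p - 1" 1] by simp
      also have "\<dots> \<le> B powr (p - 1) * \<bar>f x\<bar>"
        using fB[of x] p by (intro mult_right_mono powr_mono2) auto
      finally show ?thesis .
    qed simp
    have pi: "integrable lborel (\<lambda>x. \<bar>f x\<bar> powr p)"
      by (rule Bochner_Integration.integrable_bound[where f = "\<lambda>x. B powr (p - 1) * \<bar>f x\<bar>"])
         (use f1 pw in auto)
    have "(\<integral>x. \<bar>f x\<bar> powr p \<partial>lborel) \<le> (\<integral>x. B powr (p - 1) * \<bar>f x\<bar> \<partial>lborel)"
      using pi f1 pw by (intro integral_mono) auto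
    also have "\<dots> \<le> B powr (p - 1) * m"
      using if1 by (simp add: mult_left_mono)
    finally have "(\<integral>x. \<bar>f x\<bar> powr p \<partial>lborel) powr (1 / p) \<le> (B powr (p - 1) * m) powr (1 / p)"
      using p by (intro powr_mono2) (auto intro!: integral_nonneg_AE)
    also have "\<dots> = B powr (1 - 1 / p) * m powr (1 / p)"
      using p by (simp add: powr_mult powr_powr diff_divide_distrib)
    also have "\<dots> = t powr (- N * (1 - 1 / p)) * (m powr (1 - 1 / p) * m powr (1 / p))"
      by (simp add: B_def powr_mult powr_powr)
    also have "m powr (1 - 1 / p) * m powr (1 / p) = m" using m by (simp flip: powr_add)
    finally have "t powr (N * (1 - 1 / p)) * (\<integral>x. \<bar>f x\<bar> powr p \<partial>lborel) powr (1 / p)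
       \<le> t powr (N * (1 - 1 / p)) * (t powr (- N * (1 - 1 / p)) * m)"
      by (rule mult_left_mono) simp
    also have "\<dots> = m" using t by (simp add: powr_minus)
    finally show ?thesis using pi qp
      by (simp add: memLq_def Lq_norm_def inv_exp_def)
  qed
  then show "memLq q f" "t powr (real DIM('a) / 2 * (1 - inv_exp q)) * Lq_norm q f \<le> m" "0 \<le> Lq_norm q f"
    by (auto simp: N_def)
qed

section \<open>The heat semigroup on integrable data\<close>

lemma integrable_gauss_mult:
  fixes \<psi> :: "'a::euclidean_space \<Rightarrow> real"
  assumes "integrable lborel \<psi>" "t > 0"
  shows "integrable lborel (\<lambda>\<xi>. gauss (x - \<xi>) t * \<psi> \<xi>)"
proof (rule Bochner_Integration.integrable_bound)
  show "integrable lborel (\<lambda>\<xi>. (4 * pi * t) powr (- real DIM('a) / 2) * \<psi> \<xi>)"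
    using assms by simp
  have [measurable]: "\<psi> \<in> borel_measurable borel" using assms by auto
  show "(\<lambda>\<xi>. gauss (x - \<xi>) t * \<psi> \<xi>) \<in> borel_measurable lborel" by measurable
  show "AE \<xi> in lborel. norm (gauss (x - \<xi>) t * \<psi> \<xi>) \<le> norm ((4 * pi * t) powr (- real DIM('a) / 2) * \<psi> \<xi>)"
    using gauss_le[OF assms(2), where 'a = 'a] by (auto simp: abs_mult intro!: mult_right_mono)
qed

lemma heat_nonneg: "(\<And>x. 0 \<le> \<psi> x) \<Longrightarrow> 0 \<le> heat t \<psi> x"
  unfolding heat_def by (intro integral_nonneg_AE) auto

lemma borel_measurable_heat [measurable (raw)]:
  fixes \<psi> :: "'a::euclidean_space \<Rightarrow> real"
  assumes [measurable]: "\<psi> \<in> borel_measurable borel" "f \<in> borel_measurable M" "g \<in> borel_measurable M"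
  shows "(\<lambda>z. heat (g z) \<psi> (f z)) \<in> borel_measurable M"
  unfolding heat_def by measurable

lemma ennreal_heat:
  fixes \<psi> :: "'a::euclidean_space \<Rightarrow> real"
  assumes "integrable lborel \<psi>" "t > 0" "\<And>x. 0 \<le> \<psi> x"
  shows "ennreal (heat t \<psi> x) = (\<integral>\<^sup>+\<xi>. ennreal (gauss (x - \<xi>) t * \<psi> \<xi>) \<partial>lborel)"
  unfolding heat_def using assms by (subst nn_integral_eq_integral) (auto intro: integrable_gauss_mult)

lemma abs_heat_le:
  fixes \<psi> :: "'a::euclidean_space \<Rightarrow> real"
  shows "\<bar>heat t \<psi> x\<bar> \<le> heat t (\<lambda>y. \<bar>\<psi> y\<bar>) x"
  unfolding heat_def using integral_norm_bound[of lborel "\<lambda>\<xi>. gauss (x - \<xi>) t * \<psi> \<xi>"]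
  by (simp add: abs_mult)

text \<open>Brings the free evolution to the doubled time at which the majorant lives, with the same
  constant as in the gradient bound.\<close>

lemma abs_heat_le_double:
  fixes \<psi> :: "'a::euclidean_space \<Rightarrow> real"
  assumes "integrable lborel \<psi>" "t > 0"
  shows "\<bar>heat t \<psi> x\<bar> \<le> 2 powr (real DIM('a) / 2) * heat (2 * t) (\<lambda>y. \<bar>\<psi> y\<bar>) x"
proof -
  have "heat t (\<lambda>y. \<bar>\<psi> y\<bar>) x \<le> (\<integral>\<xi>. 2 powr (real DIM('a) / 2) * (gauss (x - \<xi>) (2 * t) * \<bar>\<psi> \<xi>\<bar>) \<partial>lborel)"
    unfolding heat_def
    using assms gauss_le_double[OF assms(2)]
    by (intro integral_mono integrable_gauss_mult integrable_mult_right)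
       (auto simp: mult.assoc[symmetric] intro!: mult_right_mono)
  then show ?thesis using abs_heat_le[of t \<psi> x] by (simp add: heat_def)
qed

lemma heat_sup_bound:
  fixes \<psi> :: "'a::euclidean_space \<Rightarrow> real"
  assumes "integrable lborel \<psi>" "t > 0" "\<And>x. 0 \<le> \<psi> x"
  shows "heat t \<psi> x \<le> (4 * pi * t) powr (- real DIM('a) / 2) * (\<integral>y. \<psi> y \<partial>lborel)"
proof -
  have "heat t \<psi> x \<le> (\<integral>\<xi>. (4 * pi * t) powr (- real DIM('a) / 2) * \<psi> \<xi> \<partial>lborel)"
    unfolding heat_def using assms gauss_le[OF assms(2)]
    by (intro integral_mono integrable_gauss_mult integrable_mult_right) (auto intro!: mult_right_mono)
  then show ?thesis by simp
qed

lemma nn_integral_heat: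
  fixes \<psi> :: "'a::euclidean_space \<Rightarrow> real"
  assumes "integrable lborel \<psi>" "t > 0" "\<And>x. 0 \<le> \<psi> x"
  shows "(\<integral>\<^sup>+x. ennreal (heat t \<psi> x) \<partial>lborel) = ennreal (\<integral>y. \<psi> y \<partial>lborel)"
proof -
  have [measurable]: "\<psi> \<in> borel_measurable borel" using assms by auto
  have "(\<integral>\<^sup>+x. ennreal (heat t \<psi> x) \<partial>lborel) = (\<integral>\<^sup>+x. \<integral>\<^sup>+\<xi>. ennreal (gauss (x - \<xi>) t * \<psi> \<xi>) \<partial>lborel \<partial>lborel)"
    using ennreal_heat[OF assms] by simp
  also have "\<dots> = (\<integral>\<^sup>+\<xi>. \<integral>\<^sup>+x. ennreal (gauss (x - \<xi>) t * \<psi> \<xi>) \<partial>lborel \<partial>lborel)"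
    by (rule lborel_pair.Fubini') measurable
  also have "\<dots> = (\<integral>\<^sup>+\<xi>. ennreal (\<psi> \<xi>) \<partial>lborel)"
    using assms by (simp add: ennreal_mult nn_integral_multc nn_integral_gauss)
  also have "\<dots> = ennreal (\<integral>y. \<psi> y \<partial>lborel)"
    using assms by (intro nn_integral_eq_integral) auto
  finally show ?thesis .
qed

lemma heat_semigroup:
  fixes \<psi> :: "'a::euclidean_space \<Rightarrow> real"
  assumes "integrable lborel \<psi>" "\<And>x. 0 \<le> \<psi> x" and ab: "a > 0" "b > 0"
  shows "(\<integral>\<^sup>+y. ennreal (gauss (x - y) a * heat b \<psi> y) \<partial>lborel) = ennreal (heat (a + b) \<psi> x)"
proof -
  have [measurable]: "\<psi> \<in> borel_measurable borel" using assms by auto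
  have "(\<integral>\<^sup>+y. ennreal (gauss (x - y) a * heat b \<psi> y) \<partial>lborel)
     = (\<integral>\<^sup>+y. ennreal (gauss (x - y) a) * (\<integral>\<^sup>+\<xi>. ennreal (gauss (y - \<xi>) b * \<psi> \<xi>) \<partial>lborel) \<partial>lborel)"
    using ennreal_heat[OF assms(1) ab(2) assms(2)] by (simp add: ennreal_mult heat_nonneg assms)
  also have "\<dots> = (\<integral>\<^sup>+y. \<integral>\<^sup>+\<xi>. ennreal (gauss (x - y) a * gauss (y - \<xi>) b) * ennreal (\<psi> \<xi>) \<partial>lborel \<partial>lborel)"
    using assms by (subst nn_integral_cmult[symmetric]) (auto simp: ennreal_mult mult_ac)
  also have "\<dots> = (\<integral>\<^sup>+\<xi>. \<integral>\<^sup>+y. ennreal (gauss (x - y) a * gauss (y - \<xi>) b) * ennreal (\<psi> \<xi>) \<partial>lborel \<partial>lborel)"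
    by (rule lborel_pair.Fubini') measurable
  also have "\<dots> = (\<integral>\<^sup>+\<xi>. ennreal (gauss (x - \<xi>) (a + b) * \<psi> \<xi>) \<partial>lborel)"
    using assms by (simp add: nn_integral_multc gauss_semigroup ennreal_mult[of "gauss (x - _) (a + b)"])
  also have "\<dots> = ennreal (heat (a + b) \<psi> x)"
    using ennreal_heat[OF assms(1) _ assms(2), of "a + b"] ab by simp
  finally show ?thesis .
qed

lemma tendsto_heat:
  fixes \<psi> :: "'a::euclidean_space \<Rightarrow> real"
  assumes \<psi>: "integrable lborel \<psi>" and t: "t > 0" and X: "X \<longlonglongrightarrow> x" and T: "T \<longlonglongrightarrow> t"
  shows "(\<lambda>n. heat (T n) \<psi> (X n)) \<longlonglongrightarrow> heat t \<psi> x"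
proof -
  have [measurable]: "\<psi> \<in> borel_measurable borel" using assms by auto
  have ev: "\<forall>\<^sub>F n in sequentially. T n > t / 2"
    using order_tendstoD(1)[OF T, of "t / 2"] t by auto
  \<comment> \<open>Keeps all times above t/2, so that one constant bounds the kernels for every n;
    eventually nothing is changed.\<close>
  define T' where "T' n = max (T n) (t / 2)" for n
  have T': "T' \<longlonglongrightarrow> t"
    unfolding T'_def using tendsto_max[OF T tendsto_const[of "t / 2"]] t by simp
  have "(\<lambda>n. heat (T' n) \<psi> (X n)) \<longlonglongrightarrow> heat t \<psi> x"
    unfolding heat_def
  proof (rule integral_dominated_convergence[where w = "\<lambda>\<xi>. (4 * pi * (t / 2)) powr (- real DIM('a) / 2) * \<bar>\<psi> \<xi>\<bar>"])
    show "AE \<xi> in lborel. (\<lambda>n. gauss (X n - \<xi>) (T' n) * \<psi> \<xi>) \<longlonglongrightarrow> gauss (x - \<xi>) t * \<psi> \<xi>"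
      using X T' t by (intro AE_I2 tendsto_intros tendsto_gauss)
    fix n
    have "gauss (X n - \<xi>) (T' n) \<le> (4 * pi * (t / 2)) powr (- real DIM('a) / 2)" for \<xi>
    proof -
      have "gauss (X n - \<xi>) (T' n) \<le> (4 * pi * T' n) powr (- real DIM('a) / 2)"
        using t by (intro gauss_le) (auto simp: T'_def)
      also have "\<dots> \<le> (4 * pi * (t / 2)) powr (- real DIM('a) / 2)"
        using t by (intro powr_mono2') (auto simp: T'_def)
      finally show ?thesis .
    qed
    then show "AE \<xi> in lborel. norm (gauss (X n - \<xi>) (T' n) * \<psi> \<xi>) \<le> (4 * pi * (t / 2)) powr (- real DIM('a) / 2) * \<bar>\<psi> \<xi>\<bar>"
      by (auto simp: abs_mult intro!: mult_right_mono)
  qed (use \<psi> in auto)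
  moreover have "\<forall>\<^sub>F n in sequentially. heat (T' n) \<psi> (X n) = heat (T n) \<psi> (X n)"
    using ev by eventually_elim (simp add: T'_def)
  ultimately show ?thesis by (rule Lim_transform_eventually)
qed

text \<open>The rate 1/16 is the one freed by passing from G(2t) to G(4t).\<close>

lemma poly_le_exp_square:
  fixes l :: real
  assumes "l \<ge> 0"
  obtains c where "c > 0" "\<And>r. r \<ge> 0 \<Longrightarrow> (1 + r) powr l \<le> c * exp (r\<^sup>2 / 16)"
proof -
  \<comment> \<open>Strictly positive also for l = 0, so that one may divide by it.\<close>
  define k where "k = l + 1"
  have k: "k > 0" using assms by (simp add: k_def)
  have "(1 + r) powr l \<le> (k powr k * exp 5) * exp (r\<^sup>2 / 16)" if r: "r \<ge> 0" for r
  proof -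
    have "(1 + r) / k \<le> exp ((1 + r) / k)" using exp_ge_add_one_self[of "(1 + r) / k"] by linarith
    then have "((1 + r) / k) powr k \<le> exp ((1 + r) / k) powr k"
      using r k by (intro powr_mono2) auto
    also have "\<dots> = exp (1 + r)" using k by (simp add: powr_def)
    finally have "(1 + r) powr k \<le> k powr k * exp (1 + r)"
      using r k by (simp add: powr_divide field_simps)
    moreover have "(1 + r) powr l \<le> (1 + r) powr k" using r by (intro powr_mono) (auto simp: k_def)
    \<comment> \<open>The constant 5 is 1 + 4, where 4 comes from (r - 8)^2 \<ge> 0.\<close>
    moreover have "exp (1 + r) \<le> exp 5 * exp (r\<^sup>2 / 16)"
    proof -
      have "r \<le> 4 + r\<^sup>2 / 16"
        using zero_le_power2[of "r - 8"] by (simp add: power2_eq_square algebra_simps)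
      then show ?thesis by (simp flip: exp_add)
    qed
    then have "k powr k * exp (1 + r) \<le> k powr k * (exp 5 * exp (r\<^sup>2 / 16))"
      by (intro mult_left_mono) auto
    ultimately show ?thesis by (simp add: mult.assoc)
  qed
  then show thesis using that[of "k powr k * exp 5"] k by simp
qed

text \<open>The weight is submultiplicative, so it splits between the kernel and the datum. The
  kernel's share lives on the diffusive length sqrt (1 + t), which produces the growth (1 +
  t)^(l/2); the polynomial left over is absorbed by passing from time 2t to time 4t.\<close>

lemma heat_weighted_bound:
  fixes \<psi> :: "'a::euclidean_space \<Rightarrow> real"
  assumes l: "l \<ge> 0" and \<psi>: "integrable lborel \<psi>" "\<And>x. 0 \<le> \<psi> x"
    and w: "integrable lborel (\<lambda>x. (1 + norm x) powr l * \<psi> x)"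
  obtains c where "c > 0" "\<And>t. t > 0 \<Longrightarrow>
    (\<integral>\<^sup>+x. ennreal ((1 + norm x) powr l * heat (2 * t) \<psi> x) \<partial>lborel) \<le> ennreal (c * (1 + t) powr (l / 2))"
proof -
  have [measurable]: "\<psi> \<in> borel_measurable borel" using \<psi> by auto
  obtain d where d: "d > 0" "\<And>r. r \<ge> 0 \<Longrightarrow> (1 + r) powr l \<le> d * exp (r\<^sup>2 / 16)"
    using poly_le_exp_square[OF l] by blast
  define e where "e = 2 powr (real DIM('a) / 2)"
  define W where "W = (\<integral>x. (1 + norm x) powr l * \<psi> x \<partial>lborel)"
  have W: "W \<ge> 0" unfolding W_def using \<psi> by (intro integral_nonneg_AE) auto
  have pt: "(1 + norm z) powr l * gauss z (2 * t) \<le> d * e * (1 + t) powr (l / 2) * gauss z (4 * t)"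
    if t: "t > 0" for z :: 'a and t
  proof -
    \<comment> \<open>Scaling with 1 + t instead of t keeps the summand 1 of the weight under
      control for small t.\<close>
    define r where "r = norm z / sqrt (1 + t)"
    have r: "r \<ge> 0" using t by (simp add: r_def)
    have "1 + norm z \<le> sqrt (1 + t) * (1 + r)"
    proof -
      have "sqrt (1 + t) * (1 + r) = sqrt (1 + t) + norm z" using t by (simp add: r_def distrib_left)
      moreover have "1 \<le> sqrt (1 + t)" using t by simp
      ultimately show ?thesis by simp
    qed
    then have "(1 + norm z) powr l \<le> (sqrt (1 + t) * (1 + r)) powr l"
      using l by (intro powr_mono2) auto
    also have "\<dots> = (1 + t) powr (l / 2) * (1 + r) powr l"
      using t r by (simp add: powr_mult powr_half_sqrt[symmetric] powr_powr)
    also have "\<dots> \<le> (1 + t) powr (l / 2) * (d * exp (r\<^sup>2 / 16))"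
      using d(2)[OF r] by (intro mult_left_mono) auto
    also have "\<dots> \<le> (1 + t) powr (l / 2) * (d * exp ((norm z)\<^sup>2 / (16 * t)))"
    proof -
      have "r\<^sup>2 = (norm z)\<^sup>2 / (1 + t)" using t by (simp add: r_def power_divide)
      also have "\<dots> \<le> (norm z)\<^sup>2 / t" using t by (intro divide_left_mono) auto
      finally show ?thesis using d(1) by (intro mult_left_mono) auto
    qed
    finally have 1: "(1 + norm z) powr l \<le> (1 + t) powr (l / 2) * (d * exp ((norm z)\<^sup>2 / (16 * t)))" .
    have "gauss z (2 * t) = e * gauss z (4 * t) * exp (- ((norm z)\<^sup>2 / (16 * t)))"
      unfolding e_def using t gauss_scale[of "2 * t" 2 z] by (simp add: field_simps)
    then have "(1 + norm z) powr l * gauss z (2 * t)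
       \<le> (1 + t) powr (l / 2) * (d * exp ((norm z)\<^sup>2 / (16 * t))) * (e * gauss z (4 * t) * exp (- ((norm z)\<^sup>2 / (16 * t))))"
      using 1 by (simp only:) (intro mult_right_mono, auto simp: e_def)
    also have "\<dots> = d * e * (1 + t) powr (l / 2) * gauss z (4 * t)"
      by (simp add: exp_minus field_simps)
    finally show ?thesis .
  qed
  have main: "(\<integral>\<^sup>+x. ennreal ((1 + norm x) powr l * heat (2 * t) \<psi> x) \<partial>lborel)
      \<le> ennreal ((d * e * (W + 1)) * (1 + t) powr (l / 2))" if t: "t > 0" for t
  proof -
    define k where "k = d * e * (1 + t) powr (l / 2)"
    have k: "k \<ge> 0" using d by (simp add: k_def e_def)
    have "(\<integral>\<^sup>+x. ennreal ((1 + norm x) powr l * heat (2 * t) \<psi> x) \<partial>lborel)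
      = (\<integral>\<^sup>+x. ennreal ((1 + norm x) powr l) * (\<integral>\<^sup>+\<xi>. ennreal (gauss (x - \<xi>) (2 * t) * \<psi> \<xi>) \<partial>lborel) \<partial>lborel)"
      using ennreal_heat[OF \<psi>(1) _ \<psi>(2), of "2 * t"] t by (simp add: ennreal_mult heat_nonneg \<psi>)
    also have "\<dots> = (\<integral>\<^sup>+x. \<integral>\<^sup>+\<xi>. ennreal ((1 + norm x) powr l * (gauss (x - \<xi>) (2 * t) * \<psi> \<xi>)) \<partial>lborel \<partial>lborel)"
      using \<psi> by (subst nn_integral_cmult[symmetric]) (auto simp: ennreal_mult)
    also have "\<dots> \<le> (\<integral>\<^sup>+x. \<integral>\<^sup>+\<xi>. ennreal (gauss (x - \<xi>) (4 * t)) * ennreal (k * ((1 + norm \<xi>) powr l * \<psi> \<xi>)) \<partial>lborel \<partial>lborel)"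
    proof (intro nn_integral_mono)
      fix x \<xi> :: 'a
      have "1 + norm x \<le> (1 + norm (x - \<xi>)) * (1 + norm \<xi>)"
        using norm_triangle_sub[of x \<xi>] mult_nonneg_nonneg[OF norm_ge_zero[of "x - \<xi>"] norm_ge_zero[of \<xi>]]
        by (simp only: algebra_simps)
      then have "(1 + norm x) powr l \<le> ((1 + norm (x - \<xi>)) * (1 + norm \<xi>)) powr l"
        using l by (intro powr_mono2) auto
      then have "(1 + norm x) powr l \<le> (1 + norm (x - \<xi>)) powr l * (1 + norm \<xi>) powr l"
        by (simp add: powr_mult)
      then have "(1 + norm x) powr l * (gauss (x - \<xi>) (2 * t) * \<psi> \<xi>)
        \<le> ((1 + norm (x - \<xi>)) powr l * (1 + norm \<xi>) powr l) * (gauss (x - \<xi>) (2 * t) * \<psi> \<xi>)"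
        using \<psi> by (intro mult_right_mono) auto
      also have "\<dots> = ((1 + norm (x - \<xi>)) powr l * gauss (x - \<xi>) (2 * t)) * ((1 + norm \<xi>) powr l * \<psi> \<xi>)"
        by (simp add: mult_ac)
      also have "\<dots> \<le> (k * gauss (x - \<xi>) (4 * t)) * ((1 + norm \<xi>) powr l * \<psi> \<xi>)"
        using pt[OF t, of "x - \<xi>"] \<psi> by (intro mult_right_mono) (auto simp: k_def)
      finally show "ennreal ((1 + norm x) powr l * (gauss (x - \<xi>) (2 * t) * \<psi> \<xi>))
        \<le> ennreal (gauss (x - \<xi>) (4 * t)) * ennreal (k * ((1 + norm \<xi>) powr l * \<psi> \<xi>))"
        using k \<psi> by (subst ennreal_mult[symmetric]) (auto simp: mult_ac)
    qed
    also have "\<dots> = (\<integral>\<^sup>+\<xi>. \<integral>\<^sup>+x. ennreal (gauss (x - \<xi>) (4 * t)) * ennreal (k * ((1 + norm \<xi>) powr l * \<psi> \<xi>)) \<partial>lborel \<partial>lborel)"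
      by (rule lborel_pair.Fubini') measurable
    also have "\<dots> = (\<integral>\<^sup>+\<xi>. ennreal (k * ((1 + norm \<xi>) powr l * \<psi> \<xi>)) \<partial>lborel)"
      using t by (simp add: nn_integral_multc nn_integral_gauss)
    also have "\<dots> = ennreal (k * W)"
      unfolding W_def using k w \<psi> by (subst nn_integral_eq_integral) auto
    \<comment> \<open>W + 1 in place of W makes the constant positive even for the zero
      datum.\<close>
    also have "\<dots> \<le> ennreal ((d * e * (W + 1)) * (1 + t) powr (l / 2))"
      using d(1) by (intro ennreal_leI) (auto simp: k_def e_def field_simps)
    finally show ?thesis .
  qed
  show thesis
    by (rule that[OF _ main]) (use d W in \<open>auto simp: e_def\<close>)
qed

section \<open>Scalar Volterra estimates\<close>

lemma nn_integral_powr_Ioo: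
  assumes "p < 1" "t > 0"
  shows "(\<integral>\<^sup>+s\<in>{0<..<t}. ennreal (s powr - p) \<partial>lborel) = ennreal (t powr (1 - p) / (1 - p))"
proof -
  have "((\<lambda>x. x powr (- p)) has_integral (t powr (- p + 1) / (- p + 1))) {0..t}"
    using assms by (intro has_integral_powr_from_0) auto
  then have "((\<lambda>x. x powr (- p)) has_integral (t powr (1 - p) / (1 - p))) {0<..<t}"
    by (simp add: has_integral_Icc_iff_Ioo add.commute)
  then have "((\<lambda>x. indicator {0<..<t} x * x powr (- p)) has_integral (t powr (1 - p) / (1 - p))) UNIV"
    by (subst (asm) has_integral_restrict_UNIV[symmetric], elim has_integral_eq[rotated])
       (auto simp: indicator_def)
  then have "integral\<^sup>N lborel (\<lambda>x. ennreal (indicator {0<..<t} x * x powr (- p))) = ennreal (t powr (1 - p) / (1 - p))"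
    by (intro nn_integral_has_integral_lborel) auto
  then show ?thesis
    by (subst (asm) ennreal_mult) (auto simp: mult.commute ennreal_indicator)
qed

lemma nn_integral_powr_Ioo_reflect:
  assumes "p < 1" "t > 0"
  shows "(\<integral>\<^sup>+s\<in>{0<..<t}. ennreal ((t - s) powr - p) \<partial>lborel) = ennreal (t powr (1 - p) / (1 - p))"
proof -
  have "(\<integral>\<^sup>+s\<in>{0<..<t}. ennreal (s powr - p) \<partial>lborel)
    = (\<integral>\<^sup>+s. ennreal ((t - s) powr - p) * indicator {0<..<t} (t - s) \<partial>lborel)"
    using nn_integral_real_affine[of "\<lambda>s. ennreal (s powr - p) * indicator {0<..<t} s" "-1" t] by simp
  also have "\<dots> = (\<integral>\<^sup>+s\<in>{0<..<t}. ennreal ((t - s) powr - p) \<partial>lborel)"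
    by (intro nn_integral_cong) (auto simp: indicator_def)
  finally show ?thesis using nn_integral_powr_Ioo[OF assms] by simp
qed

text \<open>A Beta integral: on each half of (0, t) one of the two factors is nonsingular and
  bounded by its value at t/2. For b > 1/2 the resulting power of t is negative, which is the source
  of all decay.\<close>

lemma nn_integral_beta_bound:
  assumes b: "1 / 2 < b" "b < 1"
  obtains \<kappa> where "\<kappa> > 0" "\<And>t. t > 0 \<Longrightarrow>
    (\<integral>\<^sup>+s\<in>{0<..<t}. ennreal ((t - s) powr (- 1 / 2) * s powr - b) \<partial>lborel) \<le> ennreal (\<kappa> * t powr (1 / 2 - b))"
proof -
  define c where "c = (1 / 2) powr (- 1 / 2) / (1 - b)"
  define d where "d = 2 * (1 / 2) powr - b"
  have cd: "c > 0" "d > 0" using b by (auto simp: c_def d_def)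
  have "(\<integral>\<^sup>+s\<in>{0<..<t}. ennreal ((t - s) powr (- 1 / 2) * s powr - b) \<partial>lborel) \<le> ennreal ((c + d) * t powr (1 / 2 - b))"
    if t: "t > 0" for t :: real
  proof -
    have "(\<integral>\<^sup>+s\<in>{0<..<t}. ennreal ((t - s) powr (- 1 / 2) * s powr - b) \<partial>lborel)
      \<le> (\<integral>\<^sup>+s. ennreal ((t / 2) powr (- 1 / 2)) * (ennreal (s powr - b) * indicator {0<..<t} s)
            + ennreal ((t / 2) powr - b) * (ennreal ((t - s) powr (- (1 / 2))) * indicator {0<..<t} s) \<partial>lborel)"
    proof (rule nn_integral_mono)
      fix s
      show "ennreal ((t - s) powr (- 1 / 2) * s powr - b) * indicator {0<..<t} s
        \<le> ennreal ((t / 2) powr (- 1 / 2)) * (ennreal (s powr - b) * indicator {0<..<t} s)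
            + ennreal ((t / 2) powr - b) * (ennreal ((t - s) powr (- (1 / 2))) * indicator {0<..<t} s)"
      proof (cases "s \<in> {0<..<t}")
        case True
        have "(t - s) powr (- 1 / 2) * s powr - b \<le> (t / 2) powr (- 1 / 2) * s powr - b + (t / 2) powr - b * (t - s) powr (- 1 / 2)"
        proof (cases "s \<le> t / 2")
          case True
          then have "(t - s) powr (- 1 / 2) \<le> (t / 2) powr (- 1 / 2)"
            using t by (intro powr_mono2') auto
          then show ?thesis by (intro add_increasing2 mult_right_mono) auto
        next
          case False
          then have "s powr - b \<le> (t / 2) powr - b" using t b by (intro powr_mono2') auto
          then have "(t - s) powr (- 1 / 2) * s powr - b \<le> (t / 2) powr - b * (t - s) powr (- 1 / 2)"
            by (subst mult.commute) (intro mult_right_mono, auto)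
          then show ?thesis by (intro add_increasing) auto
        qed
        then show ?thesis using True
          by (simp flip: ennreal_mult ennreal_plus)
      qed simp
    qed
    also have "\<dots> = ennreal ((t / 2) powr (- 1 / 2)) * ennreal (t powr (1 - b) / (1 - b))
        + ennreal ((t / 2) powr - b) * ennreal (t powr (1 - 1 / 2) / (1 - 1 / 2))"
      using t b
      by (subst nn_integral_add, simp, simp)
         (auto simp: nn_integral_cmult nn_integral_powr_Ioo nn_integral_powr_Ioo_reflect[of "1/2", simplified])
    also have "\<dots> = ennreal ((t / 2) powr (- 1 / 2) * (t powr (1 - b) / (1 - b)) + (t / 2) powr - b * (t powr (1 - 1 / 2) / (1 - 1 / 2)))"
      using b by (simp flip: ennreal_mult ennreal_plus)
    also have "(t / 2) powr (- 1 / 2) * (t powr (1 - b) / (1 - b)) = c * t powr (1 / 2 - b)"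
    proof -
      have "(t / 2) powr (- 1 / 2) = (1 / 2) powr (- 1 / 2) * t powr (- 1 / 2)"
        using powr_mult[of "1/2" t "- 1 / 2"] by simp
      moreover have "t powr (- 1 / 2) * t powr (1 - b) = t powr (1 / 2 - b)"
        by (simp flip: powr_add)
      ultimately show ?thesis by (simp add: c_def)
    qed
    also have "(t / 2) powr - b * (t powr (1 - 1 / 2) / (1 - 1 / 2)) = d * t powr (1 / 2 - b)"
    proof -
      have "(t / 2) powr - b = (1 / 2) powr - b * t powr - b"
        using powr_mult[of "1/2" t "- b"] by simp
      moreover have "t powr - b * t powr (1 / 2) = t powr (1 / 2 - b)"
        by (simp flip: powr_add)
      ultimately show ?thesis by (simp add: d_def)
    qed
    finally show ?thesis by (simp add: distrib_right)
  qed
  then show thesis using that[of "c + d"] cd by simp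
qed

text \<open>A > 1 keeps the exponent above 1/2, so that the Beta integral decays; the cap 3/4, an
  arbitrary number between 1/2 and 1, keeps s powr - b integrable at 0.\<close>

lemma decay_le_powr:
  fixes A s :: real
  assumes "A > 1" "s > 0"
  shows "(1 + s) powr (- A + 1 / 2) \<le> s powr - (min (A - 1 / 2) (3 / 4))"
proof -
  have "(1 + s) powr (- A + 1 / 2) \<le> (1 + s) powr - (min (A - 1 / 2) (3 / 4))"
    using assms by (intro powr_mono) auto
  also have "\<dots> \<le> s powr - (min (A - 1 / 2) (3 / 4))"
    using assms by (intro powr_mono2') auto
  finally show ?thesis .
qed

text \<open>Makes the Duhamel term o(1) relative to V once the solution is known to be at most a
  constant times V. \<open>J\<close> is strictly positive because it is later used as a real
  coefficient inside ennreal.\<close>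

lemma duhamel_weight_decay:
  fixes A C :: real
  assumes A: "A > 1" and C: "C > 0"
  obtains J :: "real \<Rightarrow> real" where "(J \<longlongrightarrow> 0) at_top" "\<And>t. t > 0 \<Longrightarrow> J t > 0"
    "\<And>t. t > 0 \<Longrightarrow> (\<integral>\<^sup>+s\<in>{0<..<t}. ennreal ((t - s) powr (- 1 / 2) * (C * (1 + s) powr (- A + 1 / 2))) \<partial>lborel) \<le> ennreal (J t)"
proof -
  define b where "b = min (A - 1 / 2) (3 / 4)"
  have b: "1 / 2 < b" "b < 1" using A by (auto simp: b_def)
  obtain \<kappa> where \<kappa>: "\<kappa> > 0" "\<And>t. t > 0 \<Longrightarrow>
    (\<integral>\<^sup>+s\<in>{0<..<t}. ennreal ((t - s) powr (- 1 / 2) * s powr - b) \<partial>lborel) \<le> ennreal (\<kappa> * t powr (1 / 2 - b))"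
    using nn_integral_beta_bound[OF b] by blast
  show thesis
  proof (rule that)
    have "((\<lambda>t::real. t powr - (b - 1 / 2)) \<longlongrightarrow> 0) at_top"
      using b by (intro tendsto_neg_powr filterlim_ident) auto
    from tendsto_mult_right_zero[OF this, of "C * \<kappa>"]
    show "((\<lambda>t. C * \<kappa> * t powr (1 / 2 - b)) \<longlongrightarrow> 0) at_top" by simp
    fix t :: real assume t: "t > 0"
    show "C * \<kappa> * t powr (1 / 2 - b) > 0" using C \<kappa> t by simp
    have "(\<integral>\<^sup>+s\<in>{0<..<t}. ennreal ((t - s) powr (- 1 / 2) * (C * (1 + s) powr (- A + 1 / 2))) \<partial>lborel)
      \<le> (\<integral>\<^sup>+s. ennreal C * (ennreal ((t - s) powr (- 1 / 2) * s powr - b) * indicator {0<..<t} s) \<partial>lborel)"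
    proof (rule nn_integral_mono)
      fix s
      show "ennreal ((t - s) powr (- 1 / 2) * (C * (1 + s) powr (- A + 1 / 2))) * indicator {0<..<t} s
         \<le> ennreal C * (ennreal ((t - s) powr (- 1 / 2) * s powr - b) * indicator {0<..<t} s)"
      proof (cases "s \<in> {0<..<t}")
        case True
        then have "(t - s) powr (- 1 / 2) * (C * (1 + s) powr (- A + 1 / 2)) \<le> (t - s) powr (- 1 / 2) * (C * s powr - b)"
          using decay_le_powr[OF A, of s] C by (intro mult_left_mono) (auto simp: b_def)
        then show ?thesis using True C by (simp add: mult_ac flip: ennreal_mult)
      qed simp
    qed
    also have "\<dots> \<le> ennreal C * ennreal (\<kappa> * t powr (1 / 2 - b))"
      using \<kappa>(2)[OF t] by (subst nn_integral_cmult) (auto intro!: mult_left_mono)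
    also have "\<dots> = ennreal (C * \<kappa> * t powr (1 / 2 - b))"
      using C \<kappa> by (simp add: mult.assoc flip: ennreal_mult)
    finally show "(\<integral>\<^sup>+s\<in>{0<..<t}. ennreal ((t - s) powr (- 1 / 2) * (C * (1 + s) powr (- A + 1 / 2))) \<partial>lborel)
       \<le> ennreal (C * \<kappa> * t powr (1 / 2 - b))" .
  qed
qed

text \<open>The exponent 1/4 trades part of the exponential for smallness in \<mu>: together with
  the kernel singularity 1/2 it leaves 3/4 < 1, which is still integrable.\<close>

lemma exp_neg_le_powr:
  fixes x :: real
  assumes "x > 0"
  shows "exp (- x) \<le> x powr (- 1 / 4)"
proof -
  have "x powr (1 / 4) \<le> (1 + x) powr 1"
    using assms order_trans[OF powr_mono2[of "1/4" x "1 + x"] powr_mono[of "1/4" 1 "1 + x"]] by simp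
  also have "\<dots> \<le> exp x" using assms exp_ge_add_one_self[of x] by simp
  finally have "inverse (exp x) \<le> inverse (x powr (1 / 4))" using assms by (intro le_imp_inverse_le) auto
  then show ?thesis by (simp add: exp_minus powr_minus)
qed

text \<open>The weight is \<open>2 c exp (\<mu> min t T)\<close>: past \<open>T\<close> the decay of \<open>(1 + s) powr (- A + 1/2)\<close> makes the
  integral operator contractive, and before \<open>T\<close> the exponential with large \<open>\<mu>\<close> does.\<close>
lemma volterra_supersolution:
  fixes A C c :: real
  assumes A: "A > 1" and C: "C > 0" and c: "c > 0"
  obtains h :: "real \<Rightarrow> real" and H :: real where "h \<in> borel_measurable borel" "\<And>t. 0 \<le> h t" "\<And>t. h t \<le> H"
    "\<And>t. t > 0 \<Longrightarrow> ennreal c + ennreal c *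
       (\<integral>\<^sup>+s\<in>{0<..<t}. ennreal ((t - s) powr (- 1 / 2) * (C * (1 + s) powr (- A + 1 / 2) * h s)) \<partial>lborel) \<le> ennreal (h t)"
proof -
  define b where "b = min (A - 1 / 2) (3 / 4)"
  have b: "1 / 2 < b" "b < 1" using A by (auto simp: b_def)
  obtain \<kappa> where \<kappa>: "\<kappa> > 0" "\<And>t. t > 0 \<Longrightarrow>
    (\<integral>\<^sup>+s\<in>{0<..<t}. ennreal ((t - s) powr (- 1 / 2) * s powr - b) \<partial>lborel) \<le> ennreal (\<kappa> * t powr (1 / 2 - b))"
    using nn_integral_beta_bound[OF b] by blast
  \<comment> \<open>\<delta> and \<epsilon> are chosen so that the late part p \<kappa> \<delta> and
    the early part 4 p \<epsilon> T^(1/4) of the integral estimate each equal E t / 2.\<close>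
  define \<delta> where "\<delta> = 1 / (4 * c * C * \<kappa>)"
  have \<delta>: "\<delta> > 0" using c C \<kappa> by (simp add: \<delta>_def)
  define T where "T = \<delta> powr (1 / (1 / 2 - b))"
  have T: "T > 0" "T powr (1 / 2 - b) = \<delta>" using \<delta> b by (auto simp: T_def powr_powr)
  define \<epsilon> where "\<epsilon> = 1 / (16 * c * C * T powr (1 / 4))"
  have \<epsilon>: "\<epsilon> > 0" using c C T by (simp add: \<epsilon>_def)
  define \<mu> where "\<mu> = \<epsilon> powr (- 4)"
  have \<mu>: "\<mu> > 0" "\<mu> powr (- 1 / 4) = \<epsilon>" using \<epsilon> by (auto simp: \<mu>_def powr_powr)
  define E where "E t = exp (\<mu> * min t T)" for t
  have E: "E t > 0" "E t \<le> exp (\<mu> * T)" for t using \<mu> by (auto simp: E_def)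
  \<comment> \<open>The factor 2 makes room for the constant term: c + c E t \<le> 2 c E t, as E t
    \<ge> 1 for t > 0.\<close>
  define h where "h t = 2 * c * E t" for t
  show thesis
  proof (rule that)
    show "h \<in> borel_measurable borel" unfolding h_def E_def by measurable
    show "0 \<le> h t" for t using c E(1)[of t] by (simp add: h_def)
    show "h t \<le> 2 * c * exp (\<mu> * T)" for t using c E(2)[of t] by (simp add: h_def)
    fix t :: real assume t: "t > 0"
    define m where "m = min t T"
    have m: "m > 0" "m \<le> t" "m \<le> T" using t T by (auto simp: m_def)
    define p where "p = 2 * c * C * E t"
    have p: "p > 0" using c C E(1)[of t] by (simp add: p_def)
    \<comment> \<open>The integrand is split at s = m. Before m the kernel is replaced by (m -
      s)^(-1/2) and the growth of E gains the small factor \<epsilon> (m - s)^(-1/4). Times s \<ge>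
      m occur only for t > T; there E s = E t, and the Beta bound over all of (0, t) is at most
      \<kappa> \<delta>.\<close>
    have "(\<integral>\<^sup>+s\<in>{0<..<t}. ennreal ((t - s) powr (- 1 / 2) * (C * (1 + s) powr (- A + 1 / 2) * h s)) \<partial>lborel)
      \<le> (\<integral>\<^sup>+s. ennreal (p * \<epsilon>) * (ennreal ((m - s) powr (- (3 / 4))) * indicator {0<..<m} s)
           + ennreal p * (ennreal (of_bool (t > T) * ((t - s) powr (- 1 / 2) * s powr - b)) * indicator {0<..<t} s) \<partial>lborel)"
    proof (rule nn_integral_mono)
      fix s
      show "ennreal ((t - s) powr (- 1 / 2) * (C * (1 + s) powr (- A + 1 / 2) * h s)) * indicator {0<..<t} s
        \<le> ennreal (p * \<epsilon>) * (ennreal ((m - s) powr (- (3 / 4))) * indicator {0<..<m} s)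
           + ennreal p * (ennreal (of_bool (t > T) * ((t - s) powr (- 1 / 2) * s powr - b)) * indicator {0<..<t} s)"
      proof (cases "s \<in> {0<..<t}")
        case s: True
        show ?thesis
        proof (cases "s < m")
          case True
          have "(t - s) powr (- 1 / 2) \<le> (m - s) powr (- 1 / 2)"
            using True m by (intro powr_mono2') auto
          moreover have "(1 + s) powr (- A + 1 / 2) \<le> 1"
            using s A powr_mono[of "- A + 1 / 2" 0 "1 + s"] by simp
          moreover have "E s \<le> E t * (\<epsilon> * (m - s) powr (- 1 / 4))"
          proof -
            have "E s = E t * exp (- (\<mu> * (m - s)))"
              using True m by (simp add: E_def m_def[symmetric] right_diff_distrib flip: exp_add)
            also have "exp (- (\<mu> * (m - s))) \<le> (\<mu> * (m - s)) powr (- 1 / 4)"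
              using True \<mu> by (intro exp_neg_le_powr) auto
            also have "\<dots> = \<epsilon> * (m - s) powr (- 1 / 4)" using True \<mu> by (simp add: powr_mult)
            finally show ?thesis using E(1)[of t] by simp
          qed
          ultimately have "(t - s) powr (- 1 / 2) * ((1 + s) powr (- A + 1 / 2) * E s)
             \<le> (m - s) powr (- 1 / 2) * (1 * (E t * (\<epsilon> * (m - s) powr (- 1 / 4))))"
            using E(1) \<epsilon> by (intro mult_mono) (auto simp: less_imp_le)
          then have "2 * c * C * ((t - s) powr (- 1 / 2) * ((1 + s) powr (- A + 1 / 2) * E s))
             \<le> 2 * c * C * ((m - s) powr (- 1 / 2) * (1 * (E t * (\<epsilon> * (m - s) powr (- 1 / 4)))))"
            using c C by (intro mult_left_mono) auto
          also have "\<dots> = p * \<epsilon> * ((m - s) powr (- 1 / 2) * (m - s) powr (- 1 / 4))" by (simp add: p_def)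
          also have "(m - s) powr (- 1 / 2) * (m - s) powr (- 1 / 4) = (m - s) powr (- (3 / 4))"
            by (simp flip: powr_add)
          finally have "(t - s) powr (- 1 / 2) * (C * (1 + s) powr (- A + 1 / 2) * h s) \<le> p * \<epsilon> * (m - s) powr (- (3 / 4))"
            by (simp add: h_def mult_ac)
          then show ?thesis using s True p \<epsilon>
            by (intro add_increasing2) (auto simp flip: ennreal_mult)
        next
          case False
          then have tT: "t > T" "m = T" "s \<ge> T" using s by (auto simp: m_def)
          then have "E s = E t" by (simp add: E_def)
          moreover have "(1 + s) powr (- A + 1 / 2) \<le> s powr - b"
            using decay_le_powr[OF A, of s] s by (simp add: b_def)
          ultimately have "2 * c * C * ((t - s) powr (- 1 / 2) * ((1 + s) powr (- A + 1 / 2) * E s))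
             \<le> 2 * c * C * ((t - s) powr (- 1 / 2) * (s powr - b * E t))"
            using c C E(1)[of t] by (intro mult_left_mono mult_right_mono) auto
          then have "(t - s) powr (- 1 / 2) * (C * (1 + s) powr (- A + 1 / 2) * h s)
             \<le> p * ((t - s) powr (- 1 / 2) * s powr - b)"
            by (simp add: h_def p_def mult_ac)
          then show ?thesis using s tT p
            by (intro add_increasing) (auto simp flip: ennreal_mult)
        qed
      qed simp
    qed
    also have "\<dots> = ennreal (p * \<epsilon>) * ennreal (m powr (1 - 3 / 4) / (1 - 3 / 4))
       + ennreal p * (\<integral>\<^sup>+s\<in>{0<..<t}. ennreal (of_bool (t > T) * ((t - s) powr (- 1 / 2) * s powr - b)) \<partial>lborel)"
      using m nn_integral_powr_Ioo_reflect[of "3 / 4" m]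
      by (subst nn_integral_add, simp, simp) (simp add: nn_integral_cmult)
    also have "\<dots> \<le> ennreal (p * \<epsilon>) * ennreal (4 * T powr (1 / 4)) + ennreal p * ennreal (\<kappa> * \<delta>)"
    proof (intro add_mono mult_left_mono)
      have "m powr (1 / 4) \<le> T powr (1 / 4)" using m by (intro powr_mono2) auto
      then show "ennreal (m powr (1 - 3 / 4) / (1 - 3 / 4)) \<le> ennreal (4 * T powr (1 / 4))" by (intro ennreal_leI) simp
      show "(\<integral>\<^sup>+s\<in>{0<..<t}. ennreal (of_bool (t > T) * ((t - s) powr (- 1 / 2) * s powr - b)) \<partial>lborel) \<le> ennreal (\<kappa> * \<delta>)"
      proof (cases "t > T")
        case True
        have "t powr (1 / 2 - b) \<le> T powr (1 / 2 - b)" using True T b by (intro powr_mono2') auto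
        then have "ennreal (\<kappa> * t powr (1 / 2 - b)) \<le> ennreal (\<kappa> * \<delta>)"
          using \<kappa> T by (intro ennreal_leI mult_left_mono) auto
        then show ?thesis using True \<kappa>(2)[OF t] by simp
      qed simp
    qed auto
    also have "\<dots> = ennreal (p * \<epsilon> * (4 * T powr (1 / 4)) + p * (\<kappa> * \<delta>))"
      using p \<epsilon> \<kappa> \<delta> by (simp flip: ennreal_mult ennreal_plus)
    also have "p * \<epsilon> * (4 * T powr (1 / 4)) + p * (\<kappa> * \<delta>) = E t"
      using c C T \<kappa> by (simp add: p_def \<epsilon>_def \<delta>_def field_simps)
    finally have "ennreal c + ennreal c * (\<integral>\<^sup>+s\<in>{0<..<t}. ennreal ((t - s) powr (- 1 / 2) * (C * (1 + s) powr (- A + 1 / 2) * h s)) \<partial>lborel)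
       \<le> ennreal c + ennreal c * ennreal (E t)"
      by (intro add_mono mult_left_mono) auto
    also have "\<dots> = ennreal (c + c * E t)"
      using c E(1)[of t] by (simp flip: ennreal_mult ennreal_plus)
    also have "\<dots> \<le> ennreal (h t)"
    proof -
      have "1 \<le> E t" using t T \<mu> by (simp add: E_def)
      then show ?thesis using c by (intro ennreal_leI) (simp add: h_def)
    qed
    finally show "ennreal c + ennreal c * (\<integral>\<^sup>+s\<in>{0<..<t}. ennreal ((t - s) powr (- 1 / 2) * (C * (1 + s) powr (- A + 1 / 2) * h s)) \<partial>lborel)
       \<le> ennreal (h t)" .
  qed
qed

section \<open>Large-time behaviour of the free evolution\<close>

text \<open>Parabolic self-similarity; it turns large times into a limit at time 1.\<close>

lemma gauss_dilate:
  assumes "c > 0" "t > 0"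
  shows "c ^ DIM('a) * gauss (c *\<^sub>R x :: 'a::euclidean_space) (c\<^sup>2 * t) = gauss x t"
proof -
  have "(4 * pi * (c\<^sup>2 * t)) powr (- real DIM('a) / 2) = (c\<^sup>2) powr (- real DIM('a) / 2) * (4 * pi * t) powr (- real DIM('a) / 2)"
    using powr_mult[of "c\<^sup>2" "4 * pi * t" "- real DIM('a) / 2"] by (simp add: mult_ac)
  moreover have "(c\<^sup>2) powr (- real DIM('a) / 2) = inverse (c ^ DIM('a))"
    using assms by (simp add: powr_powr powr_minus powr_realpow flip: powr_numeral)
  ultimately show ?thesis using assms
    by (simp add: gauss_def power_mult_distrib)
qed

lemma lborel_integral_dilate:
  fixes f :: "'a::euclidean_space \<Rightarrow> real"
  assumes [measurable]: "f \<in> borel_measurable borel" and c: "c > 0"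
  shows "(\<integral>x. f x \<partial>lborel) = (\<integral>x. c ^ DIM('a) * f (c *\<^sub>R x) \<partial>lborel)"
proof -
  have "(\<integral>x. f x \<partial>lborel) = (\<integral>x. f x \<partial>(density (distr lborel borel (\<lambda>x. 0 + c *\<^sub>R x)) (\<lambda>_. ennreal (\<bar>c\<bar> ^ DIM('a)))))"
    using c by (subst lborel_affine[of c 0]) (auto simp: ennreal_power)
  also have "\<dots> = (\<integral>x. \<bar>c\<bar> ^ DIM('a) *\<^sub>R f x \<partial>(distr lborel borel (\<lambda>x. 0 + c *\<^sub>R x)))"
    by (subst integral_density) auto
  also have "\<dots> = (\<integral>x. \<bar>c\<bar> ^ DIM('a) *\<^sub>R f (0 + c *\<^sub>R x) \<partial>lborel)"
    by (subst integral_distr) auto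
  finally show ?thesis using c by simp
qed

text \<open>The L^1 error of the asymptotics when the datum is a unit point mass at \<xi>; a general
  datum is a superposition of these.\<close>

definition gauss_gap :: "'a::euclidean_space \<Rightarrow> real \<Rightarrow> real" where
  "gauss_gap \<xi> t = (\<integral>y. \<bar>gauss (y - \<xi>) t - gauss y (1 + t)\<bar> \<partial>lborel)"

lemma integral_gauss:
  assumes "t > 0"
  shows "(\<integral>y. gauss (y - m :: 'a::euclidean_space) t \<partial>lborel) = 1"
  using nn_integral_gauss[OF assms, of m] by (subst integral_eq_nn_integral) auto

text \<open>After rescaling lengths by sqrt t the two kernels become a kernel shifted by \<xi> /
  sqrt t at time 1 and a centred one at time 1 + 1/t. Both tend to the kernel at time 1, and their
  sum is a majorant of constant mass 2.\<close>

lemma gauss_gap_tendsto_0: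
  fixes \<xi> :: "'a::euclidean_space"
  shows "(gauss_gap \<xi> \<longlongrightarrow> 0) at_top"
proof (rule tendsto_at_topI_sequentially)
  fix X :: "nat \<Rightarrow> real" assume X: "filterlim X at_top sequentially"
  \<comment> \<open>The rescaling needs a positive time for every n, which X guarantees only
    eventually.\<close>
  define T where "T n = max (X n) 1" for n
  have T1: "T n \<ge> 1" for n by (simp add: T_def)
  have Tlim: "filterlim T at_top sequentially"
    by (rule filterlim_at_top_mono[OF X]) (auto simp: T_def)
  define f where "f n z = gauss (z - (1 / sqrt (T n)) *\<^sub>R \<xi>) 1 - gauss z (1 + 1 / T n)" for n z
  define g where "g n z = gauss (z - (1 / sqrt (T n)) *\<^sub>R \<xi>) 1 + gauss z (1 + 1 / T n)" for n z
  have s0: "(\<lambda>n. 1 / sqrt (T n)) \<longlonglongrightarrow> 0"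
    using Tlim by (intro tendsto_divide_0[OF tendsto_const] filterlim_at_top_imp_at_infinity filterlim_compose[OF sqrt_at_top])
  have i0: "(\<lambda>n. 1 / T n) \<longlonglongrightarrow> 0"
    using Tlim by (intro tendsto_divide_0[OF tendsto_const] filterlim_at_top_imp_at_infinity)
  have l1: "(\<lambda>n. gauss (z - (1 / sqrt (T n)) *\<^sub>R \<xi>) 1) \<longlonglongrightarrow> gauss z 1" for z
  proof -
    have "(\<lambda>n. z - (1 / sqrt (T n)) *\<^sub>R \<xi>) \<longlonglongrightarrow> z - 0 *\<^sub>R \<xi>"
      by (intro tendsto_intros s0)
    then show ?thesis by (intro tendsto_gauss) auto
  qed
  have l2: "(\<lambda>n. gauss z (1 + 1 / T n)) \<longlonglongrightarrow> gauss z 1" for z :: 'a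
  proof -
    have "(\<lambda>n. 1 + 1 / T n) \<longlonglongrightarrow> 1 + 0" by (intro tendsto_intros i0)
    then show ?thesis by (intro tendsto_gauss) auto
  qed
  have pos: "0 < 1 + 1 / T n" for n using T1[of n] by (simp add: add_pos_nonneg)
  have "(\<lambda>n. \<integral>z. norm (f n z - 0) \<partial>lborel) \<longlonglongrightarrow> 0"
  proof (rule generalised_dominated_convergence(3)[where g = g and ?g0.0 = "\<lambda>z. 2 * gauss z 1" and c = "\<lambda>_. 2" and ?c0.0 = 2])
    show "AE z in lborel. (\<lambda>n. f n z) \<longlonglongrightarrow> 0"
      unfolding f_def by (intro AE_I2, rule tendsto_eq_rhs[OF tendsto_diff[OF l1 l2]]) simp
    show "AE z in lborel. (\<lambda>n. g n z) \<longlonglongrightarrow> 2 * gauss z 1"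
      unfolding g_def by (intro AE_I2, rule tendsto_eq_rhs[OF tendsto_add[OF l1 l2]]) simp
    show "AE z in lborel. norm (f n z) \<le> g n z" for n
      unfolding f_def g_def real_norm_def
      by (intro AE_I2 order_trans[OF abs_triangle_ineq4]) simp
    show "(\<integral>\<^sup>+z. ennreal (g n z) \<partial>lborel) = ennreal 2" for n
      unfolding g_def using nn_integral_gauss[OF pos[of n], of "0::'a"]
      by (simp add: nn_integral_add nn_integral_gauss)
    show "(\<integral>\<^sup>+z. ennreal (2 * gauss (z::'a) 1) \<partial>lborel) = ennreal 2"
      using nn_integral_gauss[of 1 "0::'a"] by (simp add: ennreal_mult nn_integral_cmult)
  qed (auto simp: f_def[abs_def] g_def[abs_def])
  moreover have "gauss_gap \<xi> (T n) = (\<integral>z. norm (f n z - 0) \<partial>lborel)" for n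
  proof -
    define c where "c = sqrt (T n)"
    have c: "c > 0" "T n = c\<^sup>2" using T1[of n] by (auto simp: c_def)
    have "c ^ DIM('a) * \<bar>gauss (c *\<^sub>R z - \<xi>) (T n) - gauss (c *\<^sub>R z) (1 + T n)\<bar> = norm (f n z - 0)" for z
    proof -
      have 1: "c *\<^sub>R z - \<xi> = c *\<^sub>R (z - (1 / sqrt (T n)) *\<^sub>R \<xi>)"
        using c(1) by (simp add: scaleR_diff_right c_def[symmetric])
      have 2: "c ^ DIM('a) * gauss (c *\<^sub>R z - \<xi>) (T n) = gauss (z - (1 / sqrt (T n)) *\<^sub>R \<xi>) 1"
        using gauss_dilate[OF c(1), of 1 "z - (1 / sqrt (T n)) *\<^sub>R \<xi>"] unfolding 1 c(2) by simp
      have 3: "1 + T n = c\<^sup>2 * (1 + 1 / T n)" using c T1[of n] by (simp add: distrib_left)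
      have 4: "c ^ DIM('a) * gauss (c *\<^sub>R z) (1 + T n) = gauss z (1 + 1 / T n)"
        unfolding 3 by (rule gauss_dilate[OF c(1) pos])
      have "c ^ DIM('a) * \<bar>gauss (c *\<^sub>R z - \<xi>) (T n) - gauss (c *\<^sub>R z) (1 + T n)\<bar>
         = \<bar>c ^ DIM('a) * gauss (c *\<^sub>R z - \<xi>) (T n) - c ^ DIM('a) * gauss (c *\<^sub>R z) (1 + T n)\<bar>"
        using c(1) by (simp add: abs_mult flip: right_diff_distrib)
      then show ?thesis unfolding 2 4 f_def by simp
    qed
    then show ?thesis unfolding gauss_gap_def
      by (subst lborel_integral_dilate[OF _ c(1)]) simp_all
  qed
  ultimately have "(\<lambda>n. gauss_gap \<xi> (T n)) \<longlonglongrightarrow> 0" by simp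
  moreover have "\<forall>\<^sub>F n in sequentially. gauss_gap \<xi> (T n) = gauss_gap \<xi> (X n)"
    using filterlim_at_top_dense[THEN iffD1, OF X, rule_format, of 1]
    by eventually_elim (simp add: T_def)
  ultimately show "(\<lambda>n. gauss_gap \<xi> (X n)) \<longlonglongrightarrow> 0" by (rule Lim_transform_eventually)
qed

lemma gauss_gap_bounds:
  fixes \<xi> :: "'a::euclidean_space"
  assumes "t > 0"
  shows "0 \<le> gauss_gap \<xi> t" "gauss_gap \<xi> t \<le> 2"
proof -
  have i: "integrable lborel (\<lambda>y. gauss (y - \<xi>) t)" "integrable lborel (\<lambda>y::'a. gauss y (1 + t))"
    using integrable_gauss[of t \<xi>] integrable_gauss[of "1 + t" "0::'a"] assms by auto
  show "0 \<le> gauss_gap \<xi> t" unfolding gauss_gap_def by (intro integral_nonneg_AE) auto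
  have "gauss_gap \<xi> t \<le> (\<integral>y. gauss (y - \<xi>) t + gauss y (1 + t) \<partial>lborel)"
    unfolding gauss_gap_def using i
    by (intro integral_mono) (auto intro!: order_trans[OF abs_triangle_ineq4])
  also have "\<dots> = 2"
    using i integral_gauss[of t \<xi>] integral_gauss[of "1 + t" "0::'a"] assms by simp
  finally show "gauss_gap \<xi> t \<le> 2" .
qed

lemma borel_measurable_gauss_gap [measurable]: "(\<lambda>\<xi>::'a::euclidean_space. gauss_gap \<xi> t) \<in> borel_measurable borel"
  unfolding gauss_gap_def by measurable

text \<open>Half of the time is spent on smoothing: both kernels are evolved by G(t/2) from their
  values at the halved time, and G(t/2) maps L^1 to sup norm with constant at most t^(-N/2).\<close>

lemma gauss_diff_sup_bound:
  fixes x \<xi> :: "'a::euclidean_space"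
  assumes t: "t > 0"
  shows "\<bar>gauss (x - \<xi>) t - gauss x (1 + t)\<bar> \<le> t powr (- real DIM('a) / 2) * gauss_gap \<xi> (t / 2)"
proof -
  define h where "h = t / 2"
  \<comment> \<open>The delay by 1 stays with the second kernel: 1 + t = h + (1 + h).\<close>
  have h: "h > 0" "h + h = t" "h + (1 + h) = 1 + t" using t by (auto simp: h_def)
  have hb: "has_bochner_integral lborel (\<lambda>y. gauss (x - y) h * gauss (y - z) b) (gauss (x - z) (h + b))"
    if "b > 0" for z b
    using that h by (intro has_bochner_integral_nn_integral) (auto simp: gauss_semigroup)
  have 1: "has_bochner_integral lborel (\<lambda>y. gauss (x - y) h * gauss (y - \<xi>) h) (gauss (x - \<xi>) t)"
    using hb[of h \<xi>] h by simp
  have 2: "has_bochner_integral lborel (\<lambda>y. gauss (x - y) h * gauss y (1 + h)) (gauss x (1 + t))"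
    using hb[of "1 + h" 0] h by simp
  have D: "has_bochner_integral lborel (\<lambda>y. gauss (x - y) h * (gauss (y - \<xi>) h - gauss y (1 + h))) (gauss (x - \<xi>) t - gauss x (1 + t))"
    using has_bochner_integral_diff[OF 1 2] by (simp add: right_diff_distrib)
  have i: "integrable lborel (\<lambda>y. gauss (y - \<xi>) h)" "integrable lborel (\<lambda>y::'a. gauss y (1 + h))"
    using integrable_gauss[of h \<xi>] integrable_gauss[of "1 + h" "0::'a"] h by auto
  have gl: "gauss (x - y) h \<le> t powr (- real DIM('a) / 2)" for y
  proof -
    have "gauss (x - y) h \<le> (4 * pi * h) powr (- real DIM('a) / 2)" using h by (intro gauss_le)
    also have "\<dots> \<le> t powr (- real DIM('a) / 2)"
      using t pi_gt3 by (intro powr_mono2') (auto simp: h_def)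
    finally show ?thesis .
  qed
  have "\<bar>gauss (x - \<xi>) t - gauss x (1 + t)\<bar> = \<bar>\<integral>y. gauss (x - y) h * (gauss (y - \<xi>) h - gauss y (1 + h)) \<partial>lborel\<bar>"
    using has_bochner_integral_integral_eq[OF D] by simp
  also have "\<dots> \<le> (\<integral>y. \<bar>gauss (x - y) h * (gauss (y - \<xi>) h - gauss y (1 + h))\<bar> \<partial>lborel)"
    by (rule integral_abs_bound)
  also have "\<dots> \<le> (\<integral>y. t powr (- real DIM('a) / 2) * \<bar>gauss (y - \<xi>) h - gauss y (1 + h)\<bar> \<partial>lborel)"
    using D i gl by (intro integral_mono integrable_abs) (auto simp: abs_mult intro!: mult_right_mono dest: has_bochner_integral_iff[THEN iffD1])
  also have "\<dots> = t powr (- real DIM('a) / 2) * gauss_gap \<xi> h" by (simp add: gauss_gap_def)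
  finally show ?thesis by (simp add: h_def)
qed

text \<open>Integrating the point-mass error against |\<phi>| and using dominated convergence with
  majorant 2 |\<phi>|. One function \<open>m\<close> bounds both the rescaled sup norm and the L^1
  norm, as \<open>Lq_norm_interpolation\<close> requires.\<close>

lemma heat_asymptotics:
  fixes \<phi> :: "'a::euclidean_space \<Rightarrow> real"
  assumes \<phi>: "integrable lborel \<phi>"
  obtains m :: "real \<Rightarrow> real" where "(m \<longlongrightarrow> 0) at_top" "\<And>t. t > 0 \<Longrightarrow> m t > 0"
    "\<And>t x. t > 0 \<Longrightarrow> \<bar>heat t \<phi> x - (\<integral>y. \<phi> y \<partial>lborel) * gauss1 x t\<bar> \<le> t powr (- real DIM('a) / 2) * m t"
    "\<And>t. t > 0 \<Longrightarrow> (\<integral>\<^sup>+x. ennreal \<bar>heat t \<phi> x - (\<integral>y. \<phi> y \<partial>lborel) * gauss1 x t\<bar> \<partial>lborel) \<le> ennreal (m t)"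
proof -
  have [measurable]: "\<phi> \<in> borel_measurable borel" using \<phi> by auto
  define \<Delta> where "\<Delta> t = (\<integral>\<xi>. \<bar>\<phi> \<xi>\<bar> * gauss_gap \<xi> t \<partial>lborel)" for t
  have Di: "integrable lborel (\<lambda>\<xi>. \<bar>\<phi> \<xi>\<bar> * gauss_gap \<xi> t)" if "t > 0" for t
    by (rule Bochner_Integration.integrable_bound[where f = "\<lambda>\<xi>. \<bar>\<phi> \<xi>\<bar> * 2"])
       (use \<phi> gauss_gap_bounds[OF that, where 'a = 'a] in \<open>auto simp: abs_mult intro!: mult_left_mono\<close>)
  have D0: "\<Delta> t \<ge> 0" if "t > 0" for t
    unfolding \<Delta>_def using gauss_gap_bounds[OF that, where 'a = 'a] by (intro integral_nonneg_AE) auto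
  have Dlim: "(\<Delta> \<longlongrightarrow> 0) at_top"
  proof -
    have "((\<lambda>t. \<integral>\<xi>. \<bar>\<phi> \<xi>\<bar> * gauss_gap \<xi> t \<partial>lborel) \<longlongrightarrow> (\<integral>\<xi>. 0 \<partial>(lborel :: 'a measure))) at_top"
    proof (rule integral_dominated_convergence_at_top[where w = "\<lambda>\<xi>. \<bar>\<phi> \<xi>\<bar> * 2"])
      show "\<forall>\<^sub>F t in at_top. AE \<xi> in lborel. norm (\<bar>\<phi> \<xi>\<bar> * gauss_gap \<xi> t) \<le> \<bar>\<phi> \<xi>\<bar> * 2"
        using eventually_gt_at_top[of 0]
        by eventually_elim
           (use gauss_gap_bounds[where 'a = 'a] in \<open>auto simp: abs_mult intro!: mult_left_mono\<close>)
      show "AE \<xi> in lborel. ((\<lambda>t. \<bar>\<phi> \<xi>\<bar> * gauss_gap \<xi> t) \<longlongrightarrow> 0) at_top"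
        using tendsto_mult_right_zero[OF gauss_gap_tendsto_0[where 'a = 'a]] by auto
    qed (use \<phi> in auto)
    then show ?thesis by (simp add: \<Delta>_def[abs_def])
  qed
  have rep: "heat t \<phi> x - (\<integral>y. \<phi> y \<partial>lborel) * gauss1 x t = (\<integral>\<xi>. (gauss (x - \<xi>) t - gauss x (1 + t)) * \<phi> \<xi> \<partial>lborel)"
    and repi: "integrable lborel (\<lambda>\<xi>. (gauss (x - \<xi>) t - gauss x (1 + t)) * \<phi> \<xi>)" if "t > 0" for t x
    using integrable_gauss_mult[OF \<phi> that, of x] \<phi>
    by (simp_all add: left_diff_distrib heat_def gauss1_def mult.commute[of "integral\<^sup>L lborel \<phi>"])
  show thesis
  proof (rule that)
    \<comment> \<open>\<Delta> t is for the L^1 bound and \<Delta> (t / 2) for the sup bound; 1/t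
      only makes \<open>m\<close> strictly positive, which the interpolation lemma asks for.\<close>
    define m where "m t = \<Delta> t + \<Delta> (t / 2) + 1 / t" for t
    have "((\<lambda>t. \<Delta> (t / 2)) \<longlongrightarrow> 0) at_top"
      by (rule filterlim_compose[OF Dlim]) (use filterlim_tendsto_pos_mult_at_top[OF tendsto_const[of "1 / 2 :: real"] _ filterlim_ident] in simp)
    moreover have "((\<lambda>t::real. 1 / t) \<longlongrightarrow> 0) at_top"
      by (intro tendsto_divide_0[OF tendsto_const] filterlim_at_top_imp_at_infinity filterlim_ident)
    ultimately have "((\<lambda>t. \<Delta> t + \<Delta> (t / 2) + 1 / t) \<longlongrightarrow> 0 + 0 + 0) at_top"
      by (intro tendsto_add Dlim)
    then show "(m \<longlongrightarrow> 0) at_top" by (simp add: m_def[abs_def])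
    fix t :: real assume t: "t > 0"
    show "m t > 0" using D0[OF t] D0[of "t / 2"] t by (simp add: m_def add_nonneg_pos)
    show "\<bar>heat t \<phi> x - (\<integral>y. \<phi> y \<partial>lborel) * gauss1 x t\<bar> \<le> t powr (- real DIM('a) / 2) * m t" for x
    proof -
      have "\<bar>heat t \<phi> x - (\<integral>y. \<phi> y \<partial>lborel) * gauss1 x t\<bar> \<le> (\<integral>\<xi>. \<bar>(gauss (x - \<xi>) t - gauss x (1 + t)) * \<phi> \<xi>\<bar> \<partial>lborel)"
        unfolding rep[OF t] by (rule integral_abs_bound)
      also have "\<dots> \<le> (\<integral>\<xi>. t powr (- real DIM('a) / 2) * (\<bar>\<phi> \<xi>\<bar> * gauss_gap \<xi> (t / 2)) \<partial>lborel)"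
      proof (rule integral_mono)
        fix \<xi>
        show "\<bar>(gauss (x - \<xi>) t - gauss x (1 + t)) * \<phi> \<xi>\<bar> \<le> t powr (- real DIM('a) / 2) * (\<bar>\<phi> \<xi>\<bar> * gauss_gap \<xi> (t / 2))"
          using mult_right_mono[OF gauss_diff_sup_bound[OF t, of x \<xi>], of "\<bar>\<phi> \<xi>\<bar>"] by (simp add: abs_mult mult_ac)
      qed (use repi[OF t, of x] Di[of "t / 2"] t in auto)
      also have "\<dots> = t powr (- real DIM('a) / 2) * \<Delta> (t / 2)" by (simp add: \<Delta>_def)
      also have "\<dots> \<le> t powr (- real DIM('a) / 2) * m t"
        using D0[OF t] t by (intro mult_left_mono) (auto simp: m_def)
      finally show ?thesis .
    qed
    have "(\<integral>\<^sup>+x. ennreal \<bar>heat t \<phi> x - (\<integral>y. \<phi> y \<partial>lborel) * gauss1 x t\<bar> \<partial>lborel)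
       \<le> (\<integral>\<^sup>+x. \<integral>\<^sup>+\<xi>. ennreal (\<bar>gauss (x - \<xi>) t - gauss x (1 + t)\<bar> * \<bar>\<phi> \<xi>\<bar>) \<partial>lborel \<partial>lborel)"
    proof (rule nn_integral_mono)
      fix x
      have "ennreal \<bar>heat t \<phi> x - (\<integral>y. \<phi> y \<partial>lborel) * gauss1 x t\<bar> \<le> ennreal (\<integral>\<xi>. \<bar>(gauss (x - \<xi>) t - gauss x (1 + t)) * \<phi> \<xi>\<bar> \<partial>lborel)"
        unfolding rep[OF t] by (intro ennreal_leI integral_abs_bound)
      also have "\<dots> = (\<integral>\<^sup>+\<xi>. ennreal (\<bar>gauss (x - \<xi>) t - gauss x (1 + t)\<bar> * \<bar>\<phi> \<xi>\<bar>) \<partial>lborel)"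
        using integrable_abs[OF repi[OF t, of x]] by (subst nn_integral_eq_integral[symmetric]) (auto simp: abs_mult)
      finally show "ennreal \<bar>heat t \<phi> x - (\<integral>y. \<phi> y \<partial>lborel) * gauss1 x t\<bar>
          \<le> (\<integral>\<^sup>+\<xi>. ennreal (\<bar>gauss (x - \<xi>) t - gauss x (1 + t)\<bar> * \<bar>\<phi> \<xi>\<bar>) \<partial>lborel)" .
    qed
    also have "\<dots> = (\<integral>\<^sup>+\<xi>. \<integral>\<^sup>+x. ennreal (\<bar>gauss (x - \<xi>) t - gauss x (1 + t)\<bar> * \<bar>\<phi> \<xi>\<bar>) \<partial>lborel \<partial>lborel)"
      by (rule lborel_pair.Fubini') measurable
    also have "\<dots> = (\<integral>\<^sup>+\<xi>. ennreal (\<bar>\<phi> \<xi>\<bar> * gauss_gap \<xi> t) \<partial>lborel)"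
    proof (rule nn_integral_cong)
      fix \<xi> :: 'a
      have i: "integrable lborel (\<lambda>y. gauss (y - \<xi>) t)" "integrable lborel (\<lambda>y::'a. gauss y (1 + t))"
        using integrable_gauss[of t \<xi>] integrable_gauss[of "1 + t" "0::'a"] t by auto
      show "(\<integral>\<^sup>+x. ennreal (\<bar>gauss (x - \<xi>) t - gauss x (1 + t)\<bar> * \<bar>\<phi> \<xi>\<bar>) \<partial>lborel) = ennreal (\<bar>\<phi> \<xi>\<bar> * gauss_gap \<xi> t)"
        using i by (subst nn_integral_eq_integral) (auto simp: gauss_gap_def mult.commute)
    qed
    also have "\<dots> = ennreal (\<Delta> t)"
      unfolding \<Delta>_def using Di[OF t] gauss_gap_bounds[OF t, where 'a = 'a] by (intro nn_integral_eq_integral) auto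
    also have "\<dots> \<le> ennreal (m t)" using D0[of "t / 2"] t by (intro ennreal_leI) (simp add: m_def)
    finally show "(\<integral>\<^sup>+x. ennreal \<bar>heat t \<phi> x - (\<integral>y. \<phi> y \<partial>lborel) * gauss1 x t\<bar> \<partial>lborel) \<le> ennreal (m t)" .
  qed
qed

section \<open>The Duhamel operator\<close>

lemma borel_measurable_fst_snd [measurable (raw)]:
  fixes f :: "'b \<Rightarrow> 'a::euclidean_space \<times> real"
  assumes "f \<in> borel_measurable M"
  shows "(\<lambda>w. fst (f w)) \<in> borel_measurable M" "(\<lambda>w. snd (f w)) \<in> borel_measurable M"
  using assms by (auto intro!: measurable_compose[OF assms] borel_measurable_continuous_onI continuous_intros)

text \<open>Extended by zero to all of space-time, z = (y, s), so that a Duhamel term is one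
  integral over a fixed measure space and the base point and the delay \<eta> enter only through the
  integrand. \<eta> = 0 is the genuine kernel.\<close>

definition dkernel :: "real \<Rightarrow> 'a::euclidean_space \<Rightarrow> real \<Rightarrow> 'a \<times> real \<Rightarrow> 'a" where
  "dkernel \<eta> x t z = (if 0 < snd z \<and> snd z < t - \<eta> then ggrad (x - fst z) (t - snd z) else 0)"

definition duhamel :: "real \<Rightarrow> ('a::euclidean_space \<times> real \<Rightarrow> 'a) \<Rightarrow> 'a \<Rightarrow> real \<Rightarrow> real" where
  "duhamel \<eta> f x t = (\<integral>z. dkernel \<eta> x t z \<bullet> f z \<partial>lborel)"

lemma borel_measurable_dkernel [measurable (raw)]:
  fixes f :: "'b \<Rightarrow> 'a::euclidean_space"
  assumes [measurable]: "f \<in> borel_measurable M" "g \<in> borel_measurable M" "h \<in> borel_measurable M"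
  shows "(\<lambda>w. dkernel \<eta> (f w) (g w) (h w)) \<in> borel_measurable M"
  unfolding dkernel_def by measurable

lemma borel_measurable_duhamel [measurable (raw)]:
  fixes f :: "'b \<Rightarrow> 'a::euclidean_space"
  assumes [measurable]: "F \<in> borel_measurable borel" "f \<in> borel_measurable M" "g \<in> borel_measurable M"
  shows "(\<lambda>w. duhamel \<eta> F (f w) (g w)) \<in> borel_measurable M"
  unfolding duhamel_def by measurable

text \<open>The hyperplane s = t is where the cutoff jumps and pointwise convergence of kernels may
  fail; it is a null set.\<close>

lemma AE_snd_neq: "AE z in (lborel :: ('a::euclidean_space \<times> real) measure). snd z \<noteq> t"
  unfolding lborel_prod[symmetric]
proof (rule lborel_pair.AE_pair_measure)
  show "{z \<in> space (lborel \<Otimes>\<^sub>M lborel). snd z \<noteq> t} \<in> sets (lborel \<Otimes>\<^sub>M (lborel :: real measure))"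
    by measurable
qed (auto intro!: AE_I2 AE_lborel_singleton)

section \<open>Space-time kernel estimates relative to the majorant\<close>

locale heat_majorant =
  fixes \<psi> :: "'a::euclidean_space \<Rightarrow> real"
  assumes integrable_psi: "integrable lborel \<psi>" and psi_nonneg: "\<And>x. 0 \<le> \<psi> x"
begin

definition V :: "'a \<Rightarrow> real \<Rightarrow> real" where
  "V x t = heat (2 * t) \<psi> x"

definition c0 :: real where
  "c0 = 2 powr (real DIM('a) / 2)"

lemma c0_pos: "c0 > 0"
  by (simp add: c0_def)

lemma borel_measurable_psi [measurable]: "\<psi> \<in> borel_measurable borel"
  using integrable_psi by auto

lemma borel_measurable_V [measurable (raw)]:
  assumes [measurable]: "f \<in> borel_measurable M" "g \<in> borel_measurable M"
  shows "(\<lambda>w. V (f w) (g w)) \<in> borel_measurable M"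
  unfolding V_def by measurable

lemma V_nonneg [simp]: "0 \<le> V x t"
  by (simp add: V_def heat_nonneg psi_nonneg)

lemma tendsto_V: "X \<longlonglongrightarrow> x \<Longrightarrow> T \<longlonglongrightarrow> t \<Longrightarrow> t > 0 \<Longrightarrow> (\<lambda>n. V (X n) (T n)) \<longlonglongrightarrow> V x t"
  unfolding V_def by (intro tendsto_heat integrable_psi tendsto_intros) auto

text \<open>Since \<open>\<bar>\<nabla>G(t - s)\<bar>\<close> is dominated by \<open>G(2(t - s))\<close> and \<open>V(s) = G(2s) * \<psi>\<close>, the semigroup property
  reproduces the profile \<open>V\<close> exactly: space integrals are eliminated and only a scalar Volterra kernel is left.\<close>
lemma nn_integral_majorant:
  assumes t: "t > 0" and [measurable]: "b \<in> borel_measurable borel" and b: "\<And>s. 0 \<le> b s"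
  shows "(\<integral>\<^sup>+z. ennreal (of_bool (0 < snd z \<and> snd z < t) * ((t - snd z) powr (- 1 / 2) * b (snd z))
            * (gauss (x - fst z) (2 * (t - snd z)) * V (fst z) (snd z))) \<partial>lborel)
    = ennreal (V x t) * (\<integral>\<^sup>+s\<in>{0<..<t}. ennreal ((t - s) powr (- 1 / 2) * b s) \<partial>lborel)"
proof -
  let ?f = "\<lambda>y s. ennreal (of_bool (0 < s \<and> s < t) * ((t - s) powr (- 1 / 2) * b s)
            * (gauss (x - y) (2 * (t - s)) * V y s))"
  have "(\<integral>\<^sup>+z. ?f (fst z) (snd z) \<partial>lborel) = (\<integral>\<^sup>+s. (\<integral>\<^sup>+y. ?f y s \<partial>lborel) \<partial>lborel)"
    by (subst lborel_prod[symmetric], subst lborel_pair.nn_integral_snd[symmetric]) simp_all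
  also have "\<dots> = (\<integral>\<^sup>+s. ennreal (V x t) * (ennreal ((t - s) powr (- 1 / 2) * b s) * indicator {0<..<t} s) \<partial>lborel)"
  proof (rule nn_integral_cong)
    fix s
    show "(\<integral>\<^sup>+y. ?f y s \<partial>lborel) = ennreal (V x t) * (ennreal ((t - s) powr (- 1 / 2) * b s) * indicator {0<..<t} s)"
    proof (cases "s \<in> {0<..<t}")
      case True
      then have "(\<integral>\<^sup>+y. ?f y s \<partial>lborel) = (\<integral>\<^sup>+y. ennreal ((t - s) powr (- 1 / 2) * b s) * ennreal (gauss (x - y) (2 * (t - s)) * V y s) \<partial>lborel)"
        using b by (intro nn_integral_cong) (simp flip: ennreal_mult)
      also have "\<dots> = ennreal ((t - s) powr (- 1 / 2) * b s) * (\<integral>\<^sup>+y. ennreal (gauss (x - y) (2 * (t - s)) * V y s) \<partial>lborel)"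
        by (rule nn_integral_cmult) simp
      also have "(\<integral>\<^sup>+y. ennreal (gauss (x - y) (2 * (t - s)) * V y s) \<partial>lborel) = ennreal (V x t)"
        using True heat_semigroup[OF integrable_psi psi_nonneg, of "2 * (t - s)" "2 * s" x] by (simp add: V_def algebra_simps)
      finally show ?thesis using True by (simp add: mult.commute)
    next
      case False
      then have "(\<integral>\<^sup>+y. ?f y s \<partial>lborel) = (\<integral>\<^sup>+y. 0 \<partial>(lborel :: 'a measure))"
        by (intro nn_integral_cong) auto
      then show ?thesis using False by simp
    qed
  qed
  also have "\<dots> = ennreal (V x t) * (\<integral>\<^sup>+s\<in>{0<..<t}. ennreal ((t - s) powr (- 1 / 2) * b s) \<partial>lborel)"
    by (rule nn_integral_cmult) simp
  finally show ?thesis .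
qed

lemma norm_dkernel_le:
  assumes "\<eta> \<ge> 0"
  shows "norm (dkernel \<eta> (x::'a) t z) \<le> of_bool (0 < snd z \<and> snd z < t) * (t - snd z) powr (- 1 / 2) * (c0 * gauss (x - fst z) (2 * (t - snd z)))"
  using assms norm_ggrad_le[of "t - snd z" "x - fst z"] by (auto simp: dkernel_def c0_def mult_ac)

lemma dkernel_tendsto:
  assumes "H \<longlonglongrightarrow> 0" "X \<longlonglongrightarrow> x" "T \<longlonglongrightarrow> t" "snd z \<noteq> t"
  shows "(\<lambda>n. dkernel (H n) (X n) (T n) z) \<longlonglongrightarrow> dkernel 0 x t z"
proof -
  have l: "(\<lambda>n. T n - H n) \<longlonglongrightarrow> t" using tendsto_diff[OF assms(3,1)] by simp
  consider "snd z \<le> 0" | "0 < snd z" "snd z < t" | "snd z > t" using assms(4) by linarith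
  then show ?thesis
  proof cases
    case 2
    have "(\<lambda>n. ggrad (X n - fst z) (T n - snd z)) \<longlonglongrightarrow> dkernel 0 x t z"
      using 2 assms by (simp add: dkernel_def) (intro tendsto_ggrad tendsto_intros, auto)
    moreover have "\<forall>\<^sub>F n in sequentially. ggrad (X n - fst z) (T n - snd z) = dkernel (H n) (X n) (T n) z"
      using order_tendstoD(1)[OF l 2(2)] by eventually_elim (use 2 in \<open>simp add: dkernel_def\<close>)
    ultimately show ?thesis by (rule Lim_transform_eventually)
  next
    case 3
    have "\<forall>\<^sub>F n in sequentially. 0 = dkernel (H n) (X n) (T n) z"
      using order_tendstoD(2)[OF l 3] by eventually_elim (simp add: dkernel_def)
    moreover have "dkernel 0 x t z = 0" using 3 by (simp add: dkernel_def)
    ultimately show ?thesis using Lim_transform_eventually[OF tendsto_const, of 0 "\<lambda>n. dkernel (H n) (X n) (T n) z"] by simp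
  qed (simp add: dkernel_def)
qed

text \<open>The dominating functions move with the base point, but their integrals converge.\<close>
lemma dkernel_L1_tendsto:
  assumes H: "\<And>n. H n \<ge> 0" "H \<longlonglongrightarrow> 0" and X: "X \<longlonglongrightarrow> x" and T: "\<And>n. T n > 0" "T \<longlonglongrightarrow> t" and t: "t > 0"
  shows "integrable lborel (\<lambda>z. V (fst z) (snd z) *\<^sub>R dkernel 0 x t z)"
    "\<And>n. integrable lborel (\<lambda>z. V (fst z) (snd z) *\<^sub>R dkernel (H n) (X n) (T n) z)"
    "(\<lambda>n. \<integral>z. norm (V (fst z) (snd z) *\<^sub>R dkernel (H n) (X n) (T n) z - V (fst z) (snd z) *\<^sub>R dkernel 0 x t z) \<partial>lborel) \<longlonglongrightarrow> 0"
proof -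
  define g where "g x t z = of_bool (0 < snd z \<and> snd z < t) * ((t - snd z) powr (- 1 / 2) * c0)
            * (gauss (x - fst z) (2 * (t - snd z)) * V (fst z) (snd z))" for x t z
  have gm [measurable]: "g x t \<in> borel_measurable borel" for x t
    unfolding g_def by measurable
  have g0: "0 \<le> g x t z" for x t z using c0_pos by (simp add: g_def)
  \<comment> \<open>The mass of the moving majorant is explicit and visibly continuous in (x, t),
    although its singularity moves; 2 sqrt t is the integral of (t - s)^(-1/2).\<close>
  have gi: "(\<integral>\<^sup>+z. ennreal (g x t z) \<partial>lborel) = ennreal (V x t * (c0 * (2 * sqrt t)))" if "t > 0" for x t
  proof -
    have "(\<integral>\<^sup>+z. ennreal (g x t z) \<partial>lborel) = ennreal (V x t) * (\<integral>\<^sup>+s\<in>{0<..<t}. ennreal ((t - s) powr (- 1 / 2) * c0) \<partial>lborel)"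
      unfolding g_def using nn_integral_majorant[OF that, of "\<lambda>_. c0" x] c0_pos by simp
    also have "(\<integral>\<^sup>+s\<in>{0<..<t}. ennreal ((t - s) powr (- 1 / 2) * c0) \<partial>lborel)
       = (\<integral>\<^sup>+s. ennreal c0 * (ennreal ((t - s) powr (- 1 / 2)) * indicator {0<..<t} s) \<partial>lborel)"
      using c0_pos by (intro nn_integral_cong) (simp add: ennreal_mult mult_ac)
    also have "\<dots> = ennreal c0 * ennreal (2 * sqrt t)"
      using nn_integral_powr_Ioo_reflect[of "1/2" t] that
      by (subst nn_integral_cmult) (auto simp: powr_half_sqrt mult.commute)
    finally show ?thesis using c0_pos that by (simp flip: ennreal_mult)
  qed
  have bound: "norm (V (fst z) (snd z) *\<^sub>R dkernel \<eta> x t z) \<le> g x t z" if "\<eta> \<ge> 0" for \<eta> x t z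
    using mult_left_mono[OF norm_dkernel_le[OF that, of x t z] V_nonneg[of "fst z" "snd z"]]
    by (simp add: g_def mult_ac)
  have glim: "(\<lambda>n. g (X n) (T n) z) \<longlonglongrightarrow> g x t z" if z: "snd z \<noteq> t" for z
  proof -
    consider "snd z \<le> 0" | "0 < snd z" "snd z < t" | "snd z > t" using z by linarith
    then show ?thesis
    proof cases
      case 2
      have "(\<lambda>n. (T n - snd z) powr (- 1 / 2) * c0 * (gauss (X n - fst z) (2 * (T n - snd z)) * V (fst z) (snd z))) \<longlonglongrightarrow> g x t z"
        using 2 X T unfolding g_def by simp (intro tendsto_gauss tendsto_intros, auto)
      moreover have "\<forall>\<^sub>F n in sequentially. (T n - snd z) powr (- 1 / 2) * c0 * (gauss (X n - fst z) (2 * (T n - snd z)) * V (fst z) (snd z)) = g (X n) (T n) z"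
        using order_tendstoD(1)[OF T(2) 2(2)] by eventually_elim (use 2 in \<open>simp add: g_def\<close>)
      ultimately show ?thesis by (rule Lim_transform_eventually)
    next
      case 3
      have "\<forall>\<^sub>F n in sequentially. 0 = g (X n) (T n) z"
        using order_tendstoD(2)[OF T(2) 3] by eventually_elim (simp add: g_def)
      moreover have "g x t z = 0" using 3 by (simp add: g_def)
      ultimately show ?thesis using Lim_transform_eventually[OF tendsto_const, of 0 "\<lambda>n. g (X n) (T n) z"] by simp
    qed (simp add: g_def)
  qed
  have cl: "(\<lambda>n. V (X n) (T n) * (c0 * (2 * sqrt (T n)))) \<longlonglongrightarrow> V x t * (c0 * (2 * sqrt t))"
    by (intro tendsto_intros tendsto_V X T t)
  note P = generalised_dominated_convergence[where M = lborel and f = "\<lambda>n z. V (fst z) (snd z) *\<^sub>R dkernel (H n) (X n) (T n) z"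
      and ?f0.0 = "\<lambda>z. V (fst z) (snd z) *\<^sub>R dkernel 0 x t z" and g = "\<lambda>n. g (X n) (T n)" and ?g0.0 = "g x t",
      OF _ _ _ _ _ _ _ _ _ gi gi cl]
  have fl: "AE z in lborel. (\<lambda>n. V (fst z) (snd z) *\<^sub>R dkernel (H n) (X n) (T n) z) \<longlonglongrightarrow> V (fst z) (snd z) *\<^sub>R dkernel 0 x t z"
    using AE_snd_neq[of t] by eventually_elim (intro tendsto_intros dkernel_tendsto H X T, auto)
  have gl: "AE z in lborel. (\<lambda>n. g (X n) (T n) z) \<longlonglongrightarrow> g x t z"
    using AE_snd_neq[of t] by eventually_elim (rule glim)
  show "integrable lborel (\<lambda>z. V (fst z) (snd z) *\<^sub>R dkernel 0 x t z)"
    by (rule P(1)) (use fl gl bound H g0 T t in auto)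
  show "integrable lborel (\<lambda>z. V (fst z) (snd z) *\<^sub>R dkernel (H n) (X n) (T n) z)" for n
    by (rule P(2)) (use fl gl bound H g0 T t in auto)
  show "(\<lambda>n. \<integral>z. norm (V (fst z) (snd z) *\<^sub>R dkernel (H n) (X n) (T n) z - V (fst z) (snd z) *\<^sub>R dkernel 0 x t z) \<partial>lborel) \<longlonglongrightarrow> 0"
    by (rule P(3)) (use fl gl bound H g0 T t in auto)
qed

lemma integrable_dkernel:
  assumes "t > 0" "\<eta> \<ge> 0"
  shows "integrable lborel (\<lambda>z. V (fst z) (snd z) *\<^sub>R dkernel \<eta> x t z)"
proof -
  have "integrable lborel (\<lambda>z. V (fst z) (snd z) *\<^sub>R dkernel 0 x t z)"
    by (rule dkernel_L1_tendsto(1)[of "\<lambda>_. 0" "\<lambda>_. x" x "\<lambda>_. t" t]) (use assms in auto)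
  then show ?thesis
    by (rule Bochner_Integration.integrable_bound) (measurable, use assms in \<open>auto simp: dkernel_def\<close>)
qed

text \<open>A modulus of continuity shared by all Duhamel terms whose source is bounded by a
  constant times V. It compares a delayed term at (x', t') with the undelayed one at (x, t), so it
  also measures the effect of the delay.\<close>

definition \<omega> :: "real \<Rightarrow> 'a \<Rightarrow> real \<Rightarrow> 'a \<Rightarrow> real \<Rightarrow> real" where
  "\<omega> \<eta> x' t' x t = (\<integral>z. norm (V (fst z) (snd z) *\<^sub>R dkernel \<eta> x' t' z - V (fst z) (snd z) *\<^sub>R dkernel 0 x t z) \<partial>lborel)"

text \<open>By contradiction: if no d worked, parameters within 1/(n + 1) of (0, x, t) would form
  sequences along which \<omega> stays at least e, against
  \<open>dkernel_L1_tendsto\<close>.\<close>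

lemma modulus_small:
  assumes t: "t > 0" and e: "e > 0"
  obtains d where "d > 0" "\<And>\<eta> x' t'. 0 \<le> \<eta> \<Longrightarrow> \<eta> < d \<Longrightarrow> dist x' x < d \<Longrightarrow> dist t' t < d \<Longrightarrow> t' > 0 \<Longrightarrow> \<omega> \<eta> x' t' x t < e"
proof (rule ccontr)
  assume "\<not> thesis"
  then have "\<forall>n::nat. \<exists>\<eta> x' t'. 0 \<le> \<eta> \<and> \<eta> < inverse (real (Suc n)) \<and> dist x' x < inverse (real (Suc n))
      \<and> dist t' t < inverse (real (Suc n)) \<and> t' > 0 \<and> \<not> \<omega> \<eta> x' t' x t < e"
    using that by (metis inverse_positive_iff_positive of_nat_0_less_iff zero_less_Suc)
  then obtain H X T where HXT: "\<And>n. 0 \<le> H n" "\<And>n. H n < inverse (real (Suc n))" "\<And>n. dist (X n) x < inverse (real (Suc n))"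
      "\<And>n. dist (T n) t < inverse (real (Suc n))" "\<And>n. T n > 0" "\<And>n. \<not> \<omega> (H n) (X n) (T n) x t < e"
    by metis
  have i0: "(\<lambda>n. inverse (real (Suc n))) \<longlonglongrightarrow> 0" by (rule LIMSEQ_inverse_real_of_nat)
  have "H \<longlonglongrightarrow> 0"
    by (rule tendsto_sandwich[OF _ _ tendsto_const i0]) (use HXT in \<open>auto intro!: always_eventually less_imp_le\<close>)
  moreover have "X \<longlonglongrightarrow> x"
    unfolding tendsto_dist_iff[of X]
    by (rule tendsto_sandwich[OF _ _ tendsto_const i0]) (use HXT in \<open>auto intro!: always_eventually less_imp_le\<close>)
  moreover have "T \<longlonglongrightarrow> t"
    unfolding tendsto_dist_iff[of T]
    by (rule tendsto_sandwich[OF _ _ tendsto_const i0]) (use HXT in \<open>auto intro!: always_eventually less_imp_le\<close>)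
  ultimately have "(\<lambda>n. \<omega> (H n) (X n) (T n) x t) \<longlonglongrightarrow> 0"
    unfolding \<omega>_def using HXT t by (intro dkernel_L1_tendsto(3))
  from order_tendstoD(2)[OF this e] obtain n where "\<omega> (H n) (X n) (T n) x t < e"
    by (auto simp: eventually_sequentially)
  then show False using HXT(6) by blast
qed

lemma integrable_duhamel:
  assumes [measurable]: "f \<in> borel_measurable borel" and f: "\<And>y s. s > 0 \<Longrightarrow> norm (f (y, s)) \<le> B * V y s"
    and t: "t > 0" and \<eta>: "\<eta> \<ge> 0"
  shows "integrable lborel (\<lambda>z. dkernel \<eta> x t z \<bullet> f z)"
proof (rule Bochner_Integration.integrable_bound)
  show "integrable lborel (\<lambda>z. B *\<^sub>R (V (fst z) (snd z) *\<^sub>R dkernel \<eta> x t z))"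
    using integrable_dkernel[OF t \<eta>, of x] by (rule integrable_scaleR_right)
  show "AE z in lborel. norm (dkernel \<eta> x t z \<bullet> f z) \<le> norm (B *\<^sub>R (V (fst z) (snd z) *\<^sub>R dkernel \<eta> x t z))"
  proof (rule AE_I2)
    fix z :: "'a \<times> real"
    show "norm (dkernel \<eta> x t z \<bullet> f z) \<le> norm (B *\<^sub>R (V (fst z) (snd z) *\<^sub>R dkernel \<eta> x t z))"
    proof (cases "snd z > 0")
      case True
      have "norm (dkernel \<eta> x t z \<bullet> f z) \<le> norm (dkernel \<eta> x t z) * norm (f z)"
        by (simp add: Cauchy_Schwarz_ineq2)
      also have "\<dots> \<le> norm (dkernel \<eta> x t z) * (\<bar>B\<bar> * V (fst z) (snd z))"
        using f[OF True, of "fst z"] mult_right_mono[OF abs_ge_self[of B] V_nonneg[of "fst z" "snd z"]]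
        by (intro mult_left_mono) auto
      finally show ?thesis by (simp add: mult_ac abs_mult)
    qed (simp add: dkernel_def)
  qed
qed simp

lemma duhamel_diff_le:
  assumes [measurable]: "f \<in> borel_measurable borel" and f: "\<And>y s. s > 0 \<Longrightarrow> norm (f (y, s)) \<le> B * V y s"
    and t: "t > 0" "t' > 0" and \<eta>: "\<eta> \<ge> 0" and B: "B \<ge> 0"
  shows "\<bar>duhamel \<eta> f x' t' - duhamel 0 f x t\<bar> \<le> B * \<omega> \<eta> x' t' x t"
proof -
  have i: "integrable lborel (\<lambda>z. dkernel \<eta> x t z \<bullet> f z)" if "t > 0" "\<eta> \<ge> 0" for \<eta> x t
    by (rule integrable_duhamel[OF assms(1) _ that]) (rule f)
  have "duhamel \<eta> f x' t' - duhamel 0 f x t = (\<integral>z. (dkernel \<eta> x' t' z - dkernel 0 x t z) \<bullet> f z \<partial>lborel)"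
    unfolding duhamel_def using i[OF t(2) \<eta>, of x'] i[OF t(1), of 0 x] by (simp add: inner_diff_left)
  also have "\<bar>\<dots>\<bar> \<le> (\<integral>z. \<bar>(dkernel \<eta> x' t' z - dkernel 0 x t z) \<bullet> f z\<bar> \<partial>lborel)" by (rule integral_abs_bound)
  also have "\<dots> \<le> (\<integral>z. B * norm (V (fst z) (snd z) *\<^sub>R dkernel \<eta> x' t' z - V (fst z) (snd z) *\<^sub>R dkernel 0 x t z) \<partial>lborel)"
  proof (rule integral_mono)
    show "integrable lborel (\<lambda>z. \<bar>(dkernel \<eta> x' t' z - dkernel 0 x t z) \<bullet> f z\<bar>)"
      using i[OF t(2) \<eta>, of x'] i[OF t(1), of 0 x] by (auto simp: inner_diff_left)
    show "integrable lborel (\<lambda>z. B * norm (V (fst z) (snd z) *\<^sub>R dkernel \<eta> x' t' z - V (fst z) (snd z) *\<^sub>R dkernel 0 x t z))"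
      using integrable_dkernel[OF t(2) \<eta>, of x'] integrable_dkernel[OF t(1), of 0 x] by auto
    fix z :: "'a \<times> real"
    show "\<bar>(dkernel \<eta> x' t' z - dkernel 0 x t z) \<bullet> f z\<bar>
        \<le> B * norm (V (fst z) (snd z) *\<^sub>R dkernel \<eta> x' t' z - V (fst z) (snd z) *\<^sub>R dkernel 0 x t z)"
    proof (cases "snd z > 0")
      case True
      have "\<bar>(dkernel \<eta> x' t' z - dkernel 0 x t z) \<bullet> f z\<bar> \<le> norm (dkernel \<eta> x' t' z - dkernel 0 x t z) * norm (f z)"
        by (rule Cauchy_Schwarz_ineq2)
      also have "\<dots> \<le> norm (dkernel \<eta> x' t' z - dkernel 0 x t z) * (B * V (fst z) (snd z))"
        using f[OF True, of "fst z"] by (intro mult_left_mono) auto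
      finally show ?thesis by (simp add: mult_ac flip: scaleR_diff_right)
    qed (simp add: dkernel_def)
  qed
  also have "\<dots> = B * \<omega> \<eta> x' t' x t" by (simp add: \<omega>_def)
  finally show ?thesis .
qed

text \<open>Formulated in ennreal so that the scalar integral on the right can be inserted into the
  supersolution inequality directly.\<close>

lemma duhamel_bound:
  assumes [measurable]: "f \<in> borel_measurable borel" "b \<in> borel_measurable borel"
    and b: "\<And>s. 0 \<le> b s" and f: "\<And>y s. s > 0 \<Longrightarrow> norm (f (y, s)) \<le> b s * V y s"
    and t: "t > 0" and \<eta>: "\<eta> \<ge> 0"
  shows "ennreal \<bar>duhamel \<eta> f x t\<bar>
    \<le> ennreal (V x t) * (ennreal c0 * (\<integral>\<^sup>+s\<in>{0<..<t}. ennreal ((t - s) powr (- 1 / 2) * b s) \<partial>lborel))"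
proof -
  \<comment> \<open>If the integrand is not integrable, the left-hand side is 0 by the convention
    for the Bochner integral.\<close>
  have "ennreal \<bar>duhamel \<eta> f x t\<bar> \<le> (\<integral>\<^sup>+z. ennreal \<bar>dkernel \<eta> x t z \<bullet> f z\<bar> \<partial>lborel)"
    unfolding duhamel_def using integral_norm_bound_ennreal[of lborel "\<lambda>z. dkernel \<eta> x t z \<bullet> f z"]
    by (cases "integrable lborel (\<lambda>z. dkernel \<eta> x t z \<bullet> f z)") (auto simp: not_integrable_integral_eq)
  also have "\<dots> \<le> (\<integral>\<^sup>+z. ennreal c0 * ennreal (of_bool (0 < snd z \<and> snd z < t) * ((t - snd z) powr (- 1 / 2) * b (snd z))
            * (gauss (x - fst z) (2 * (t - snd z)) * V (fst z) (snd z))) \<partial>lborel)"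
  proof (rule nn_integral_mono)
    fix z :: "'a \<times> real"
    have "\<bar>dkernel \<eta> x t z \<bullet> f z\<bar> \<le> c0 * (of_bool (0 < snd z \<and> snd z < t) * ((t - snd z) powr (- 1 / 2) * b (snd z))
            * (gauss (x - fst z) (2 * (t - snd z)) * V (fst z) (snd z)))"
    proof (cases "snd z > 0")
      case True
      have "\<bar>dkernel \<eta> x t z \<bullet> f z\<bar> \<le> norm (dkernel \<eta> x t z) * norm (f z)"
        by (rule Cauchy_Schwarz_ineq2)
      also have "\<dots> \<le> (of_bool (0 < snd z \<and> snd z < t) * (t - snd z) powr (- 1 / 2) * (c0 * gauss (x - fst z) (2 * (t - snd z)))) * (b (snd z) * V (fst z) (snd z))"
        using f[OF True, of "fst z"] norm_dkernel_le[OF \<eta>, of x t z] c0_pos by (intro mult_mono) auto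
      finally show ?thesis by (simp add: mult_ac)
    qed (simp add: dkernel_def)
    then show "ennreal \<bar>dkernel \<eta> x t z \<bullet> f z\<bar> \<le> ennreal c0 * ennreal (of_bool (0 < snd z \<and> snd z < t) * ((t - snd z) powr (- 1 / 2) * b (snd z))
            * (gauss (x - fst z) (2 * (t - snd z)) * V (fst z) (snd z)))"
      using c0_pos b by (simp flip: ennreal_mult)
  qed
  also have "\<dots> = ennreal c0 * (ennreal (V x t) * (\<integral>\<^sup>+s\<in>{0<..<t}. ennreal ((t - s) powr (- 1 / 2) * b s) \<partial>lborel))"
    using nn_integral_majorant[OF t assms(2) b, of x] by (subst nn_integral_cmult) auto
  finally show ?thesis by (simp add: mult_ac)
qed

end

section \<open>Retarded approximations\<close>

text \<open>The delay seen as causality: the value at time t is blind to the source after t -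
  \<eta>.\<close>

lemma duhamel_cong:
  assumes "\<And>y s. 0 < s \<Longrightarrow> s < t - \<eta> \<Longrightarrow> f (y, s) = g (y, s)"
  shows "duhamel \<eta> f x t = duhamel \<eta> g x t"
  unfolding duhamel_def
  by (rule Bochner_Integration.integral_cong) (use assms in \<open>auto simp: dkernel_def\<close>)

text \<open>\<open>h\<close> and \<open>H\<close> are supplied by
  \<open>volterra_supersolution\<close>. The constant 2^(N/2) appears twice because it bounds the
  free evolution (\<open>abs_heat_le_double\<close>) as well as the gradient kernel
  (\<open>norm_ggrad_le\<close>).\<close>

locale perturbed_heat =
  fixes \<phi> :: "'a::euclidean_space \<Rightarrow> real" and F :: "'a \<Rightarrow> real \<Rightarrow> real \<Rightarrow> 'a" and C A :: real
    and h :: "real \<Rightarrow> real" and H :: real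
  assumes integrable_phi: "integrable lborel \<phi>"
    and Fcont: "continuous_on (UNIV \<times> {0<..} \<times> UNIV) (\<lambda>(x, t, p). F x t p)"
    and C: "C > 0" and A: "A > 1"
    and Fbound: "\<And>x t p. t > 0 \<Longrightarrow> norm (F x t p) \<le> C * (1 + t) powr (- A + 1/2) * \<bar>p\<bar>"
    and h_measurable [measurable]: "h \<in> borel_measurable borel"
    and h_nonneg: "\<And>t. 0 \<le> h t" and h_le: "\<And>t. h t \<le> H"
    and h_super: "\<And>t. t > 0 \<Longrightarrow> ennreal (2 powr (real DIM('a) / 2)) + ennreal (2 powr (real DIM('a) / 2)) *
       (\<integral>\<^sup>+s\<in>{0<..<t}. ennreal ((t - s) powr (- 1 / 2) * (C * (1 + s) powr (- A + 1 / 2) * h s)) \<partial>lborel) \<le> ennreal (h t)"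
begin

sublocale heat_majorant "\<lambda>x. \<bar>\<phi> x\<bar>"
  by standard (use integrable_phi in auto)

lemma borel_measurable_phi [measurable]: "\<phi> \<in> borel_measurable borel"
  using integrable_phi by auto

lemma H_nonneg: "0 \<le> H"
  using h_nonneg[of 0] h_le[of 0] by linarith

definition b :: "real \<Rightarrow> real" where
  "b s = C * (1 + s) powr (- A + 1 / 2) * h s"

lemma borel_measurable_b [measurable]: "b \<in> borel_measurable borel"
  unfolding b_def by measurable

lemma b_nonneg: "0 \<le> b s"
  using C h_nonneg by (simp add: b_def)

lemma b_le: "s > 0 \<Longrightarrow> b s \<le> C * H"
  using C A h_nonneg[of s] h_le[of s] powr_mono[of "- A + 1 / 2" 0 "1 + s"]
    mult_mono[of "C * (1 + s) powr (- A + 1 / 2)" C "h s" H]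
  by (simp add: b_def)

text \<open>Continuity of F is assumed for positive times only; the extension by zero gives a Borel
  function on all of space-time.\<close>

definition source :: "('a \<times> real \<Rightarrow> real) \<Rightarrow> 'a \<times> real \<Rightarrow> 'a" where
  "source u z = (if snd z > 0 then F (fst z) (snd z) (u z) else 0)"

lemma borel_measurable_source:
  assumes u: "u \<in> borel_measurable borel"
  shows "source u \<in> borel_measurable borel"
proof -
  let ?S = "UNIV \<times> {0<..} \<times> UNIV :: ('a \<times> real \<times> real) set"
  have "?S \<in> sets borel" by (intro borel_open open_Times) auto
  then have "(\<lambda>w. indicator ?S w *\<^sub>R (case w of (x, t, p) \<Rightarrow> F x t p)) \<in> borel_measurable borel"
    using Fcont by (rule borel_measurable_continuous_on_indicator)
  moreover have "(\<lambda>z::'a \<times> real. (fst z, snd z, u z)) \<in> borel_measurable borel"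
    by (intro borel_measurable_Pair u borel_measurable_fst_snd) auto
  ultimately have "(\<lambda>z. indicator ?S (fst z, snd z, u z) *\<^sub>R (case (fst z, snd z, u z) of (x, t, p) \<Rightarrow> F x t p)) \<in> borel_measurable borel"
    by (rule measurable_compose[rotated])
  moreover have "source u = (\<lambda>z. indicator ?S (fst z, snd z, u z) *\<^sub>R (case (fst z, snd z, u z) of (x, t, p) \<Rightarrow> F x t p))"
    by (rule ext) (simp add: source_def indicator_def)
  ultimately show ?thesis by simp
qed

text \<open>The order interval that \<open>step\<close> maps into itself, for every delay.\<close>

definition admissible :: "('a \<times> real \<Rightarrow> real) \<Rightarrow> bool" where
  "admissible u \<longleftrightarrow> u \<in> borel_measurable borel \<and> (\<forall>x t. t > 0 \<longrightarrow> \<bar>u (x, t)\<bar> \<le> h t * V x t)"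

lemma source_bound:
  assumes "admissible u" "s > 0"
  shows "norm (source u (y, s)) \<le> b s * V y s" "norm (source u (y, s)) \<le> C * H * V y s"
proof -
  have "norm (source u (y, s)) \<le> C * (1 + s) powr (- A + 1/2) * \<bar>u (y, s)\<bar>"
    using assms Fbound[OF assms(2)] by (simp add: source_def)
  also have "\<dots> \<le> C * (1 + s) powr (- A + 1/2) * (h s * V y s)"
    using assms C by (intro mult_left_mono) (auto simp: admissible_def)
  also have "\<dots> = b s * V y s" by (simp add: b_def)
  finally show 1: "norm (source u (y, s)) \<le> b s * V y s" .
  also have "\<dots> \<le> C * H * V y s" using b_le[OF assms(2)] by (intro mult_right_mono) auto
  finally show "norm (source u (y, s)) \<le> C * H * V y s" .
qed

definition free :: "'a \<times> real \<Rightarrow> real" where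
  "free z = heat (snd z) \<phi> (fst z)"

definition step :: "real \<Rightarrow> ('a \<times> real \<Rightarrow> real) \<Rightarrow> 'a \<times> real \<Rightarrow> real" where
  "step \<eta> u z = free z + duhamel \<eta> (source u) (fst z) (snd z)"

lemma borel_measurable_free [measurable]: "free \<in> borel_measurable borel"
  unfolding free_def by measurable

lemma abs_free_le: "t > 0 \<Longrightarrow> \<bar>free (x, t)\<bar> \<le> c0 * V x t"
  unfolding free_def c0_def V_def using abs_heat_le_double[OF integrable_phi, of t x] by simp

lemma h_super': "t > 0 \<Longrightarrow> ennreal c0 + ennreal c0 * (\<integral>\<^sup>+s\<in>{0<..<t}. ennreal ((t - s) powr (- 1 / 2) * b s) \<partial>lborel) \<le> ennreal (h t)"
  using h_super unfolding c0_def b_def .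

lemma admissible_free: "admissible free"
  unfolding admissible_def
proof (intro conjI allI impI)
  fix x :: 'a and t :: real assume t: "t > 0"
  \<comment> \<open>The constant term of the supersolution inequality alone.\<close>
  have "ennreal c0 \<le> ennreal (h t)"
    using h_super'[OF t] by (rule order_trans[rotated]) simp
  then have "c0 \<le> h t" using h_nonneg by simp
  then have "c0 * V x t \<le> h t * V x t" by (intro mult_right_mono) auto
  then show "\<bar>free (x, t)\<bar> \<le> h t * V x t" using abs_free_le[OF t, of x] by linarith
qed measurable

lemma admissible_duhamel_bound:
  assumes u: "admissible u" and t: "t > 0" and \<eta>: "\<eta> \<ge> 0"
  shows "ennreal \<bar>duhamel \<eta> (source u) x t\<bar>
    \<le> ennreal (V x t) * (ennreal c0 * (\<integral>\<^sup>+s\<in>{0<..<t}. ennreal ((t - s) powr (- 1 / 2) * b s) \<partial>lborel))"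
  by (rule duhamel_bound)
     (use u t \<eta> source_bound(1)[OF u] b_nonneg in \<open>auto simp: admissible_def intro!: borel_measurable_source\<close>)

text \<open>The supersolution inequality multiplied by V: the free part contributes c0 V, and the
  Duhamel part reproduces V with the scalar Volterra integral as its coefficient.\<close>

lemma admissible_step:
  assumes u: "admissible u" and \<eta>: "\<eta> \<ge> 0"
  shows "admissible (step \<eta> u)"
  unfolding admissible_def
proof (intro conjI allI impI)
  have [measurable]: "source u \<in> borel_measurable borel"
    using u by (auto simp: admissible_def intro!: borel_measurable_source)
  show "step \<eta> u \<in> borel_measurable borel" unfolding step_def by measurable
  fix x :: 'a and t :: real assume t: "t > 0"
  have "ennreal \<bar>step \<eta> u (x, t)\<bar> \<le> ennreal (\<bar>free (x, t)\<bar> + \<bar>duhamel \<eta> (source u) x t\<bar>)"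
    by (intro ennreal_leI) (simp add: step_def)
  also have "\<dots> = ennreal \<bar>free (x, t)\<bar> + ennreal \<bar>duhamel \<eta> (source u) x t\<bar>" by simp
  also have "\<dots> \<le> ennreal (c0 * V x t) + ennreal (V x t) * (ennreal c0 * (\<integral>\<^sup>+s\<in>{0<..<t}. ennreal ((t - s) powr (- 1 / 2) * b s) \<partial>lborel))"
    by (intro add_mono ennreal_leI abs_free_le t admissible_duhamel_bound u \<eta>)
  also have "\<dots> = ennreal (V x t) * (ennreal c0 + ennreal c0 * (\<integral>\<^sup>+s\<in>{0<..<t}. ennreal ((t - s) powr (- 1 / 2) * b s) \<partial>lborel))"
    using c0_pos by (simp add: distrib_left ennreal_mult mult.commute)
  also have "\<dots> \<le> ennreal (V x t) * ennreal (h t)"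
    by (intro mult_left_mono h_super' t) auto
  also have "\<dots> = ennreal (h t * V x t)" using h_nonneg by (simp add: mult.commute flip: ennreal_mult)
  finally show "\<bar>step \<eta> u (x, t)\<bar> \<le> h t * V x t" using h_nonneg by simp
qed

lemma admissible_iterate: "\<eta> \<ge> 0 \<Longrightarrow> admissible ((step \<eta> ^^ k) free)"
  by (induction k) (auto intro: admissible_free admissible_step)

text \<open>The cutoff at \<open>t - \<eta>\<close> makes the iteration stationary after finitely many steps on bounded time
  intervals, so the retarded equation is solved exactly without any Lipschitz condition.\<close>
lemma iterate_stationary:
  assumes "\<eta> > 0" "t \<le> real (Suc k) * \<eta>"
  shows "(step \<eta> ^^ Suc k) free (x, t) = (step \<eta> ^^ k) free (x, t)"
  using assms(2)
proof (induction k arbitrary: x t)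
  case 0
  \<comment> \<open>Here t \<le> \<eta>, so the time window 0 < s < t - \<eta> is empty.\<close>
  have "duhamel \<eta> (source free) x t = duhamel \<eta> (\<lambda>_. 0) x t"
    using 0 by (intro duhamel_cong) auto
  then show ?case by (simp add: step_def duhamel_def)
next
  case (Suc k)
  have "duhamel \<eta> (source ((step \<eta> ^^ Suc k) free)) x t = duhamel \<eta> (source ((step \<eta> ^^ k) free)) x t"
  proof (rule duhamel_cong)
    fix y s assume s: "0 < s" "s < t - \<eta>"
    \<comment> \<open>The kernel looks back by at least \<eta>, so each further iteration extends
      the stationary interval by \<eta>.\<close>
    then have "s \<le> real (Suc k) * \<eta>" using Suc.prems by (simp add: algebra_simps)
    then show "source ((step \<eta> ^^ Suc k) free) (y, s) = source ((step \<eta> ^^ k) free) (y, s)"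
      using Suc.IH[of s y] by (simp add: source_def)
  qed
  then have "step \<eta> ((step \<eta> ^^ Suc k) free) (x, t) = step \<eta> ((step \<eta> ^^ k) free) (x, t)"
    by (simp only: step_def fst_conv snd_conv)
  then show ?case by simp
qed

text \<open>With delay 1/(n + 1) each iteration settles a time interval of that length, so (n + 1)^2
  iterations reach the horizon n + 1. Thus the delay shrinks while the horizon grows.\<close>

definition approx :: "nat \<Rightarrow> 'a \<times> real \<Rightarrow> real" where
  "approx n = (step (inverse (real (Suc n))) ^^ (Suc n * Suc n)) free"

lemma admissible_approx: "admissible (approx n)"
  unfolding approx_def by (rule admissible_iterate) simp

lemma approx_eq:
  assumes "t \<le> real n"
  shows "approx n (x, t) = free (x, t) + duhamel (inverse (real (Suc n))) (source (approx n)) x t"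
proof -
  have "real (Suc (Suc n * Suc n)) * inverse (real (Suc n)) \<ge> real (Suc n * Suc n) * inverse (real (Suc n))"
    by (intro mult_right_mono) auto
  moreover have "real (Suc n * Suc n) * inverse (real (Suc n)) = real (Suc n)"
    by (simp only: of_nat_mult) simp
  moreover have "t \<le> real (Suc n)" using assms by simp
  ultimately have "t \<le> real (Suc (Suc n * Suc n)) * inverse (real (Suc n))" by linarith
  from iterate_stationary[OF _ this, of x]
  have "step (inverse (real (Suc n))) (approx n) (x, t) = approx n (x, t)" by (simp add: approx_def)
  then show ?thesis by (simp add: step_def)
qed

text \<open>Equicontinuity at (x, t), with d independent of n. The modulus \<omega> compares only
  with the undelayed term at the centre, so both values are compared with \<open>duhamel 0\<close>
  at (x, t). The free part, common to all n, is subtracted.\<close>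

lemma approx_oscillation:
  assumes t: "t > 0" and e: "e > 0"
  obtains d N where "d > 0" "\<And>n x' t'. n \<ge> N \<Longrightarrow> dist x' x < d \<Longrightarrow> dist t' t < d \<Longrightarrow> t' > 0 \<Longrightarrow>
    \<bar>(approx n (x', t') - free (x', t')) - (approx n (x, t) - free (x, t))\<bar> < e"
proof -
  define B where "B = C * H"
  have B: "B \<ge> 0" using C H_nonneg by (simp add: B_def)
  \<comment> \<open>Two comparisons, each costing B e'; B + 1 avoids division by zero.\<close>
  define e' where "e' = e / (2 * (B + 1))"
  have e': "e' > 0" "2 * (B * e') < e" using B e by (auto simp: e'_def field_simps)
  obtain d where d: "d > 0" "\<And>\<eta> x' t'. 0 \<le> \<eta> \<Longrightarrow> \<eta> < d \<Longrightarrow> dist x' x < d \<Longrightarrow> dist t' t < d \<Longrightarrow> t' > 0 \<Longrightarrow> \<omega> \<eta> x' t' x t < e'"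
    using modulus_small[OF t e'(1), of x] by blast
  \<comment> \<open>N1 makes the delay smaller than d; N2 puts t and all nearby t' inside the
    horizon where \<open>approx_eq\<close> holds.\<close>
  obtain N1 where N1: "inverse (real (Suc N1)) < d" using reals_Archimedean[OF d(1)] by blast
  obtain N2 :: nat where N2: "t + d \<le> real N2" using real_arch_simple by blast
  show thesis
  proof (rule that[OF d(1)])
    fix n x' t' assume n: "n \<ge> max N1 N2" and x': "dist x' x < d" "dist t' t < d" "t' > 0"
    define \<eta> where "\<eta> = inverse (real (Suc n))"
    have "\<eta> \<le> inverse (real (Suc N1))" unfolding \<eta>_def using n by (intro le_imp_inverse_le) auto
    then have \<eta>: "0 \<le> \<eta>" "\<eta> < d" using N1 by (simp add: \<eta>_def, linarith)
    have tn: "t' \<le> real n" "t \<le> real n"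
      using N2 n x' d(1) by (auto simp: dist_real_def)
    let ?f = "source (approx n)"
    have fm: "?f \<in> borel_measurable borel"
      using admissible_approx by (auto simp: admissible_def intro!: borel_measurable_source)
    have fb: "norm (?f (y, s)) \<le> B * V y s" if "s > 0" for y s
      unfolding B_def by (rule source_bound(2)[OF admissible_approx that])
    have 1: "\<bar>duhamel \<eta> ?f x' t' - duhamel 0 ?f x t\<bar> \<le> B * \<omega> \<eta> x' t' x t"
      by (rule duhamel_diff_le) (use fm fb t x' \<eta> B in auto)
    \<comment> \<open>The modulus at coinciding base points: this is the pure effect of the
      delay.\<close>
    have 2: "\<bar>duhamel \<eta> ?f x t - duhamel 0 ?f x t\<bar> \<le> B * \<omega> \<eta> x t x t"
      by (rule duhamel_diff_le) (use fm fb t x' \<eta> B in auto)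
    have 3: "B * \<omega> \<eta> x' t' x t \<le> B * e'" "B * \<omega> \<eta> x t x t \<le> B * e'"
      using d(2)[OF \<eta> x'] d(2)[OF \<eta>, of x t] d(1) t B by (auto intro!: mult_left_mono)
    have "\<bar>duhamel \<eta> ?f x' t' - duhamel \<eta> ?f x t\<bar> < e"
      using 1 2 3 e'(2) by linarith
    then show "\<bar>(approx n (x', t') - free (x', t')) - (approx n (x, t) - free (x, t))\<bar> < e"
      using approx_eq[OF tn(1), of x'] approx_eq[OF tn(2), of x] by (simp add: \<eta>_def)
  qed
qed

text \<open>An Arzela-Ascoli argument: diagonal extraction on a countable dense set, then
  equicontinuity makes the sequence Cauchy at every point. Pointwise convergence is all that the
  limit passage in the integral equation uses.\<close>

lemma approx_convergent_subsequence:
  obtains k :: "nat \<Rightarrow> nat" where "strict_mono k" "\<And>x t. t > 0 \<Longrightarrow> convergent (\<lambda>n. approx (k n) (x, t))"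
proof -
  obtain S :: "('a \<times> real) set" where S: "countable S" "\<And>U. open U \<Longrightarrow> U \<noteq> {} \<Longrightarrow> \<exists>d\<in>S. d \<in> U"
    using countable_dense_setE by blast
  define S' where "S' = S \<inter> {z. snd z > 0}"
  \<comment> \<open>The extraction principle asks for one bound at all points, whereas h V may blow
    up as t tends to 0; dividing by \<open>w\<close> gives the bound 1.\<close>
  define w where "w z = 1 + h (snd z) * V (fst z) (snd z)" for z
  have w: "w z \<ge> 1" for z using h_nonneg by (simp add: w_def)
  have "\<exists>k. strict_mono (k :: nat \<Rightarrow> nat) \<and> (\<forall>z\<in>S'. \<exists>l. (\<lambda>n. approx (k n) z / w z) \<longlonglongrightarrow> l)"
  proof (rule function_convergent_subsequence[where f = "\<lambda>n z. approx n z / w z" and S = S' and M = 1])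
    show "countable S'" using S(1) by (simp add: S'_def)
    fix n z assume "z \<in> S'"
    then have "\<bar>approx n (fst z, snd z)\<bar> \<le> h (snd z) * V (fst z) (snd z)"
      using admissible_approx[of n] unfolding admissible_def S'_def by blast
    then show "norm (approx n z / w z) \<le> 1" using w[of z] by (simp add: w_def)
  qed blast
  then obtain k where k: "strict_mono (k :: nat \<Rightarrow> nat)" "\<And>z. z \<in> S' \<Longrightarrow> \<exists>l. (\<lambda>n. approx (k n) z / w z) \<longlonglongrightarrow> l"
    by blast
  show thesis
  proof (rule that[OF k(1)])
    fix x :: 'a and t :: real assume t: "t > 0"
    have "Cauchy (\<lambda>n. approx (k n) (x, t))"
    proof (rule metric_CauchyI)
      fix e :: real assume e: "e > 0"
      obtain d N where d: "d > 0" "\<And>n x' t'. n \<ge> N \<Longrightarrow> dist x' x < d \<Longrightarrow> dist t' t < d \<Longrightarrow> t' > 0 \<Longrightarrow>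
          \<bar>(approx n (x', t') - free (x', t')) - (approx n (x, t) - free (x, t))\<bar> < e / 3"
        using approx_oscillation[OF t, of "e / 3" x] e by auto
      \<comment> \<open>Restricting to positive times ensures that the dense point found lies in
        S'.\<close>
      have "open (ball x d \<times> (ball t d \<inter> {0<..}))" by (intro open_Times open_Int) auto
      moreover have "(x, t) \<in> ball x d \<times> (ball t d \<inter> {0<..})" using d t by auto
      ultimately obtain z where z: "z \<in> S" "z \<in> ball x d \<times> (ball t d \<inter> {0<..})" using S(2) by blast
      obtain x' t' where z': "z = (x', t')" by (cases z)
      have xt: "dist x' x < d" "dist t' t < d" "t' > 0" using z(2) z' by (auto simp: dist_commute)
      obtain l where "(\<lambda>n. approx (k n) z / w z) \<longlonglongrightarrow> l" using k(2)[of z] z(1) xt z' by (auto simp: S'_def)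
      from tendsto_mult[OF this tendsto_const[of "w z"]] have "(\<lambda>n. approx (k n) z) \<longlonglongrightarrow> l * w z"
        using w[of z] by simp
      then have "Cauchy (\<lambda>n. approx (k n) z)" by (rule LIMSEQ_imp_Cauchy)
      from metric_CauchyD[OF this, of "e / 3"] e
      obtain M where M: "\<And>m n. m \<ge> M \<Longrightarrow> n \<ge> M \<Longrightarrow> dist (approx (k m) z) (approx (k n) z) < e / 3" by auto
      show "\<exists>M. \<forall>m\<ge>M. \<forall>n\<ge>M. dist (approx (k m) (x, t)) (approx (k n) (x, t)) < e"
      proof (intro exI allI impI)
        fix m n assume mn: "m \<ge> max M N" "n \<ge> max M N"
        have "k m \<ge> N" "k n \<ge> N" using mn seq_suble[OF k(1), of m] seq_suble[OF k(1), of n] by auto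
        \<comment> \<open>Three contributions of e/3; the values of \<open>free\<close> cancel
          between the indices k m and k n.\<close>
        from d(2)[OF this(1) xt] d(2)[OF this(2) xt] M[of m n] mn
        show "dist (approx (k m) (x, t)) (approx (k n) (x, t)) < e"
          unfolding dist_real_def z' by linarith
      qed
    qed
    then show "convergent (\<lambda>n. approx (k n) (x, t))" by (rule Cauchy_convergent)
  qed
qed

text \<open>Now the base point is fixed and delayed kernels are truncations of the undelayed one, so
  a single majorant suffices. Continuity of F in p is used here to pass to the limit in the source
  pointwise.\<close>

lemma mild_solution_exists:
  obtains u where "admissible u" "\<And>x t. t > 0 \<Longrightarrow> u (x, t) = free (x, t) + duhamel 0 (source u) x t"
proof -
  obtain k :: "nat \<Rightarrow> nat" where k: "strict_mono k" "\<And>x t. t > 0 \<Longrightarrow> convergent (\<lambda>n. approx (k n) (x, t))"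
    using approx_convergent_subsequence by blast
  \<comment> \<open>Set to zero for t \<le> 0, where nothing is known about convergence, so that the
    limit exists everywhere and is Borel.\<close>
  define v where "v n z = (if snd z > 0 then approx (k n) z else 0)" for n z
  define u where "u z = lim (\<lambda>n. v n z)" for z
  have vlim: "(\<lambda>n. v n z) \<longlonglongrightarrow> u z" for z
  proof -
    have "convergent (\<lambda>n. v n z)"
      using k(2)[of "snd z" "fst z"] by (cases "snd z > 0") (auto simp: v_def convergent_const)
    then show ?thesis unfolding u_def by (rule convergent_LIMSEQ_iff[THEN iffD1])
  qed
  have [measurable]: "approx n \<in> borel_measurable borel" for n
    using admissible_approx[of n] by (simp add: admissible_def)
  have vm: "v n \<in> borel_measurable borel" for n unfolding v_def by measurable
  have adm: "admissible u"
    unfolding admissible_def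
  proof (intro conjI allI impI)
    show "u \<in> borel_measurable borel" by (rule borel_measurable_LIMSEQ_real[OF vlim vm])
    fix x :: 'a and t :: real assume t: "t > 0"
    have "\<bar>v n (x, t)\<bar> \<le> h t * V x t" for n
      using t admissible_approx[of "k n"] by (simp add: v_def admissible_def)
    then show "\<bar>u (x, t)\<bar> \<le> h t * V x t"
      by (intro tendsto_upperbound[OF tendsto_rabs[OF vlim]]) auto
  qed
  show thesis
  proof (rule that[OF adm])
    fix x :: 'a and t :: real assume t: "t > 0"
    define \<eta> where "\<eta> n = inverse (real (Suc (k n)))" for n
    have \<eta>0: "\<eta> \<longlonglongrightarrow> 0"
      unfolding \<eta>_def using LIMSEQ_subseq_LIMSEQ[OF LIMSEQ_inverse_real_of_nat k(1)] by (simp add: o_def)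
    have \<eta>p: "\<eta> n \<ge> 0" for n by (simp add: \<eta>_def)
    have sm: "source u \<in> borel_measurable borel" if "admissible u" for u
      using that by (auto simp: admissible_def intro!: borel_measurable_source)
    have "(\<lambda>n. duhamel (\<eta> n) (source (approx (k n))) x t) \<longlonglongrightarrow> duhamel 0 (source u) x t"
      unfolding duhamel_def
    proof (rule integral_dominated_convergence[where w = "\<lambda>z. C * H * norm (V (fst z) (snd z) *\<^sub>R dkernel 0 x t z)"])
      show "(\<lambda>z. dkernel 0 x t z \<bullet> source u z) \<in> borel_measurable lborel"
        using sm[OF adm] by simp
      show "(\<lambda>z. dkernel (\<eta> n) x t z \<bullet> source (approx (k n)) z) \<in> borel_measurable lborel" for n
        using sm[OF admissible_approx] by simp
      show "integrable lborel (\<lambda>z. C * H * norm (V (fst z) (snd z) *\<^sub>R dkernel 0 x t z))"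
        using integrable_dkernel[OF t, of 0 x] by (intro integrable_mult_right integrable_norm) auto
      show "AE z in lborel. (\<lambda>n. dkernel (\<eta> n) x t z \<bullet> source (approx (k n)) z) \<longlonglongrightarrow> dkernel 0 x t z \<bullet> source u z"
        using AE_snd_neq[of t]
      proof eventually_elim
        case (elim z)
        have "(\<lambda>n. source (approx (k n)) z) \<longlonglongrightarrow> source u z"
        proof (cases "snd z > 0")
          case True
          have "(\<lambda>n. approx (k n) z) \<longlonglongrightarrow> u z" using vlim[of z] True by (simp add: v_def)
          then have "(\<lambda>n. (fst z, snd z, approx (k n) z)) \<longlonglongrightarrow> (fst z, snd z, u z)" by (intro tendsto_intros)
          from continuous_on_tendsto_compose[OF Fcont this] True
          show ?thesis by (simp add: source_def)
        qed (simp add: source_def)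
        then show ?case by (intro tendsto_inner dkernel_tendsto \<eta>0 tendsto_const elim)
      qed
      fix n
      show "AE z in lborel. norm (dkernel (\<eta> n) x t z \<bullet> source (approx (k n)) z) \<le> C * H * norm (V (fst z) (snd z) *\<^sub>R dkernel 0 x t z)"
      proof (rule AE_I2)
        fix z :: "'a \<times> real"
        show "norm (dkernel (\<eta> n) x t z \<bullet> source (approx (k n)) z) \<le> C * H * norm (V (fst z) (snd z) *\<^sub>R dkernel 0 x t z)"
        proof (cases "snd z > 0")
          case True
          have "norm (dkernel (\<eta> n) x t z \<bullet> source (approx (k n)) z) \<le> norm (dkernel (\<eta> n) x t z) * norm (source (approx (k n)) z)"
            by (simp add: Cauchy_Schwarz_ineq2)
          also have "\<dots> \<le> norm (dkernel 0 x t z) * (C * H * V (fst z) (snd z))"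
            using source_bound(2)[OF admissible_approx True, of "k n" "fst z"] \<eta>p[of n]
            by (intro mult_mono) (auto simp: dkernel_def)
          finally show ?thesis by (simp add: mult_ac)
        qed (simp add: dkernel_def)
      qed
    qed
    then have "(\<lambda>n. free (x, t) + duhamel (\<eta> n) (source (approx (k n))) x t) \<longlonglongrightarrow> free (x, t) + duhamel 0 (source u) x t"
      by (intro tendsto_intros)
    moreover have "\<forall>\<^sub>F n in sequentially. free (x, t) + duhamel (\<eta> n) (source (approx (k n))) x t = v n (x, t)"
    proof -
      obtain N :: nat where N: "t \<le> real N" using real_arch_simple by blast
      show ?thesis
        using eventually_ge_at_top[of N]
      proof eventually_elim
        case (elim n)
        have "N \<le> k n" using elim seq_suble[OF k(1), of n] by simp
        then have "t \<le> real (k n)" using N by simp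
        from approx_eq[OF this, of x] show ?case using t by (simp add: v_def \<eta>_def)
      qed
    qed
    ultimately have "(\<lambda>n. v n (x, t)) \<longlonglongrightarrow> free (x, t) + duhamel 0 (source u) x t"
      by (rule Lim_transform_eventually)
    then show "u (x, t) = free (x, t) + duhamel 0 (source u) x t"
      using vlim LIMSEQ_unique by blast
  qed
qed

end

section \<open>The mild solution\<close>

text \<open>Differentiation under the integral: the mean value theorem bounds the difference
  quotients of the kernel by a global Lipschitz constant, so L |f| dominates.\<close>

lemma heat_has_derivative_line:
  fixes f :: "'a::euclidean_space \<Rightarrow> real"
  assumes f: "integrable lborel f" and t: "t > 0"
  shows "integrable lborel (\<lambda>\<xi>. (ggrad (x - \<xi>) t \<bullet> b) * f \<xi>)"
    and "((\<lambda>h. heat t f (x + h *\<^sub>R b)) has_real_derivative (\<integral>\<xi>. (ggrad (x - \<xi>) t \<bullet> b) * f \<xi> \<partial>lborel)) (at 0)"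
proof -
  have [measurable]: "f \<in> borel_measurable borel" using f by auto
  define L where "L = 2 powr (real DIM('a) / 2) * t powr (- 1 / 2) * (4 * pi * (2 * t)) powr (- real DIM('a) / 2) * norm b"
  have L0: "L \<ge> 0" by (simp add: L_def)
  have gb: "\<bar>ggrad z t \<bullet> b\<bar> \<le> L" for z
  proof -
    have "\<bar>ggrad z t \<bullet> b\<bar> \<le> norm (ggrad z t) * norm b" by (rule Cauchy_Schwarz_ineq2)
    also have "\<dots> \<le> (2 powr (real DIM('a) / 2) * t powr (- 1 / 2) * gauss z (2 * t)) * norm b"
      using norm_ggrad_le[OF t, of z] by (intro mult_right_mono) auto
    also have "\<dots> \<le> L"
      unfolding L_def using gauss_le[of "2 * t" z] t by (intro mult_right_mono mult_left_mono) auto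
    finally show ?thesis .
  qed
  show "integrable lborel (\<lambda>\<xi>. (ggrad (x - \<xi>) t \<bullet> b) * f \<xi>)"
    by (rule Bochner_Integration.integrable_bound[where f = "\<lambda>\<xi>. L * f \<xi>"])
       (use f gb L0 in \<open>auto simp: abs_mult intro!: mult_right_mono\<close>)
  have "((\<lambda>h. (heat t f (x + h *\<^sub>R b) - heat t f x) / h) \<longlongrightarrow> (\<integral>\<xi>. (ggrad (x - \<xi>) t \<bullet> b) * f \<xi> \<partial>lborel)) (at 0)"
    unfolding tendsto_at_iff_sequentially
  proof (intro allI impI)
    fix X :: "nat \<Rightarrow> real" assume X: "\<forall>i. X i \<in> UNIV - {0}" "X \<longlonglongrightarrow> 0"
    have "(\<lambda>n. \<integral>\<xi>. (gauss (x - \<xi> + X n *\<^sub>R b) t - gauss (x - \<xi>) t) / X n * f \<xi> \<partial>lborel)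
        \<longlonglongrightarrow> (\<integral>\<xi>. (ggrad (x - \<xi>) t \<bullet> b) * f \<xi> \<partial>lborel)"
    proof (rule integral_dominated_convergence[where w = "\<lambda>\<xi>. L * \<bar>f \<xi>\<bar>"])
      show "AE \<xi> in lborel. (\<lambda>n. (gauss (x - \<xi> + X n *\<^sub>R b) t - gauss (x - \<xi>) t) / X n * f \<xi>) \<longlonglongrightarrow> (ggrad (x - \<xi>) t \<bullet> b) * f \<xi>"
      proof (intro AE_I2 tendsto_mult tendsto_const)
        fix \<xi>
        have "((\<lambda>h. (gauss (x - \<xi> + h *\<^sub>R b) t - gauss (x - \<xi>) t) / h) \<longlongrightarrow> ggrad (x - \<xi>) t \<bullet> b) (at 0)"
          using gauss_has_derivative_line[OF t, of "x - \<xi>" b 0] by (simp add: DERIV_def)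
        then show "(\<lambda>n. (gauss (x - \<xi> + X n *\<^sub>R b) t - gauss (x - \<xi>) t) / X n) \<longlonglongrightarrow> ggrad (x - \<xi>) t \<bullet> b"
          using X unfolding tendsto_at_iff_sequentially o_def by auto
      qed
      fix n
      have "\<bar>gauss (x - \<xi> + X n *\<^sub>R b) t - gauss (x - \<xi>) t\<bar> \<le> L * \<bar>X n\<bar>" for \<xi>
        using field_differentiable_bound[of UNIV "\<lambda>h. gauss (x - \<xi> + h *\<^sub>R b) t" "\<lambda>h. ggrad (x - \<xi> + h *\<^sub>R b) t \<bullet> b" L "X n" 0]
          gauss_has_derivative_line[OF t, of "x - \<xi>" b] gb by simp
      then show "AE \<xi> in lborel. norm ((gauss (x - \<xi> + X n *\<^sub>R b) t - gauss (x - \<xi>) t) / X n * f \<xi>) \<le> L * \<bar>f \<xi>\<bar>"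
        using X(1) by (intro AE_I2) (auto simp: abs_mult intro!: mult_right_mono simp: divide_le_eq simp del: times_divide_eq_left)
    qed (use f in auto)
    moreover have "(heat t f (x + X n *\<^sub>R b) - heat t f x) / X n
       = (\<integral>\<xi>. (gauss (x - \<xi> + X n *\<^sub>R b) t - gauss (x - \<xi>) t) / X n * f \<xi> \<partial>lborel)" for n
    proof -
      have "(\<integral>\<xi>. (gauss (x - \<xi> + X n *\<^sub>R b) t - gauss (x - \<xi>) t) / X n * f \<xi> \<partial>lborel)
         = (\<integral>\<xi>. (gauss (x + X n *\<^sub>R b - \<xi>) t * f \<xi> - gauss (x - \<xi>) t * f \<xi>) / X n \<partial>lborel)"
        by (intro Bochner_Integration.integral_cong) (auto simp: algebra_simps diff_divide_distrib)
      also have "\<dots> = (heat t f (x + X n *\<^sub>R b) - heat t f x) / X n"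
        using integrable_gauss_mult[OF f t] by (simp add: heat_def)
      finally show ?thesis ..
    qed
    ultimately show "((\<lambda>h. (heat t f (x + h *\<^sub>R b) - heat t f x) / h) \<circ> X) \<longlonglongrightarrow> (\<integral>\<xi>. (ggrad (x - \<xi>) t \<bullet> b) * f \<xi> \<partial>lborel)"
      by (simp only: o_def)
  qed
  then show "((\<lambda>h. heat t f (x + h *\<^sub>R b)) has_real_derivative (\<integral>\<xi>. (ggrad (x - \<xi>) t \<bullet> b) * f \<xi> \<partial>lborel)) (at 0)"
    by (simp add: DERIV_def)
qed

text \<open>Translates the divergence, which is defined through derivatives along coordinate lines,
  into the kernel form on which all estimates rest.\<close>

lemma divg_heatv:
  fixes f :: "'a::euclidean_space \<Rightarrow> 'a"
  assumes f: "integrable lborel f" and t: "t > 0"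
  shows "divg (heatv t f) x = (\<integral>\<xi>. ggrad (x - \<xi>) t \<bullet> f \<xi> \<partial>lborel)"
proof -
  have fb: "integrable lborel (\<lambda>\<xi>. f \<xi> \<bullet> b)" for b using f by simp
  have "deriv (\<lambda>h. heatv t f (x + h *\<^sub>R b) \<bullet> b) 0 = (\<integral>\<xi>. (ggrad (x - \<xi>) t \<bullet> b) * (f \<xi> \<bullet> b) \<partial>lborel)" if "b \<in> Basis" for b
  proof -
    have "(\<lambda>h. heatv t f (x + h *\<^sub>R b) \<bullet> b) = (\<lambda>h. heat t (\<lambda>y. f y \<bullet> b) (x + h *\<^sub>R b))"
      using that by (simp add: heatv_def)
    then show ?thesis using heat_has_derivative_line(2)[OF fb[of b] t, of x b] by (simp add: DERIV_imp_deriv)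
  qed
  then have "divg (heatv t f) x = (\<Sum>b\<in>Basis. \<integral>\<xi>. (ggrad (x - \<xi>) t \<bullet> b) * (f \<xi> \<bullet> b) \<partial>lborel)"
    by (simp add: divg_def)
  also have "\<dots> = (\<integral>\<xi>. (\<Sum>b\<in>Basis. (ggrad (x - \<xi>) t \<bullet> b) * (f \<xi> \<bullet> b)) \<partial>lborel)"
    by (rule Bochner_Integration.integral_sum[symmetric]) (rule heat_has_derivative_line(1)[OF fb t])
  also have "\<dots> = (\<integral>\<xi>. ggrad (x - \<xi>) t \<bullet> f \<xi> \<partial>lborel)"
    by (intro Bochner_Integration.integral_cong refl) (rule euclidean_inner[symmetric])
  finally show ?thesis .
qed

section \<open>Norms of the majorant and the resulting claims on the solution\<close>

context heat_majorant
begin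

lemma V_sup_bound:
  assumes "t > 0"
  shows "V x t \<le> t powr (- real DIM('a) / 2) * (\<integral>y. \<psi> y \<partial>lborel)"
proof -
  have "V x t \<le> (4 * pi * (2 * t)) powr (- real DIM('a) / 2) * (\<integral>y. \<psi> y \<partial>lborel)"
    unfolding V_def using assms by (intro heat_sup_bound integrable_psi psi_nonneg) auto
  also have "\<dots> \<le> t powr (- real DIM('a) / 2) * (\<integral>y. \<psi> y \<partial>lborel)"
    using assms pi_gt3 psi_nonneg
    by (intro mult_right_mono powr_mono2' integral_nonneg_AE) auto
  finally show ?thesis .
qed

lemma nn_integral_V: "t > 0 \<Longrightarrow> (\<integral>\<^sup>+x. ennreal (V x t) \<partial>lborel) = ennreal (\<integral>y. \<psi> y \<partial>lborel)"
  unfolding V_def by (intro nn_integral_heat integrable_psi psi_nonneg) auto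

lemma integrable_V: "t > 0 \<Longrightarrow> integrable lborel (\<lambda>x. V x t)"
  using nn_integral_V[of t] by (intro integrableI_nonneg) auto

end

context perturbed_heat
begin

text \<open>Fubini's theorem reconciles the space-time integral with the time integral of a
  divergence, and also yields the integrability in s.\<close>

lemma duhamel_source_eq:
  fixes x :: 'a
  assumes u: "admissible u" and t: "t > 0"
  defines "I \<equiv> \<lambda>s. divg (heatv (t - s) (\<lambda>y. F y s (u (y, s)))) x"
  shows "set_integrable lborel {0<..<t} I" "(LINT s:{0<..<t}|lborel. I s) = duhamel 0 (source u) x t"
proof -
  have m [measurable]: "source u \<in> borel_measurable borel"
    using u by (auto simp: admissible_def intro!: borel_measurable_source)
  have "integrable lborel (\<lambda>z. dkernel 0 x t z \<bullet> source u z)"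
    by (rule integrable_duhamel[OF m source_bound(2)[OF u]]) (use t in auto)
  then have i: "integrable (lborel \<Otimes>\<^sub>M lborel) (\<lambda>(y, s). dkernel 0 x t (y, s) \<bullet> source u (y, s))"
    by (simp add: lborel_prod case_prod_beta')
  \<comment> \<open>An identity for every s: the slices of the source are integrable at each
    positive time, being bounded by a multiple of V(s).\<close>
  have I: "indicator {0<..<t} s *\<^sub>R I s = (\<integral>y. dkernel 0 x t (y, s) \<bullet> source u (y, s) \<partial>lborel)" for s
  proof (cases "s \<in> {0<..<t}")
    case True
    have "(\<lambda>y. source u (y, s)) \<in> borel_measurable borel" by measurable
    then have "integrable lborel (\<lambda>y. source u (y, s))"
      using True source_bound(2)[OF u, of s] C H_nonneg
      by (intro Bochner_Integration.integrable_bound[OF integrable_mult_right[OF integrable_V[of s], of "C * H"]]) auto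
    then have "integrable lborel (\<lambda>y. F y s (u (y, s)))" using True by (simp add: source_def)
    then show ?thesis using True
      by (simp add: I_def divg_heatv dkernel_def source_def)
  next
    case False
    then have "dkernel 0 x t (y, s) = 0" for y by (auto simp: dkernel_def)
    then show ?thesis using False by simp
  qed
  show "set_integrable lborel {0<..<t} I"
    unfolding set_integrable_def I using lborel_pair.integrable_snd[OF i] by simp
  show "(LINT s:{0<..<t}|lborel. I s) = duhamel 0 (source u) x t"
    unfolding set_lebesgue_integral_def I duhamel_def
    using lborel_pair.integral_snd[OF i] by (simp add: lborel_prod case_prod_beta')
qed

text \<open>The same modulus without delay, applied to the integral equation itself.\<close>

lemma mild_solution_continuous:
  assumes u: "admissible u" and eq: "\<And>x t. t > 0 \<Longrightarrow> u (x, t) = free (x, t) + duhamel 0 (source u) x t"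
  shows "continuous_on (UNIV \<times> {0<..}) u"
  unfolding continuous_on_sequentially
proof (intro allI ballI impI)
  fix Z and z :: "'a \<times> real"
  assume z: "z \<in> UNIV \<times> {0<..}" and Z: "(\<forall>n. Z n \<in> UNIV \<times> {0<..}) \<and> Z \<longlonglongrightarrow> z"
  have t: "snd z > 0" "snd (Z n) > 0" for n using z Z by (auto simp: mem_Times_iff)
  have u_eq: "u w = free w + duhamel 0 (source u) (fst w) (snd w)" if "snd w > 0" for w
    using eq[OF that, of "fst w"] by simp
  have l: "(\<lambda>n. fst (Z n)) \<longlonglongrightarrow> fst z" "(\<lambda>n. snd (Z n)) \<longlonglongrightarrow> snd z"
    using Z by (auto intro!: tendsto_intros)
  have "(\<lambda>n. free (Z n)) \<longlonglongrightarrow> free z"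
    unfolding free_def by (rule tendsto_heat[OF integrable_phi t(1) l])
  moreover have "(\<lambda>n. duhamel 0 (source u) (fst (Z n)) (snd (Z n))) \<longlonglongrightarrow> duhamel 0 (source u) (fst z) (snd z)"
  proof -
    have "(\<lambda>n. \<omega> 0 (fst (Z n)) (snd (Z n)) (fst z) (snd z)) \<longlonglongrightarrow> 0"
      unfolding \<omega>_def by (rule dkernel_L1_tendsto(3)) (use t l in auto)
    from tendsto_mult_right_zero[OF this, of "C * H"]
    have lim: "(\<lambda>n. C * H * \<omega> 0 (fst (Z n)) (snd (Z n)) (fst z) (snd z)) \<longlonglongrightarrow> 0" .
    have "source u \<in> borel_measurable borel"
      using u by (auto simp: admissible_def intro!: borel_measurable_source)
    then have "norm (duhamel 0 (source u) (fst (Z n)) (snd (Z n)) - duhamel 0 (source u) (fst z) (snd z))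
        \<le> C * H * \<omega> 0 (fst (Z n)) (snd (Z n)) (fst z) (snd z)" for n
      unfolding real_norm_def by (rule duhamel_diff_le) (use source_bound(2)[OF u] t C H_nonneg in auto)
    then have "\<forall>\<^sub>F n in sequentially. norm (duhamel 0 (source u) (fst (Z n)) (snd (Z n)) - duhamel 0 (source u) (fst z) (snd z))
        \<le> C * H * \<omega> 0 (fst (Z n)) (snd (Z n)) (fst z) (snd z)"
      by (intro always_eventually allI)
    from LIM_zero_cancel[OF Lim_null_comparison[OF this lim]] show ?thesis .
  qed
  ultimately have "(\<lambda>n. free (Z n) + duhamel 0 (source u) (fst (Z n)) (snd (Z n))) \<longlonglongrightarrow> free z + duhamel 0 (source u) (fst z) (snd z)"
    by (rule tendsto_add)
  then show "(u \<circ> Z) \<longlonglongrightarrow> u z"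
    using u_eq[OF t(1)] u_eq[OF t(2)] by (simp only: o_def)
qed

lemma admissible_le:
  assumes "admissible u" "t > 0"
  shows "\<bar>u (x, t)\<bar> \<le> H * V x t"
  using assms h_le[of t] mult_right_mono[OF h_le[of t] V_nonneg[of x t]] unfolding admissible_def
  by (meson order_trans)

lemma borel_measurable_admissible_slice:
  assumes "admissible u"
  shows "(\<lambda>x. u (x, t)) \<in> borel_measurable borel"
proof -
  have [measurable]: "u \<in> borel_measurable borel" using assms by (simp add: admissible_def)
  show ?thesis by measurable
qed

lemma admissible_Lq_bound:
  assumes u: "admissible u"
  obtains B where "\<And>t q. t > 0 \<Longrightarrow> 1 \<le> q \<Longrightarrow> memLq q (\<lambda>x. u (x, t)) \<and>
    t powr (real DIM('a) / 2 * (1 - inv_exp q)) * Lq_norm q (\<lambda>x. u (x, t)) \<le> B"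
proof -
  define W where "W = (\<integral>y. \<bar>\<phi> y\<bar> \<partial>lborel)"
  \<comment> \<open>The summand 1 provides the strict positivity required by
    \<open>Lq_norm_interpolation\<close>.\<close>
  define m where "m = H * W + 1"
  have W: "W \<ge> 0" unfolding W_def by (rule integral_nonneg_AE) auto
  have m: "m > 0" "H * W \<le> m" using H_nonneg W by (auto simp: m_def add_nonneg_pos)
  have "memLq q (\<lambda>x. u (x, t)) \<and> t powr (real DIM('a) / 2 * (1 - inv_exp q)) * Lq_norm q (\<lambda>x. u (x, t)) \<le> m"
    if t: "t > 0" and q: "1 \<le> q" for t q
  proof -
    have s: "\<bar>u (x, t)\<bar> \<le> t powr (- real DIM('a) / 2) * m" for x
    proof -
      have "\<bar>u (x, t)\<bar> \<le> H * (t powr (- real DIM('a) / 2) * W)"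
        using admissible_le[OF u t, of x] mult_left_mono[OF V_sup_bound[OF t, of x] H_nonneg] by (simp add: W_def)
      also have "\<dots> = t powr (- real DIM('a) / 2) * (H * W)" by simp
      also have "\<dots> \<le> t powr (- real DIM('a) / 2) * m" using m by (intro mult_left_mono) auto
      finally show ?thesis .
    qed
    have "(\<integral>\<^sup>+x. ennreal \<bar>u (x, t)\<bar> \<partial>lborel) \<le> (\<integral>\<^sup>+x. ennreal H * ennreal (V x t) \<partial>lborel)"
      using admissible_le[OF u t] H_nonneg by (intro nn_integral_mono) (auto intro!: ennreal_leI simp flip: ennreal_mult)
    also have "\<dots> = ennreal (H * W)"
      using nn_integral_V[OF t] W H_nonneg by (subst nn_integral_cmult) (auto simp: W_def ennreal_mult)
    also have "\<dots> \<le> ennreal m" using m by (intro ennreal_leI)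
    finally have L: "(\<integral>\<^sup>+x. ennreal \<bar>u (x, t)\<bar> \<partial>lborel) \<le> ennreal m" .
    show ?thesis
      using Lq_norm_interpolation[OF borel_measurable_admissible_slice[OF u] t m(1) q s L] by blast
  qed
  then show thesis by (rule that)
qed

lemma admissible_weighted_bound:
  assumes u: "admissible u" and l: "l \<ge> 0" and w: "integrable lborel (\<lambda>x. (1 + norm x) powr l * \<bar>\<phi> x\<bar>)"
  obtains B where "\<And>t. t > 0 \<Longrightarrow> wmem l (\<lambda>x. u (x, t)) \<and> (1 + t) powr (- l / 2) * wnorm l (\<lambda>x. u (x, t)) \<le> B"
proof -
  obtain c where c: "c > 0" "\<And>t. t > 0 \<Longrightarrow>
      (\<integral>\<^sup>+x. ennreal ((1 + norm x) powr l * V x t) \<partial>lborel) \<le> ennreal (c * (1 + t) powr (l / 2))"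
    using heat_weighted_bound[OF l integrable_psi _ w] by (auto simp: V_def)
  have "wmem l (\<lambda>x. u (x, t)) \<and> (1 + t) powr (- l / 2) * wnorm l (\<lambda>x. u (x, t)) \<le> H * c" if t: "t > 0" for t
  proof -
    note [measurable] = borel_measurable_admissible_slice[OF u]
    have "(\<integral>\<^sup>+x. ennreal ((1 + norm x) powr l * \<bar>u (x, t)\<bar>) \<partial>lborel)
       \<le> (\<integral>\<^sup>+x. ennreal H * ennreal ((1 + norm x) powr l * V x t) \<partial>lborel)"
    proof (rule nn_integral_mono)
      fix x
      have "(1 + norm x) powr l * \<bar>u (x, t)\<bar> \<le> (1 + norm x) powr l * (H * V x t)"
        using admissible_le[OF u t] by (intro mult_left_mono) auto
      then show "ennreal ((1 + norm x) powr l * \<bar>u (x, t)\<bar>) \<le> ennreal H * ennreal ((1 + norm x) powr l * V x t)"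
        using H_nonneg by (auto intro!: ennreal_leI simp: mult_ac simp flip: ennreal_mult)
    qed
    also have "\<dots> \<le> ennreal H * ennreal (c * (1 + t) powr (l / 2))"
      using c(2)[OF t] by (subst nn_integral_cmult) (auto intro!: mult_left_mono)
    also have "\<dots> = ennreal (H * (c * (1 + t) powr (l / 2)))"
      using H_nonneg c by (simp flip: ennreal_mult)
    finally have n: "(\<integral>\<^sup>+x. ennreal ((1 + norm x) powr l * \<bar>u (x, t)\<bar>) \<partial>lborel) \<le> ennreal (H * (c * (1 + t) powr (l / 2)))" .
    then have i: "integrable lborel (\<lambda>x. (1 + norm x) powr l * \<bar>u (x, t)\<bar>)"
      by (intro integrableI_nonneg) (auto intro: le_less_trans)
    have "ennreal (wnorm l (\<lambda>x. u (x, t))) \<le> ennreal (H * (c * (1 + t) powr (l / 2)))"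
      unfolding wnorm_def using n i by (subst nn_integral_eq_integral[symmetric]) auto
    then have "wnorm l (\<lambda>x. u (x, t)) \<le> H * (c * (1 + t) powr (l / 2))" using H_nonneg c by simp
    then have "(1 + t) powr (- l / 2) * wnorm l (\<lambda>x. u (x, t)) \<le> (1 + t) powr (- l / 2) * (H * (c * (1 + t) powr (l / 2)))"
      by (intro mult_left_mono) auto
    also have "\<dots> = H * c" using t by (simp add: powr_minus)
    finally show ?thesis using i by (simp add: wmem_def)
  qed
  then show thesis by (rule that)
qed

text \<open>The error splits into that of the free evolution and the Duhamel term; the latter is at
  most k(t) V with k(t) tending to 0, because \<open>H\<close> turns the Volterra weight
  \<open>b\<close> into the decaying one of \<open>duhamel_weight_decay\<close>.\<close>

lemma mild_solution_asymptotics: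
  assumes u: "admissible u" and eq: "\<And>x t. t > 0 \<Longrightarrow> u (x, t) = free (x, t) + duhamel 0 (source u) x t" and q: "1 \<le> q"
  shows "((\<lambda>t. t powr (real DIM('a) / 2 * (1 - inv_exp q)) *
          Lq_norm q (\<lambda>x. u (x, t) - (LINT y|lborel. \<phi> y) * gauss1 x t)) \<longlongrightarrow> 0) at_top"
proof -
  \<comment> \<open>\<open>N\<close> is the mass of the datum here, not the space dimension.\<close>
  define N where "N = (LINT y|lborel. \<phi> y)"
  define W where "W = (\<integral>y. \<bar>\<phi> y\<bar> \<partial>lborel)"
  have W: "W \<ge> 0" unfolding W_def by (rule integral_nonneg_AE) auto
  obtain J where J: "(J \<longlongrightarrow> 0) at_top" "\<And>t. t > 0 \<Longrightarrow> J t > 0"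
    "\<And>t. t > 0 \<Longrightarrow> (\<integral>\<^sup>+s\<in>{0<..<t}. ennreal ((t - s) powr (- 1 / 2) * (C * (1 + s) powr (- A + 1 / 2))) \<partial>lborel) \<le> ennreal (J t)"
    using duhamel_weight_decay[OF A C] by blast
  obtain m where m: "(m \<longlongrightarrow> 0) at_top" "\<And>t. t > 0 \<Longrightarrow> m t > 0"
    "\<And>t x. t > 0 \<Longrightarrow> \<bar>heat t \<phi> x - N * gauss1 x t\<bar> \<le> t powr (- real DIM('a) / 2) * m t"
    "\<And>t. t > 0 \<Longrightarrow> (\<integral>\<^sup>+x. ennreal \<bar>heat t \<phi> x - N * gauss1 x t\<bar> \<partial>lborel) \<le> ennreal (m t)"
    using heat_asymptotics[OF integrable_phi] unfolding N_def by blast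
  define k where "k t = c0 * (H * J t)" for t
  \<comment> \<open>\<open>W\<close> is the L^1 norm of V and also bounds t^(N/2) V, with N the
    dimension in this exponent, so r t serves the sup bound and the L^1 bound at once.\<close>
  define r where "r t = m t + k t * W" for t
  have k0: "k t \<ge> 0" if "t > 0" for t using J(2)[OF that] c0_pos H_nonneg by (simp add: k_def)
  have D: "\<bar>duhamel 0 (source u) x t\<bar> \<le> k t * V x t" if t: "t > 0" for x t
  proof -
    have "(\<integral>\<^sup>+s\<in>{0<..<t}. ennreal ((t - s) powr (- 1 / 2) * b s) \<partial>lborel)
      \<le> (\<integral>\<^sup>+s. ennreal H * (ennreal ((t - s) powr (- 1 / 2) * (C * (1 + s) powr (- A + 1 / 2))) * indicator {0<..<t} s) \<partial>lborel)"
    proof (rule nn_integral_mono)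
      fix s
      have "(t - s) powr (- 1 / 2) * b s \<le> H * ((t - s) powr (- 1 / 2) * (C * (1 + s) powr (- A + 1 / 2)))"
        unfolding b_def using mult_left_mono[OF h_le[of s], of "(t - s) powr (- 1 / 2) * (C * (1 + s) powr (- A + 1 / 2))"] C
        by (simp add: mult_ac)
      then show "ennreal ((t - s) powr (- 1 / 2) * b s) * indicator {0<..<t} s
         \<le> ennreal H * (ennreal ((t - s) powr (- 1 / 2) * (C * (1 + s) powr (- A + 1 / 2))) * indicator {0<..<t} s)"
        using H_nonneg C by (auto simp: indicator_def intro!: ennreal_leI simp flip: ennreal_mult)
    qed
    also have "\<dots> \<le> ennreal H * ennreal (J t)"
      using J(3)[OF t] by (subst nn_integral_cmult) (auto intro!: mult_left_mono)
    finally have "ennreal (V x t) * (ennreal c0 * (\<integral>\<^sup>+s\<in>{0<..<t}. ennreal ((t - s) powr (- 1 / 2) * b s) \<partial>lborel))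
      \<le> ennreal (V x t) * (ennreal c0 * (ennreal H * ennreal (J t)))"
      by (intro mult_left_mono) auto
    also have "\<dots> = ennreal (k t * V x t)"
      using J(2)[OF t] c0_pos H_nonneg by (simp add: k_def mult_ac flip: ennreal_mult)
    finally have "ennreal \<bar>duhamel 0 (source u) x t\<bar> \<le> ennreal (k t * V x t)"
      using admissible_duhamel_bound[OF u t, of 0 x] by simp
    then show ?thesis using k0[OF t] by simp
  qed
  have est: "0 \<le> Lq_norm q (\<lambda>x. u (x, t) - N * gauss1 x t)"
    "t powr (real DIM('a) / 2 * (1 - inv_exp q)) * Lq_norm q (\<lambda>x. u (x, t) - N * gauss1 x t) \<le> r t" if t: "t > 0" for t
  proof -
    note [measurable] = borel_measurable_admissible_slice[OF u]
    have [measurable]: "(\<lambda>x::'a. gauss1 x t) \<in> borel_measurable borel" unfolding gauss1_def by measurable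
    have pt: "\<bar>u (x, t) - N * gauss1 x t\<bar> \<le> \<bar>heat t \<phi> x - N * gauss1 x t\<bar> + k t * V x t" for x
      using D[OF t, of x] eq[OF t, of x] by (simp add: free_def)
    have r0: "r t > 0" using m(2)[OF t] k0[OF t] W by (simp add: r_def add_pos_nonneg)
    have s: "\<bar>u (x, t) - N * gauss1 x t\<bar> \<le> t powr (- real DIM('a) / 2) * r t" for x
    proof -
      have "k t * V x t \<le> k t * (t powr (- real DIM('a) / 2) * W)"
        unfolding W_def by (intro mult_left_mono V_sup_bound t k0)
      then show ?thesis using pt[of x] m(3)[OF t, of x] by (simp add: r_def algebra_simps)
    qed
    have "(\<integral>\<^sup>+x. ennreal \<bar>u (x, t) - N * gauss1 x t\<bar> \<partial>lborel)
       \<le> (\<integral>\<^sup>+x. ennreal \<bar>heat t \<phi> x - N * gauss1 x t\<bar> + ennreal (k t) * ennreal (V x t) \<partial>lborel)"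
      using pt k0[OF t] by (intro nn_integral_mono) (auto intro!: ennreal_leI simp flip: ennreal_mult ennreal_plus)
    also have "\<dots> = (\<integral>\<^sup>+x. ennreal \<bar>heat t \<phi> x - N * gauss1 x t\<bar> \<partial>lborel) + ennreal (k t) * ennreal W"
      using nn_integral_V[OF t] by (subst nn_integral_add, simp, simp) (simp add: nn_integral_cmult W_def)
    also have "\<dots> \<le> ennreal (m t) + ennreal (k t) * ennreal W"
      by (intro add_mono m(4) t) auto
    also have "\<dots> = ennreal (r t)"
      using m(2)[OF t] k0[OF t] W by (simp add: r_def flip: ennreal_mult ennreal_plus)
    finally have L: "(\<integral>\<^sup>+x. ennreal \<bar>u (x, t) - N * gauss1 x t\<bar> \<partial>lborel) \<le> ennreal (r t)" .
    have "(\<lambda>x. u (x, t) - N * gauss1 x t) \<in> borel_measurable borel" by measurable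
    from Lq_norm_interpolation[OF this t r0 q s L]
    show "0 \<le> Lq_norm q (\<lambda>x. u (x, t) - N * gauss1 x t)"
      "t powr (real DIM('a) / 2 * (1 - inv_exp q)) * Lq_norm q (\<lambda>x. u (x, t) - N * gauss1 x t) \<le> r t" by auto
  qed
  have "((\<lambda>t. m t + c0 * (H * J t) * W) \<longlongrightarrow> 0 + c0 * (H * 0) * W) at_top"
    by (intro tendsto_intros m(1) J(1))
  then have rlim: "(r \<longlongrightarrow> 0) at_top" by (simp add: r_def[abs_def] k_def)
  show ?thesis
    unfolding N_def[symmetric]
  proof (rule tendsto_sandwich[OF _ _ tendsto_const rlim])
    show "\<forall>\<^sub>F t in at_top. 0 \<le> t powr (real DIM('a) / 2 * (1 - inv_exp q)) * Lq_norm q (\<lambda>x. u (x, t) - N * gauss1 x t)"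
      using eventually_gt_at_top[of 0] by eventually_elim (simp add: est)
    show "\<forall>\<^sub>F t in at_top. t powr (real DIM('a) / 2 * (1 - inv_exp q)) * Lq_norm q (\<lambda>x. u (x, t) - N * gauss1 x t) \<le> r t"
      using eventually_gt_at_top[of 0] by eventually_elim (rule est(2))
  qed
qed

end

lemma integrable_weight_mono:
  fixes \<phi> :: "'a::euclidean_space \<Rightarrow> real"
  assumes "wmem K \<phi>" "l \<le> K"
  shows "integrable lborel (\<lambda>x. (1 + norm x) powr l * \<bar>\<phi> x\<bar>)"
proof (rule Bochner_Integration.integrable_bound)
  show "integrable lborel (\<lambda>x. (1 + norm x) powr K * \<bar>\<phi> x\<bar>)" using assms by (simp add: wmem_def)
  have [measurable]: "\<phi> \<in> borel_measurable borel" using assms by (simp add: wmem_def)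
  show "(\<lambda>x. (1 + norm x) powr l * \<bar>\<phi> x\<bar>) \<in> borel_measurable lborel" by measurable
  show "AE x in lborel. norm ((1 + norm x) powr l * \<bar>\<phi> x\<bar>) \<le> norm ((1 + norm x) powr K * \<bar>\<phi> x\<bar>)"
    using assms(2) by (auto simp: abs_mult intro!: mult_right_mono powr_mono)
qed

theorem theorem3p2:
  fixes \<phi> :: "'a::euclidean_space \<Rightarrow> real"
    and F :: "'a \<Rightarrow> real \<Rightarrow> real \<Rightarrow> 'a"
    and K C A :: real
  assumes K: "K \<ge> 0"
    and phi: "wmem K \<phi>"
    and Fcont: "continuous_on (UNIV \<times> {0<..} \<times> UNIV) (\<lambda>(x, t, p). F x t p)"
    and C: "C > 0" and A: "A > 1"
    and Fbound: "\<And>x t p. t > 0 \<Longrightarrow> norm (F x t p) \<le> C * (1 + t) powr (- A + 1/2) * \<bar>p\<bar>"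
  shows "\<exists>u :: 'a \<Rightarrow> real \<Rightarrow> real.
    continuous_on (UNIV \<times> {0<..}) (\<lambda>(x, t). u x t) \<and>
    (\<forall>q l. 1 \<le> q \<and> 0 \<le> l \<and> l \<le> K \<longrightarrow>
       (\<exists>B. \<forall>t>0. memLq q (\<lambda>x. u x t) \<and> wmem l (\<lambda>x. u x t) \<and>
          t powr (real DIM('a) / 2 * (1 - inv_exp q)) * Lq_norm q (\<lambda>x. u x t)
          + (1 + t) powr (- l / 2) * wnorm l (\<lambda>x. u x t) \<le> B)) \<and>
    (AE z in (lborel :: ('a \<times> real) measure). snd z > 0 \<longrightarrow>
       (let x = fst z; t = snd z;
            I = (\<lambda>s. divg (heatv (t - s) (\<lambda>y. F y s (u y s))) x)
        in set_integrable lborel {0<..<t} I \<and>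
           u x t = heat t \<phi> x + (LINT s:{0<..<t}|lborel. I s))) \<and>
    (\<forall>q. 1 \<le> q \<longrightarrow>
       ((\<lambda>t. t powr (real DIM('a) / 2 * (1 - inv_exp q)) *
          Lq_norm q (\<lambda>x. u x t - (LINT y|lborel. \<phi> y) * gauss1 x t)) \<longlongrightarrow> 0) at_top)"
proof -
  \<comment> \<open>The weight of order 0 is trivial, so the weighted hypothesis contains plain
    integrability of \<phi>.\<close>
  have "(1 + norm x) powr 0 = 1" for x :: 'a
    using norm_ge_zero[of x] by (simp add: add_nonneg_eq_0_iff)
  then have "integrable lborel (\<lambda>x. \<bar>\<phi> x\<bar>)" using integrable_weight_mono[OF phi K] by simp
  moreover have "\<phi> \<in> borel_measurable lborel" using phi by (simp add: wmem_def)
  ultimately have int: "integrable lborel \<phi>" by (rule integrable_abs_cancel)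
  obtain h :: "real \<Rightarrow> real" and H where h: "h \<in> borel_measurable borel" "\<And>t. 0 \<le> h t" "\<And>t. h t \<le> H"
    "\<And>t. t > 0 \<Longrightarrow> ennreal (2 powr (real DIM('a) / 2)) + ennreal (2 powr (real DIM('a) / 2)) *
       (\<integral>\<^sup>+s\<in>{0<..<t}. ennreal ((t - s) powr (- 1 / 2) * (C * (1 + s) powr (- A + 1 / 2) * h s)) \<partial>lborel) \<le> ennreal (h t)"
    using volterra_supersolution[OF A C, of "2 powr (real DIM('a) / 2)"] by auto
  interpret perturbed_heat \<phi> F C A h H
    by standard (use int Fcont C A Fbound h in auto)
  obtain u where u: "admissible u" and eq: "\<And>x t. t > 0 \<Longrightarrow> u (x, t) = free (x, t) + duhamel 0 (source u) x t"
    using mild_solution_exists by blast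
  show ?thesis
  proof (intro exI[of _ "\<lambda>x t. u (x, t)"] conjI allI impI)
    show "continuous_on (UNIV \<times> {0<..}) (\<lambda>(x, t). u (x, t))"
      using mild_solution_continuous[OF u eq] by simp
  next
    fix q :: ereal and l assume ql: "1 \<le> q \<and> 0 \<le> l \<and> l \<le> K"
    obtain B1 where B1: "\<And>t q. t > 0 \<Longrightarrow> 1 \<le> q \<Longrightarrow> memLq q (\<lambda>x. u (x, t)) \<and>
        t powr (real DIM('a) / 2 * (1 - inv_exp q)) * Lq_norm q (\<lambda>x. u (x, t)) \<le> B1"
      using admissible_Lq_bound[OF u] by blast
    obtain B2 where B2: "\<And>t. t > 0 \<Longrightarrow> wmem l (\<lambda>x. u (x, t)) \<and> (1 + t) powr (- l / 2) * wnorm l (\<lambda>x. u (x, t)) \<le> B2"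
      using admissible_weighted_bound[OF u _ integrable_weight_mono[OF phi]] ql by blast
    show "\<exists>B. \<forall>t>0. memLq q (\<lambda>x. u (x, t)) \<and> wmem l (\<lambda>x. u (x, t)) \<and>
          t powr (real DIM('a) / 2 * (1 - inv_exp q)) * Lq_norm q (\<lambda>x. u (x, t))
          + (1 + t) powr (- l / 2) * wnorm l (\<lambda>x. u (x, t)) \<le> B"
      using B1[of _ q] B2 ql by (intro exI[of _ "B1 + B2"]) (auto intro: add_mono)
  next
    \<comment> \<open>The integral equation is in fact available at every point with t > 0.\<close>
    show "AE z in (lborel :: ('a \<times> real) measure). snd z > 0 \<longrightarrow>
       (let x = fst z; t = snd z;
            I = (\<lambda>s. divg (heatv (t - s) (\<lambda>y. F y s (u (y, s)))) x)
        in set_integrable lborel {0<..<t} I \<and>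
           u (x, t) = heat t \<phi> x + (LINT s:{0<..<t}|lborel. I s))"
      using duhamel_source_eq[OF u] eq by (intro AE_I2) (simp add: Let_def free_def)
  next
    fix q :: ereal assume q: "1 \<le> q"
    show "((\<lambda>t. t powr (real DIM('a) / 2 * (1 - inv_exp q)) *
          Lq_norm q (\<lambda>x. u (x, t) - (LINT y|lborel. \<phi> y) * gauss1 x t)) \<longlongrightarrow> 0) at_top"
      by (rule mild_solution_asymptotics[OF u _ q]) (rule eq)
  qed
qed

end
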